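(* Let $B=\{\mathbf{x}\in\mathbb{R}^2:|\mathbf{x}|<1\}$ and let $f=u\chi_\Omega$, where $\Omega\subset B$ is a compact domain with smooth boundary and $u\in C_c^\infty(\mathbb{R}^2)$ with $u>0$ on $\Omega$. Let the smoothing kernel satisfy $\varphi\in H^{\lambda,\infty}(\mathbb{R}^2)$. Fix $\phi\in[-\pi,\pi]$ and let $g=e^{-\widetilde{\mathcal{V}_L}f(\cdot,\phi)}$. Then, for any cutoff function $\eta\in C_c^\infty(\mathbb{R}^2)$ and any $\alpha<1/2$, $\eta g\in H^{\alpha+\lambda,2}(\mathbb{R}^2)$ and $\eta g\in H^{\alpha+\lambda-1,1}(\mathbb{R}^2)$.
   Context: Fourier transform: $\hat f(\xi)=\int e^{-i\mathbf{x}\cdot\xi}f(\mathbf{x})\,d\mathbf{x}$. For $\alpha\in\mathbb{R}$, $1\le p\le\infty$, $H^{\alpha,p}(\mathbb{R}^n)$ is the space of tempered distributions $f$ whose Fourier transform is a measurable function with $\|f\|_{H^{\alpha,p}(\mathbb{R}^n)}=\|(1+|\xi|^2)^{\alpha/2}\hat f\|_{L^p(\mathbb{R}^n)}<\infty$. $\chi_\Omega$ is the characteristic function of $\Omega$. Fix $a,b>0$, $2\psi\in(0,\pi)$, $\nu>0$. The finite-length V-line transform is $$\mathcal{V}_Lf(\mathbf{x},\phi)=a\int_0^\nu f(\mathbf{x}+t\Phi)\,dt+b\int_0^\nu f(\mathbf{x}+t\Phi')\,dt,$$ where $\Phi=(\cos(\phi+2\psi-\pi/2),\sin(\phi+2\psi-\pi/2))$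 and $\Phi'=(\cos(\phi-\pi/2),\sin(\phi-\pi/2))$. Its smoothed version is $\widetilde{\mathcal{V}_L}f(\cdot,\phi)=\varphi*\mathcal{V}_Lf(\cdot,\phi)$ (convolution in $\mathbf{x}$), where $\varphi\ge 0$ is a smoothing kernel with $\int_{\mathbb{R}^2}\varphi=1$. *)

theory Defs
  imports "HOL-Analysis.Analysis" "HOL-Probability.Essential_Supremum"
begin

text \<open>\<open>iter_deriv [v1, ..., vk] f\<close> is the iterated directional derivative
  \<open>D_v1 (... (D_vk f))\<close>.  It is meaningful only where the derivatives involved exist;
  \<open>smooth_on\<close> requires exactly this, for all partial derivatives of all orders.\<close>

fun iter_deriv :: "'a::euclidean_space list \<Rightarrow> ('a \<Rightarrow> 'b::real_normed_vector) \<Rightarrow> 'a \<Rightarrow> 'b" where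
  "iter_deriv [] f = f"
| "iter_deriv (v # vs) f = (\<lambda>x. frechet_derivative (iter_deriv vs f) (at x) v)"

text \<open>Intended for open \<open>S\<close>.\<close>

definition smooth_on :: "'a::euclidean_space set \<Rightarrow> ('a \<Rightarrow> 'b::real_normed_vector) \<Rightarrow> bool" where
  "smooth_on S f \<longleftrightarrow>
     (\<forall>vs \<in> lists Basis. \<forall>x\<in>S. iter_deriv vs f differentiable (at x))"

definition test_function :: "('a::euclidean_space \<Rightarrow> 'b::real_normed_vector) \<Rightarrow> bool" where
  "test_function f \<longleftrightarrow> smooth_on UNIV f \<and> compact (closure {x. f x \<noteq> 0})"

text \<open>Near each boundary point, \<open>\<Omega>\<close> is a sublevel set of a smooth function
  without critical points.\<close>

definition smooth_boundary :: "'a::euclidean_space set \<Rightarrow> bool" where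
  "smooth_boundary \<Omega> \<longleftrightarrow>
     (\<forall>p \<in> frontier \<Omega>. \<exists>U (\<rho> :: 'a \<Rightarrow> real). open U \<and> p \<in> U \<and> smooth_on U \<rho> \<and>
        (\<forall>x\<in>U. \<exists>v. frechet_derivative \<rho> (at x) v \<noteq> 0) \<and>
        \<Omega> \<inter> U = {x \<in> U. \<rho> x \<le> 0})"

definition compact_smooth_domain :: "'a::euclidean_space set \<Rightarrow> bool" where
  "compact_smooth_domain \<Omega> \<longleftrightarrow>
     compact \<Omega> \<and> \<Omega> \<noteq> {} \<and> \<Omega> = closure (interior \<Omega>) \<and> connected (interior \<Omega>) \<and>
     smooth_boundary \<Omega>"

definition schwartz :: "('a::euclidean_space \<Rightarrow> complex) set" where
  "schwartz = {f. smooth_on UNIV f \<and>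
     (\<forall>k. \<forall>vs \<in> lists Basis. bounded (range (\<lambda>x. norm x ^ k *\<^sub>R iter_deriv vs f x)))}"

definition schwartz_norm :: "nat \<Rightarrow> ('a::euclidean_space \<Rightarrow> complex) \<Rightarrow> real" where
  "schwartz_norm N f =
     (\<Sum>k\<le>N. \<Sum>vs \<in> {vs \<in> lists Basis. length vs \<le> N}.
        (SUP x. norm x ^ k * norm (iter_deriv vs f x)))"

text \<open>A distribution is represented by a functional on all functions of which only the
  restriction to \<open>schwartz\<close> is ever used.\<close>

definition tempered_distribution :: "(('a::euclidean_space \<Rightarrow> complex) \<Rightarrow> complex) \<Rightarrow> bool" where
  "tempered_distribution T \<longleftrightarrow>
     (\<forall>f\<in>schwartz. \<forall>g\<in>schwartz. T (\<lambda>x. f x + g x) = T f + T g) \<and>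
     (\<forall>c. \<forall>f\<in>schwartz. T (\<lambda>x. c * f x) = c * T f) \<and>
     (\<exists>N C. \<forall>f\<in>schwartz. norm (T f) \<le> C * schwartz_norm N f)"

definition dist_of :: "('a::euclidean_space \<Rightarrow> complex) \<Rightarrow> ('a \<Rightarrow> complex) \<Rightarrow> complex" where
  "dist_of h = (\<lambda>f. LINT x|lebesgue. h x * f x)"

definition fourier :: "('a::euclidean_space \<Rightarrow> complex) \<Rightarrow> 'a \<Rightarrow> complex" where
  "fourier f \<xi> = (LINT x|lebesgue. exp (- \<i> * of_real (x \<bullet> \<xi>)) * f x)"

definition dist_fourier ::
  "(('a::euclidean_space \<Rightarrow> complex) \<Rightarrow> complex) \<Rightarrow> ('a \<Rightarrow> complex) \<Rightarrow> complex" where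
  "dist_fourier T = (\<lambda>f. T (fourier f))"

text \<open>Intended for measurable \<open>f\<close> and \<open>1 \<le> p \<le> \<infinity>\<close>.\<close>

definition Lp_norm :: "ennreal \<Rightarrow> 'a measure \<Rightarrow> ('a \<Rightarrow> complex) \<Rightarrow> ennreal" where
  "Lp_norm p M f =
     (if p = \<infinity> then esssup M (\<lambda>x. ennreal (norm (f x)))
      else (let I = \<integral>\<^sup>+ x. ennreal (norm (f x) powr enn2real p) \<partial>M
            in if I = \<infinity> then \<infinity> else ennreal (enn2real I powr (1 / enn2real p))))"

definition H_space ::
  "real \<Rightarrow> ennreal \<Rightarrow> (('a::euclidean_space \<Rightarrow> complex) \<Rightarrow> complex) set" where
  "H_space \<alpha> p = {T. tempered_distribution T \<and>
     (\<exists>h \<in> borel_measurable lebesgue.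
        (\<forall>f\<in>schwartz. integrable lebesgue (\<lambda>\<xi>. h \<xi> * f \<xi>) \<and> dist_fourier T f = dist_of h f) \<and>
        Lp_norm p lebesgue (\<lambda>\<xi>. of_real ((1 + (norm \<xi>)\<^sup>2) powr (\<alpha> / 2)) * h \<xi>) < \<infinity>)}"

definition direction :: "real \<Rightarrow> real^2" where
  "direction \<theta> = vector [cos \<theta>, sin \<theta>]"

definition vline :: "real \<Rightarrow> real \<Rightarrow> real \<Rightarrow> real \<Rightarrow> (real^2 \<Rightarrow> real) \<Rightarrow> real^2 \<Rightarrow> real \<Rightarrow> real" where
  "vline a b \<psi> \<nu> f x \<phi> =
     a * (LINT t:{0..\<nu>}|lebesgue. f (x + t *\<^sub>R direction (\<phi> + 2 * \<psi> - pi / 2))) +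
     b * (LINT t:{0..\<nu>}|lebesgue. f (x + t *\<^sub>R direction (\<phi> - pi / 2)))"

definition convol :: "('a::euclidean_space \<Rightarrow> real) \<Rightarrow> ('a \<Rightarrow> real) \<Rightarrow> 'a \<Rightarrow> real" where
  "convol k f x = (LINT y|lebesgue. k (x - y) * f y)"

definition smoothing_kernel :: "('a::euclidean_space \<Rightarrow> real) \<Rightarrow> bool" where
  "smoothing_kernel k \<longleftrightarrow>
     (\<forall>x. 0 \<le> k x) \<and> integrable lebesgue k \<and> (LINT x|lebesgue. k x) = 1"

definition smoothed_vline ::
  "(real^2 \<Rightarrow> real) \<Rightarrow> real \<Rightarrow> real \<Rightarrow> real \<Rightarrow> real \<Rightarrow> (real^2 \<Rightarrow> real) \<Rightarrow> real^2 \<Rightarrow> real \<Rightarrow> real" where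
  "smoothed_vline k a b \<psi> \<nu> f x \<phi> = convol k (\<lambda>y. vline a b \<psi> \<nu> f y \<phi>) x"

end

theory Submission
  imports Defs "HOL-Probability.Characteristic_Functions"
begin

text \<open>Differences \<open>f(x + h) - f(x)\<close> of \<open>f = u \<chi>\<^sub>\<Omega>\<close> are supported, up to a Lipschitz error, in an
  \<open>|h|\<close>-neighbourhood of the boundary, whose area is \<open>O(|h|)\<close>. With Bessel's inequality this puts \<open>f\<close>
  in \<open>H\<^sup>r\<close> for every \<open>r < 1/2\<close>. The smoothed transform is \<open>F = \<mu> * P\<close> with \<open>P = k * f\<close> and a finite
  measure \<open>\<mu>\<close> on two segments, so \<open>P\<close> and \<open>F\<close> gain \<open>l\<close> derivatives. It remains to compose with the
  exponential. For order \<open>s < 1\<close> the description of Sobolev spaces by differences (with an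
  arbitrarily small loss) is stable under Lipschitz maps. For order \<open>s > 1\<close>, half the dimension,
  the weighted \<open>L\<^sup>2\<close> space is a convolution algebra and the exponential series converges in it. Since
  the inequality \<open>\<alpha> < 1/2\<close> is strict, \<open>\<alpha>\<close> can be increased slightly to absorb the loss, to avoid the
  order 1, and to pass from \<open>L\<^sup>2\<close> to \<open>L\<^sup>1\<close> with weight exponent lowered by 1. Negative \<open>l\<close> reduces to
  \<open>l = 0\<close> because \<open>k\<close> is integrable.\<close>

text \<open>Two obstacles shape the route. Below order 1 the exponential is controlled in
  \<open>x\<close>-space, whereas the gain from the kernel is visible only as decay of its
  transform; hence the passage from transforms to differences and back. The way back sums a series
  over dyadic steps with ratio \<open>4 powr (r - s)\<close>, and this is the origin of the loss.
  The passage from transforms to differences, and the inversion formula used above order 1, speak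
  about values at points and ask for a continuous function. The function \<open>f\<close> jumps
  across the boundary, but its discontinuities form a null set, so \<open>P\<close> is continuous.
  This is why the segment integrals are moved outside the convolution and every estimate starts from
  \<open>P\<close>. Above half the dimension the cutoff is carried through the whole exponential
  series: it makes each term integrable, while \<open>exp (- F)\<close> alone, bounded below by a
  positive constant, is not.\<close>

lemma borel_measurable_cis [measurable (raw)]:
  "f \<in> borel_measurable M \<Longrightarrow> (\<lambda>x. cis (f x)) \<in> borel_measurable M"
  by (rule borel_measurable_continuous_on[of cis]) (auto simp: cis_conv_exp intro!: continuous_intros)

lemma fourier_lborel:
  assumes [measurable]: "f \<in> borel_measurable borel"
  shows "fourier f \<xi> = (LINT x|lborel. cis (- (x \<bullet> \<xi>)) * f x)"
proof -
  have "exp (- \<i> * of_real (x \<bullet> \<xi>)) = cis (- (x \<bullet> \<xi>))" for x :: 'a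
    by (simp add: cis_conv_exp)
  then show ?thesis unfolding fourier_def by (subst integral_completion) auto
qed

section \<open>Changes of variables and integrability on products\<close>

lemma nn_integral_lborel_affine:
  fixes f :: "'a::euclidean_space \<Rightarrow> ennreal"
  assumes [measurable]: "f \<in> borel_measurable borel" and "c \<noteq> 0"
  shows "(\<integral>\<^sup>+x. f x \<partial>lborel) = ennreal (\<bar>c\<bar> ^ DIM('a)) * (\<integral>\<^sup>+x. f (t + c *\<^sub>R x) \<partial>lborel)"
  by (subst lborel_affine[OF \<open>c \<noteq> 0\<close>, of t])
     (simp add: nn_integral_density nn_integral_distr nn_integral_cmult)

lemma lborel_integral_affine:
  fixes f :: "'a::euclidean_space \<Rightarrow> 'b::{banach, second_countable_topology}"
  assumes [measurable]: "f \<in> borel_measurable borel" and "c \<noteq> 0"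
  shows "(LINT x|lborel. f x) = \<bar>c\<bar> ^ DIM('a) *\<^sub>R (LINT x|lborel. f (t + c *\<^sub>R x))"
  by (subst lborel_affine[OF \<open>c \<noteq> 0\<close>, of t])
     (simp add: integral_density integral_distr)

lemma integrable_lborel_affine:
  fixes f :: "'a::euclidean_space \<Rightarrow> 'b::{banach, second_countable_topology}"
  assumes "integrable lborel f" and "c \<noteq> 0"
  shows "integrable lborel (\<lambda>x. f (t + c *\<^sub>R x))"
proof -
  have [measurable]: "f \<in> borel_measurable borel" using assms by auto
  have "integrable (density (distr lborel borel (\<lambda>x::'a. t + c *\<^sub>R x)) (\<lambda>_. ennreal (\<bar>c\<bar> ^ DIM('a)))) f"
    using lborel_affine[OF \<open>c \<noteq> 0\<close>, of t] assms by metis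
  then have "integrable lborel (\<lambda>x. \<bar>c\<bar> ^ DIM('a) *\<^sub>R f (t + c *\<^sub>R x))"
    by (subst (asm) integrable_density) (auto simp: integrable_distr_eq)
  from integrable_scaleR_right[OF this, of "1 / \<bar>c\<bar> ^ DIM('a)"] show ?thesis
    using \<open>c \<noteq> 0\<close> by simp
qed

lemma nn_integral_lborel_shift:
  fixes f :: "'a::euclidean_space \<Rightarrow> ennreal"
  assumes "f \<in> borel_measurable borel"
  shows "(\<integral>\<^sup>+x. f (t + x) \<partial>lborel) = (\<integral>\<^sup>+x. f x \<partial>lborel)"
  using nn_integral_lborel_affine[OF assms, of 1 t] by simp

lemma nn_integral_lborel_reflect:
  fixes f :: "'a::euclidean_space \<Rightarrow> ennreal"
  assumes "f \<in> borel_measurable borel"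
  shows "(\<integral>\<^sup>+x. f (t - x) \<partial>lborel) = (\<integral>\<^sup>+x. f x \<partial>lborel)"
  using nn_integral_lborel_affine[OF assms, of "-1" t] by simp

lemma lborel_integral_shift:
  fixes f :: "'a::euclidean_space \<Rightarrow> 'b::{banach, second_countable_topology}"
  assumes "f \<in> borel_measurable borel"
  shows "(LINT x|lborel. f (t + x)) = (LINT x|lborel. f x)"
  using lborel_integral_affine[OF assms, of 1 t] by simp

lemma lborel_integral_reflect:
  fixes f :: "'a::euclidean_space \<Rightarrow> 'b::{banach, second_countable_topology}"
  assumes "f \<in> borel_measurable borel"
  shows "(LINT x|lborel. f (t - x)) = (LINT x|lborel. f x)"
  using lborel_integral_affine[OF assms, of "-1" t] by simp

lemma integrable_lborel_pairI:
  fixes F :: "'a::euclidean_space \<Rightarrow> 'b::euclidean_space \<Rightarrow> 'c::{banach, second_countable_topology}"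
  assumes [measurable]: "case_prod F \<in> borel_measurable (lborel \<Otimes>\<^sub>M lborel)"
    and "(\<integral>\<^sup>+x. (\<integral>\<^sup>+y. norm (F x y) \<partial>lborel) \<partial>lborel) < \<infinity>"
  shows "integrable (lborel \<Otimes>\<^sub>M lborel) (case_prod F)"
  unfolding integrable_iff_bounded
proof
  have "(\<integral>\<^sup>+z. norm (case_prod F z) \<partial>(lborel \<Otimes>\<^sub>M lborel)) = (\<integral>\<^sup>+x. (\<integral>\<^sup>+y. norm (F x y) \<partial>lborel) \<partial>lborel)"
    by (subst lborel.nn_integral_fst[symmetric]) auto
  then show "(\<integral>\<^sup>+z. norm (case_prod F z) \<partial>(lborel \<Otimes>\<^sub>M lborel)) < \<infinity>" using assms by simp
qed fact

text \<open>Domination by a tensor product. Oscillating factors \<open>cis\<close> have modulus 1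
  and drop out, so this justifies most interchanges of integrals below; convolutions of two
  integrable functions do not fit and use \<open>integrable_lborel_pairI\<close> directly.\<close>

lemma integrable_lborel_pair_bound:
  fixes F :: "'a::euclidean_space \<Rightarrow> 'b::euclidean_space \<Rightarrow> 'c::{banach, second_countable_topology}"
    and g :: "'a \<Rightarrow> 'd::{banach, second_countable_topology}" and h :: "'b \<Rightarrow> 'e::{banach, second_countable_topology}"
  assumes [measurable]: "case_prod F \<in> borel_measurable (lborel \<Otimes>\<^sub>M lborel)"
    and g: "integrable lborel g" and h: "integrable lborel h"
    and le: "\<And>x y. norm (F x y) \<le> norm (g x) * norm (h y)"
  shows "integrable (lborel \<Otimes>\<^sub>M lborel) (case_prod F)"
proof (rule integrable_lborel_pairI)
  have [measurable]: "g \<in> borel_measurable borel" "h \<in> borel_measurable borel" using g h by auto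
  have "(\<integral>\<^sup>+x. (\<integral>\<^sup>+y. norm (F x y) \<partial>lborel) \<partial>lborel) \<le>
    (\<integral>\<^sup>+x. (\<integral>\<^sup>+y. ennreal (norm (g x)) * ennreal (norm (h y)) \<partial>lborel) \<partial>lborel)"
    by (intro nn_integral_mono) (auto simp flip: ennreal_mult intro!: ennreal_leI le)
  also have "\<dots> = (\<integral>\<^sup>+x. norm (g x) \<partial>lborel) * (\<integral>\<^sup>+y. norm (h y) \<partial>lborel)"
    by (simp add: nn_integral_cmult nn_integral_multc)
  also have "\<dots> < \<infinity>" using g h by (auto simp: integrable_iff_bounded ennreal_mult_less_top)
  finally show "(\<integral>\<^sup>+x. (\<integral>\<^sup>+y. norm (F x y) \<partial>lborel) \<partial>lborel) < \<infinity>" .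
qed fact

section \<open>The Gaussian\<close>

text \<open>The exponent has the factor 1/2 and there is no normalisation: the Fourier transform is
  then the same function up to a power of \<open>sqrt (2 * pi)\<close>.\<close>

definition gauss :: "'a::euclidean_space \<Rightarrow> real" where "gauss x = exp (- (norm x)\<^sup>2 / 2)"

lemma gauss_measurable [measurable]: "gauss \<in> borel_measurable borel"
  unfolding gauss_def by measurable

lemma gauss_le_1: "gauss x \<le> 1" and gauss_nonneg [simp]: "0 \<le> gauss x"
  and gauss_minus [simp]: "gauss (- x) = gauss x"
  by (auto simp: gauss_def)

lemma gauss_prod: "gauss x = (\<Prod>b\<in>Basis. exp (- (x \<bullet> b)\<^sup>2 / 2))"
proof -
  have "(norm x)\<^sup>2 / 2 = (\<Sum>b\<in>Basis. (x \<bullet> b)\<^sup>2 / 2)"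
    unfolding power2_norm_eq_inner by (subst euclidean_inner) (simp add: power2_eq_square sum_divide_distrib)
  then show ?thesis by (simp add: gauss_def sum_negf flip: exp_sum)
qed

lemma std_normal_eq: "exp (- t\<^sup>2 / 2) = sqrt (2 * pi) * std_normal_density t"
  by (simp add: std_normal_density_def)

lemma gauss_real_integrable: "integrable lborel (\<lambda>t::real. exp (- t\<^sup>2 / 2))"
  unfolding std_normal_eq by simp

text \<open>Up to normalisation the integral is the characteristic function of the standard normal
  distribution.\<close>

lemma gauss_real_fourier:
  "(LINT t|lborel. cis (t * s) * exp (- t\<^sup>2 / 2)) = of_real (sqrt (2 * pi) * exp (- s\<^sup>2 / 2))"
proof -
  have "of_real (exp (- s\<^sup>2 / 2)) = char std_normal_distribution s"
    by (simp add: char_std_normal_distribution)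
  also have "\<dots> = (LINT t|lborel. std_normal_density t *\<^sub>R cis (t * s))"
    unfolding char_def
    by (subst integral_density) (auto simp: normal_density_nonneg cis_conv_exp ac_simps)
  finally have "of_real (sqrt (2 * pi) * exp (- s\<^sup>2 / 2)) = of_real (sqrt (2*pi)) * (LINT t|lborel. std_normal_density t *\<^sub>R cis (t * s))"
    by simp
  also have "\<dots> = (LINT t|lborel. cis (t * s) * exp (- t\<^sup>2 / 2))"
    unfolding std_normal_eq
    by (subst integral_mult_right_zero[symmetric]) (auto simp: scaleR_conv_of_real ac_simps)
  finally show ?thesis by simp
qed

text \<open>The integrand factors over the coordinates, and Lebesgue measure is the image of a
  product of one-dimensional ones. The sign inside \<open>cis\<close> is immaterial because the
  Gaussian is even.\<close>

lemma gauss_fourier_prod: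
  fixes \<xi> :: "'a::euclidean_space"
  shows "integrable lborel (\<lambda>x::'a. cis (x \<bullet> \<xi>) * gauss x)"
    and "(LINT x|lborel. cis (x \<bullet> \<xi>) * gauss x) = of_real (sqrt (2 * pi) ^ DIM('a) * gauss \<xi>)"
proof -
  interpret product_sigma_finite "\<lambda>b::'a. lborel :: real measure" ..
  let ?f = "\<lambda>b t. cis (t * (\<xi> \<bullet> b)) * complex_of_real (exp (- t\<^sup>2 / 2))"
  let ?T = "\<lambda>f. \<Sum>b\<in>(Basis::'a set). f b *\<^sub>R b"
  have "cis (\<Sum>b\<in>Basis. (x \<bullet> b) * (\<xi> \<bullet> b)) = (\<Prod>b\<in>Basis. cis ((x \<bullet> b) * (\<xi> \<bullet> b)))" for x :: 'a
    unfolding cis_conv_exp of_real_sum sum_distrib_left by (rule exp_sum) simp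
  then have "cis (x \<bullet> \<xi>) = (\<Prod>b\<in>Basis. cis ((x \<bullet> b) * (\<xi> \<bullet> b)))" for x :: 'a
    by (metis euclidean_inner)
  then have eq: "cis (x \<bullet> \<xi>) * of_real (gauss x) = (\<Prod>b\<in>Basis. ?f b (x \<bullet> b))" for x :: 'a
    by (simp only: gauss_prod prod.distrib of_real_prod)
  have T: "?T \<in> (\<Pi>\<^sub>M b\<in>(Basis::'a set). lborel) \<rightarrow>\<^sub>M borel" by measurable
  have i: "integrable lborel (?f b)" for b
    by (rule Bochner_Integration.integrable_bound[OF gauss_real_integrable]) (auto simp: norm_mult)
  have m: "(\<lambda>x::'a. cis (x \<bullet> \<xi>) * of_real (gauss x)) \<in> borel_measurable borel" by measurable
  have c: "cis (?T f \<bullet> \<xi>) * of_real (gauss (?T f)) = (\<Prod>b\<in>Basis. ?f b (f b))" for f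
    unfolding eq by (intro prod.cong) auto
  show "integrable lborel (\<lambda>x::'a. cis (x \<bullet> \<xi>) * gauss x)"
    by (subst lborel_eq, subst integrable_distr_eq[OF T m]) (simp only: c product_integrable_prod[OF finite_Basis i])
  show "(LINT x|lborel. cis (x \<bullet> \<xi>) * gauss x) = of_real (sqrt (2 * pi) ^ DIM('a) * gauss \<xi>)"
    apply (subst lborel_eq, subst integral_distr[OF T m])
    apply (simp only: c product_integral_prod[OF finite_Basis i] gauss_real_fourier)
    by (simp add: gauss_prod prod.distrib)
qed

lemma gauss_integrable: "integrable lborel (gauss :: 'a::euclidean_space \<Rightarrow> real)"
proof -
  have "integrable lborel (\<lambda>x::'a. complex_of_real (gauss x))"
    using gauss_fourier_prod(1)[of 0] by simp
  then show ?thesis using integrable_Re by fastforce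
qed

lemma gauss_integral: "(LINT x|lborel. gauss (x::'a::euclidean_space)) = sqrt (2 * pi) ^ DIM('a)"
proof -
  have "complex_of_real (LINT x|lborel. gauss (x::'a)) = of_real (sqrt (2 * pi) ^ DIM('a))"
    using gauss_fourier_prod(2)[of "0::'a"] by (simp add: gauss_def)
  then show ?thesis by (simp only: of_real_eq_iff)
qed

lemma gauss_fourier_scaled:
  fixes w :: "'a::euclidean_space"
  assumes "\<epsilon> > 0"
  shows "integrable lborel (\<lambda>\<xi>::'a. cis (w \<bullet> \<xi>) * gauss (\<epsilon> *\<^sub>R \<xi>))"
    and "\<epsilon> ^ DIM('a) *\<^sub>R (LINT \<xi>|lborel. cis (w \<bullet> \<xi>) * gauss (\<epsilon> *\<^sub>R \<xi>)) = of_real (sqrt (2 * pi) ^ DIM('a) * gauss (w /\<^sub>R \<epsilon>))"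
proof -
  let ?F = "\<lambda>x::'a. cis (x \<bullet> (w /\<^sub>R \<epsilon>)) * complex_of_real (gauss x)"
  have F: "?F (0 + \<epsilon> *\<^sub>R \<xi>) = cis (w \<bullet> \<xi>) * gauss (\<epsilon> *\<^sub>R \<xi>)" for \<xi>
    using assms by (simp add: inner_commute mult.assoc[symmetric])
  show "integrable lborel (\<lambda>\<xi>::'a. cis (w \<bullet> \<xi>) * gauss (\<epsilon> *\<^sub>R \<xi>))"
    using integrable_lborel_affine[OF gauss_fourier_prod(1)[of "w /\<^sub>R \<epsilon>"], of \<epsilon> 0] assms unfolding F by simp
  show "\<epsilon> ^ DIM('a) *\<^sub>R (LINT \<xi>|lborel. cis (w \<bullet> \<xi>) * gauss (\<epsilon> *\<^sub>R \<xi>)) = of_real (sqrt (2 * pi) ^ DIM('a) * gauss (w /\<^sub>R \<epsilon>))"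
    using lborel_integral_affine[of ?F \<epsilon> 0] assms unfolding F gauss_fourier_prod(2) by simp
qed

section \<open>The Fourier transform of integrable functions\<close>

lemma borel_measurable_cnj [measurable (raw)]:
  "f \<in> borel_measurable M \<Longrightarrow> (\<lambda>x. cnj (f x)) \<in> borel_measurable M"
  by (rule borel_measurable_continuous_on[of cnj]) (auto intro!: continuous_intros)

lemma fourier_measurable [measurable (raw)]:
  assumes [measurable]: "f \<in> borel_measurable borel" "g \<in> borel_measurable M"
  shows "(\<lambda>x. fourier f (g x)) \<in> borel_measurable M"
proof -
  have "(\<lambda>\<xi>. fourier f \<xi>) \<in> borel_measurable borel"
    unfolding fourier_lborel[OF assms(1)] by measurable
  then show ?thesis by measurable
qed

lemma integrable_cis_mult [simp]:
  fixes f :: "'a::euclidean_space \<Rightarrow> complex"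
  assumes "integrable lborel f" and [measurable]: "t \<in> borel_measurable borel"
  shows "integrable lborel (\<lambda>x. cis (t x) * f x)"
proof -
  have [measurable]: "f \<in> borel_measurable borel" using assms by auto
  show ?thesis
    by (rule Bochner_Integration.integrable_bound[OF assms(1)]) (auto simp: norm_mult)
qed

lemma norm_fourier_le:
  assumes "integrable lborel f"
  shows "norm (fourier f \<xi>) \<le> (LINT x|lborel. norm (f x))"
proof -
  have [measurable]: "f \<in> borel_measurable borel" using assms by auto
  have "norm (LINT x|lborel. cis (- (x \<bullet> \<xi>)) * f x) \<le> (LINT x|lborel. norm (cis (- (x \<bullet> \<xi>)) * f x))"
    by (rule integral_norm_bound)
  then show ?thesis by (simp add: fourier_lborel norm_mult)
qed

lemma tendsto_fourier:
  assumes f: "integrable lborel f" and X: "X \<longlonglongrightarrow> \<xi>"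
  shows "(\<lambda>n. fourier f (X n)) \<longlonglongrightarrow> fourier f \<xi>"
proof -
  have [measurable]: "f \<in> borel_measurable borel" using f by auto
  have "(\<lambda>n. cis (- (x \<bullet> X n)) * f x) \<longlonglongrightarrow> cis (- (x \<bullet> \<xi>)) * f x" for x
    unfolding cis_conv_exp using X by (intro tendsto_intros)
  then show ?thesis unfolding fourier_lborel[OF \<open>f \<in> borel_measurable borel\<close>]
    by (intro integral_dominated_convergence[where w="\<lambda>x. norm (f x)"])
      (auto simp: norm_mult f)
qed

lemma fourier_diff:
  assumes "integrable lborel f" "integrable lborel g"
  shows "fourier (\<lambda>x. f x - g x) \<xi> = fourier f \<xi> - fourier g \<xi>"
proof -
  have [measurable]: "f \<in> borel_measurable borel" "g \<in> borel_measurable borel" using assms by auto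
  show ?thesis using assms
    by (simp add: fourier_lborel right_diff_distrib)
qed

lemma fourier_shift:
  assumes [measurable]: "f \<in> borel_measurable borel"
  shows "fourier (\<lambda>x. f (x + h)) \<xi> = cis (h \<bullet> \<xi>) * fourier f \<xi>"
proof -
  have "(LINT x|lborel. cis (- (x \<bullet> \<xi>)) * f x) = (LINT x|lborel. cis (- ((h + x) \<bullet> \<xi>)) * f (h + x))"
    by (rule lborel_integral_shift[symmetric]) measurable
  also have "\<dots> = (LINT x|lborel. cis (- (h \<bullet> \<xi>)) * (cis (- (x \<bullet> \<xi>)) * f (x + h)))"
    by (intro Bochner_Integration.integral_cong) (auto simp: inner_add_left cis_mult algebra_simps)
  finally have "fourier f \<xi> = cis (- (h \<bullet> \<xi>)) * fourier (\<lambda>x. f (x + h)) \<xi>"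
    by (simp add: fourier_lborel)
  then have "cis (h \<bullet> \<xi>) * fourier f \<xi> = (cis (h \<bullet> \<xi>) * cis (- (h \<bullet> \<xi>))) * fourier (\<lambda>x. f (x + h)) \<xi>"
    by simp
  then show ?thesis by (simp add: cis_mult)
qed

lemma integrable_lborel_shift:
  fixes f :: "'a::euclidean_space \<Rightarrow> 'b::{banach, second_countable_topology}"
  assumes "integrable lborel f"
  shows "integrable lborel (\<lambda>x. f (x + h))"
  using integrable_lborel_affine[OF assms, of 1 h] by (simp add: add.commute)

text \<open>This identity links differences in \<open>x\<close> with weights in
  \<open>\<xi>\<close>, and is used in both directions.\<close>

lemma fourier_difference:
  assumes "integrable lborel f"
  shows "fourier (\<lambda>x. f (x + h) - f x) \<xi> = (cis (h \<bullet> \<xi>) - 1) * fourier f \<xi>"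
proof -
  have "f \<in> borel_measurable borel" using assms by auto
  then show ?thesis using assms
    by (simp add: fourier_diff fourier_shift integrable_lborel_shift left_diff_distrib)
qed

section \<open>Gaussian regularisation: multiplication formula, Bessel inequalities,
  inversion\<close>

lemma fourier_multiplication:
  fixes f g :: "'a::euclidean_space \<Rightarrow> complex"
  assumes f: "integrable lborel f" and g: "integrable lborel g"
  shows "(LINT \<xi>|lborel. fourier f \<xi> * g \<xi>) = (LINT x|lborel. f x * fourier g x)"
proof -
  have [measurable]: "f \<in> borel_measurable borel" "g \<in> borel_measurable borel" using f g by auto
  have "(LINT \<xi>|lborel. fourier f \<xi> * g \<xi>) = (LINT \<xi>|lborel. LINT x|lborel. cis (- (x \<bullet> \<xi>)) * f x * g \<xi>)"
    by (simp add: fourier_lborel f)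
  also have "\<dots> = (LINT x|lborel. LINT \<xi>|lborel. cis (- (x \<bullet> \<xi>)) * f x * g \<xi>)"
    by (rule lborel_pair.Fubini_integral, rule integrable_lborel_pair_bound[OF _ f g]) (auto simp: norm_mult)
  also have "\<dots> = (LINT x|lborel. f x * fourier g x)"
    by (simp add: fourier_lborel g inner_commute mult.assoc mult.left_commute)
  finally show ?thesis .
qed

text \<open>The multiplication formula with a modulated, scaled Gaussian as second factor, whose
  transform is a bump of width \<open>\<epsilon>\<close> around \<open>x\<close>. The left side is
  the inverse transform made absolutely convergent; the right side is an average of \<open>H\<close>
  near \<open>x\<close>.\<close>

lemma gauss_summation:
  fixes H :: "'a::euclidean_space \<Rightarrow> complex"
  assumes H: "integrable lborel H" and \<epsilon>: "\<epsilon> > 0"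
  shows "(LINT \<xi>|lborel. cis (x \<bullet> \<xi>) * fourier H \<xi> * gauss (\<epsilon> *\<^sub>R \<xi>)) =
    of_real (sqrt (2 * pi) ^ DIM('a)) * (LINT z|lborel. H (x - \<epsilon> *\<^sub>R z) * gauss z)"
proof -
  have [measurable]: "H \<in> borel_measurable borel" using H by auto
  let ?c = "sqrt (2 * pi) ^ DIM('a)"
  let ?g = "\<lambda>\<xi>. cis (x \<bullet> \<xi>) * complex_of_real (gauss (\<epsilon> *\<^sub>R \<xi>))"
  have g: "integrable lborel ?g" by (rule gauss_fourier_scaled(1)[OF \<epsilon>])
  have fg: "fourier ?g y = of_real (?c * gauss ((x - y) /\<^sub>R \<epsilon>)) /\<^sub>R \<epsilon> ^ DIM('a)" for y
  proof -
    have "fourier ?g y = (LINT \<xi>|lborel. cis ((x - y) \<bullet> \<xi>) * gauss (\<epsilon> *\<^sub>R \<xi>))"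
      by (simp add: fourier_lborel cis_mult inner_diff_left inner_commute[of _ y] mult.assoc[symmetric])
    also have "\<dots> = (\<epsilon> ^ DIM('a) *\<^sub>R (LINT \<xi>|lborel. cis ((x - y) \<bullet> \<xi>) * gauss (\<epsilon> *\<^sub>R \<xi>))) /\<^sub>R \<epsilon> ^ DIM('a)"
      using \<epsilon> by simp
    finally show ?thesis unfolding gauss_fourier_scaled(2)[OF \<epsilon>] .
  qed
  have "(LINT \<xi>|lborel. cis (x \<bullet> \<xi>) * fourier H \<xi> * gauss (\<epsilon> *\<^sub>R \<xi>)) = (LINT \<xi>|lborel. fourier H \<xi> * ?g \<xi>)"
    by (simp add: ac_simps)
  also have "\<dots> = (LINT y|lborel. H y * fourier ?g y)"
    by (rule fourier_multiplication[OF H g])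
  \<comment> \<open>Substitution \<open>y = x - \<epsilon> z\<close>; its Jacobian cancels the power
    of \<open>\<epsilon>\<close> in \<open>fg\<close>.\<close>
  also have "\<dots> = \<epsilon> ^ DIM('a) *\<^sub>R (LINT z|lborel. H (x - \<epsilon> *\<^sub>R z) * fourier ?g (x - \<epsilon> *\<^sub>R z))"
    using lborel_integral_affine[of "\<lambda>y. H y * fourier ?g y" "- \<epsilon>" x] \<epsilon> by simp
  also have "\<dots> = \<epsilon> ^ DIM('a) *\<^sub>R (LINT z|lborel. (of_real ?c /\<^sub>R \<epsilon> ^ DIM('a)) * (H (x - \<epsilon> *\<^sub>R z) * gauss z))"
    unfolding fg using \<epsilon> by (simp add: mult.left_commute)
  also have "\<dots> = of_real ?c * (LINT z|lborel. H (x - \<epsilon> *\<^sub>R z) * gauss z)"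
    using \<epsilon> by (subst integral_mult_right_zero) (simp add: scaleR_conv_of_real)
  finally show ?thesis .
qed

text \<open>Multiply \<open>gauss_summation\<close> by \<open>cnj (H x)\<close> and integrate: the
  integral over \<open>x\<close> reassembles \<open>cnj (fourier H \<xi>)\<close>. The transform is
  bounded, so the Gaussian makes everything converge although \<open>H\<close> is only
  integrable.\<close>

lemma gauss_energy:
  fixes H :: "'a::euclidean_space \<Rightarrow> complex"
  assumes H: "integrable lborel H" and \<epsilon>: "\<epsilon> > 0"
  shows "integrable lborel (\<lambda>\<xi>. (norm (fourier H \<xi>))\<^sup>2 * gauss (\<epsilon> *\<^sub>R \<xi>))"
    and "of_real (LINT \<xi>|lborel. (norm (fourier H \<xi>))\<^sup>2 * gauss (\<epsilon> *\<^sub>R \<xi>)) =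
    of_real (sqrt (2 * pi) ^ DIM('a)) * (LINT x|lborel. LINT z|lborel. cnj (H x) * H (x - \<epsilon> *\<^sub>R z) * gauss z)"
proof -
  have [measurable]: "H \<in> borel_measurable borel" using H by auto
  define N where "N = (LINT x|lborel. norm (H x))"
  have N: "norm (fourier H \<xi>) \<le> N" "0 \<le> N" for \<xi> using norm_fourier_le[OF H] unfolding N_def by auto
  have g: "integrable lborel (\<lambda>\<xi>::'a. gauss (\<epsilon> *\<^sub>R \<xi>))"
    using integrable_lborel_affine[OF gauss_integrable, of \<epsilon> 0] \<epsilon> by simp
  show I: "integrable lborel (\<lambda>\<xi>. (norm (fourier H \<xi>))\<^sup>2 * gauss (\<epsilon> *\<^sub>R \<xi>))"
    by (rule Bochner_Integration.integrable_bound[OF integrable_mult_right[OF g, of "N\<^sup>2"]])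
       (auto intro!: mult_right_mono power_mono N)
  have "of_real (sqrt (2 * pi) ^ DIM('a)) * (LINT x|lborel. LINT z|lborel. cnj (H x) * H (x - \<epsilon> *\<^sub>R z) * gauss z)
      = (LINT x|lborel. cnj (H x) * (of_real (sqrt (2 * pi) ^ DIM('a)) * (LINT z|lborel. H (x - \<epsilon> *\<^sub>R z) * gauss z)))"
    by (simp only: mult.assoc mult.left_commute[of "cnj _" "of_real (sqrt (2 * pi) ^ DIM('a))"] integral_mult_right_zero)
  also have "\<dots> = (LINT x|lborel. cnj (H x) * (LINT \<xi>|lborel. cis (x \<bullet> \<xi>) * fourier H \<xi> * gauss (\<epsilon> *\<^sub>R \<xi>)))"
    by (simp only: gauss_summation[OF H \<epsilon>])
  also have "\<dots> = (LINT x|lborel. LINT \<xi>|lborel. cnj (H x) * (cis (x \<bullet> \<xi>) * fourier H \<xi> * gauss (\<epsilon> *\<^sub>R \<xi>)))"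
    by simp
  also have "\<dots> = (LINT \<xi>|lborel. LINT x|lborel. cnj (H x) * (cis (x \<bullet> \<xi>) * fourier H \<xi> * gauss (\<epsilon> *\<^sub>R \<xi>)))"
    by (intro lborel_pair.Fubini_integral[symmetric] integrable_lborel_pair_bound[OF _ H integrable_mult_right[OF g, of N]])
       (auto simp: norm_mult N intro!: mult_left_mono mult_right_mono)
  also have "\<dots> = (LINT \<xi>|lborel. (fourier H \<xi> * gauss (\<epsilon> *\<^sub>R \<xi>)) * cnj (fourier H \<xi>))"
  proof -
    have "(LINT x|lborel. cnj (cis (- (x \<bullet> \<xi>)) * H x)) = cnj (fourier H \<xi>)" for \<xi>
      unfolding fourier_lborel[OF \<open>H \<in> borel_measurable borel\<close>] by (rule Bochner_Integration.integral_cnj)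
    then have "cnj (fourier H \<xi>) = (LINT x|lborel. cis (x \<bullet> \<xi>) * cnj (H x))" for \<xi>
      by (simp only: complex_cnj_mult cis_cnj minus_minus)
    then have "(fourier H \<xi> * gauss (\<epsilon> *\<^sub>R \<xi>)) * cnj (fourier H \<xi>) = (LINT x|lborel. (fourier H \<xi> * gauss (\<epsilon> *\<^sub>R \<xi>)) * (cis (x \<bullet> \<xi>) * cnj (H x)))" for \<xi>
      by (simp only: integral_mult_right_zero)
    then show ?thesis by (simp add: ac_simps)
  qed
  also have "\<dots> = (LINT \<xi>|lborel. of_real ((norm (fourier H \<xi>))\<^sup>2 * gauss (\<epsilon> *\<^sub>R \<xi>)))"
    by (intro Bochner_Integration.integral_cong refl) (simp only: of_real_mult complex_norm_square ac_simps)
  also have "\<dots> = of_real (LINT \<xi>|lborel. (norm (fourier H \<xi>))\<^sup>2 * gauss (\<epsilon> *\<^sub>R \<xi>))"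
    by (rule integral_complex_of_real)
  finally show "of_real (LINT \<xi>|lborel. (norm (fourier H \<xi>))\<^sup>2 * gauss (\<epsilon> *\<^sub>R \<xi>)) =
    of_real (sqrt (2 * pi) ^ DIM('a)) * (LINT x|lborel. LINT z|lborel. cnj (H x) * H (x - \<epsilon> *\<^sub>R z) * gauss z)" ..
qed

lemma sqrt_2pi_power: "sqrt (2 * pi) ^ n * sqrt (2 * pi) ^ n = (2 * pi) ^ n"
  unfolding power_mult_distrib[symmetric] real_sqrt_mult_self by simp

text \<open>Integrability is not a hypothesis, because a Bochner integral that does not exist equals
  0.\<close>

lemma norm_integral_le_nn_integral:
  fixes f :: "'a \<Rightarrow> 'b::{banach, second_countable_topology}"
  shows "ennreal (norm (integral\<^sup>L M f)) \<le> (\<integral>\<^sup>+x. norm (f x) \<partial>M)"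
  by (cases "integrable M f") (auto intro: integral_norm_bound_ennreal simp: not_integrable_integral_eq)

lemma gauss_scaled_tendsto:
  assumes "f \<longlonglongrightarrow> 0"
  shows "(\<lambda>n. gauss (f n *\<^sub>R x)) \<longlonglongrightarrow> 1"
proof -
  have "(\<lambda>n. gauss (f n *\<^sub>R x)) \<longlonglongrightarrow> exp (- (norm (0 *\<^sub>R x))\<^sup>2 / 2)"
    unfolding gauss_def by (intro tendsto_intros assms) auto
  then show ?thesis by simp
qed

lemma LIMSEQ_inverse_Suc: "(\<lambda>n. 1 / real (Suc n)) \<longlonglongrightarrow> 0"
  using LIMSEQ_inverse_real_of_nat by (simp add: inverse_eq_divide)

text \<open>Gaussian summation of the energy replaces the usual density argument for Plancherel's
  theorem: this direction needs no continuity of translations, and for the reverse one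
  continuity of \<open>H\<close> suffices.\<close>

lemma bessel_inequality:
  fixes H :: "'a::euclidean_space \<Rightarrow> complex"
  assumes H: "integrable lborel H"
  shows "(\<integral>\<^sup>+\<xi>. ennreal ((norm (fourier H \<xi>))\<^sup>2) \<partial>lborel) \<le> ennreal ((2 * pi) ^ DIM('a)) * (\<integral>\<^sup>+x. ennreal ((norm (H x))\<^sup>2) \<partial>lborel)"
proof -
  have [measurable]: "H \<in> borel_measurable borel" using H by auto
  let ?c = "sqrt (2 * pi) ^ DIM('a)"
  let ?S = "\<integral>\<^sup>+x. ennreal ((norm (H x))\<^sup>2) \<partial>lborel"
  note c2 = sqrt_2pi_power[of "DIM('a)"]
  have bound: "(\<integral>\<^sup>+\<xi>. ennreal ((norm (fourier H \<xi>))\<^sup>2 * gauss (\<epsilon> *\<^sub>R \<xi>)) \<partial>lborel) \<le> ennreal ((2 * pi) ^ DIM('a)) * ?S"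
    if \<epsilon>: "\<epsilon> > 0" for \<epsilon>
  proof -
    let ?K = "LINT x|lborel. LINT z|lborel. cnj (H x) * H (x - \<epsilon> *\<^sub>R z) * gauss z"
    define h where "h = (1/2 :: real)"
    \<comment> \<open>This elementary bound takes the place of Cauchy-Schwarz: after Tonelli each
      half contributes the same multiple of \<open>?S\<close>, by translation invariance.\<close>
    have am: "norm (H x) * norm (H y) \<le> h * (norm (H x))\<^sup>2 + h * (norm (H y))\<^sup>2" for x y
      using sum_squares_bound[of "norm (H x)" "norm (H y)"] by (simp add: field_simps h_def)
    have h: "0 \<le> h" "h + h = 1" by (simp_all add: h_def)
    have "ennreal (norm ?K) \<le> (\<integral>\<^sup>+x. \<integral>\<^sup>+z. norm (cnj (H x) * H (x - \<epsilon> *\<^sub>R z) * gauss z) \<partial>lborel \<partial>lborel)"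
      by (rule order_trans[OF norm_integral_le_nn_integral], intro nn_integral_mono norm_integral_le_nn_integral)
    also have "\<dots> \<le> (\<integral>\<^sup>+x. \<integral>\<^sup>+z. (ennreal h * ennreal ((norm (H x))\<^sup>2) + ennreal h * ennreal ((norm (H (x - \<epsilon> *\<^sub>R z)))\<^sup>2)) * ennreal (gauss z) \<partial>lborel \<partial>lborel)"
      by (intro nn_integral_mono) (auto simp: norm_mult h simp flip: ennreal_mult ennreal_plus intro!: ennreal_leI mult_right_mono am)
    also have "\<dots> = (\<integral>\<^sup>+z. \<integral>\<^sup>+x. (ennreal h * ennreal ((norm (H x))\<^sup>2) + ennreal h * ennreal ((norm (H (x - \<epsilon> *\<^sub>R z)))\<^sup>2)) * ennreal (gauss z) \<partial>lborel \<partial>lborel)"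
      by (rule lborel_pair.Fubini'[symmetric]) measurable
    also have "\<dots> = (\<integral>\<^sup>+z. ?S * ennreal (gauss (z::'a)) \<partial>lborel)"
    proof (intro nn_integral_cong)
      fix z :: 'a
      have "(\<integral>\<^sup>+x. ennreal ((norm (H (x - \<epsilon> *\<^sub>R z)))\<^sup>2) \<partial>lborel) = ?S"
        using nn_integral_lborel_shift[of "\<lambda>x. ennreal ((norm (H x))\<^sup>2)" "- \<epsilon> *\<^sub>R z"] by simp
      then have "(\<integral>\<^sup>+x. (ennreal h * ennreal ((norm (H x))\<^sup>2) + ennreal h * ennreal ((norm (H (x - \<epsilon> *\<^sub>R z)))\<^sup>2)) * ennreal (gauss z) \<partial>lborel)
        = (ennreal h * ?S + ennreal h * ?S) * ennreal (gauss z)"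
        by (simp add: nn_integral_multc nn_integral_add nn_integral_cmult)
      also have "ennreal h * ?S + ennreal h * ?S = ?S"
        by (simp add: h flip: distrib_right ennreal_plus)
      finally show "(\<integral>\<^sup>+x. (ennreal h * ennreal ((norm (H x))\<^sup>2) + ennreal h * ennreal ((norm (H (x - \<epsilon> *\<^sub>R z)))\<^sup>2)) * ennreal (gauss z) \<partial>lborel) = ?S * ennreal (gauss z)" .
    qed
    also have "\<dots> = ?S * ennreal ?c"
      by (simp add: nn_integral_cmult nn_integral_eq_integral[OF gauss_integrable] gauss_integral)
    finally have K: "ennreal (norm ?K) \<le> ?S * ennreal ?c" .
    have "(\<integral>\<^sup>+\<xi>. ennreal ((norm (fourier H \<xi>))\<^sup>2 * gauss (\<epsilon> *\<^sub>R \<xi>)) \<partial>lborel) = ennreal (LINT \<xi>|lborel. (norm (fourier H \<xi>))\<^sup>2 * gauss (\<epsilon> *\<^sub>R \<xi>))"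
      by (intro nn_integral_eq_integral gauss_energy[OF H \<epsilon>]) auto
    also have "\<dots> \<le> ennreal (norm (complex_of_real (LINT \<xi>|lborel. (norm (fourier H \<xi>))\<^sup>2 * gauss (\<epsilon> *\<^sub>R \<xi>))))"
      by (intro ennreal_leI) (simp only: norm_of_real abs_ge_self)
    also have "\<dots> = ennreal (?c * norm ?K)"
      unfolding gauss_energy(2)[OF H \<epsilon>] norm_mult norm_of_real by simp
    also have "\<dots> = ennreal ?c * ennreal (norm ?K)" by (simp add: ennreal_mult)
    also have "\<dots> \<le> ennreal ?c * (?S * ennreal ?c)" by (intro mult_left_mono K) auto
    also have "\<dots> = ennreal (?c * ?c) * ?S" by (subst ennreal_mult) (auto simp: ac_simps)
    finally show ?thesis unfolding c2 .
  qed
  have "(\<lambda>n. ennreal ((norm (fourier H \<xi>))\<^sup>2 * gauss ((1 / real (Suc n)) *\<^sub>R \<xi>))) \<longlonglongrightarrow> ennreal ((norm (fourier H \<xi>))\<^sup>2)" for \<xi>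
    using tendsto_mult[OF tendsto_const gauss_scaled_tendsto[OF LIMSEQ_inverse_Suc], of "(norm (fourier H \<xi>))\<^sup>2" \<xi>] by (intro tendsto_ennrealI) simp
  then have lim: "liminf (\<lambda>n. ennreal ((norm (fourier H \<xi>))\<^sup>2 * gauss ((1 / real (Suc n)) *\<^sub>R \<xi>))) = ennreal ((norm (fourier H \<xi>))\<^sup>2)" for \<xi>
    by (intro lim_imp_Liminf) auto
  \<comment> \<open>Fatou's lemma as the regularisation is removed along
    \<open>\<epsilon> = 1 / Suc n\<close>.\<close>
  have "(\<integral>\<^sup>+\<xi>. ennreal ((norm (fourier H \<xi>))\<^sup>2) \<partial>lborel) \<le> liminf (\<lambda>n. \<integral>\<^sup>+\<xi>. ennreal ((norm (fourier H \<xi>))\<^sup>2 * gauss ((1 / real (Suc n)) *\<^sub>R \<xi>)) \<partial>lborel)"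
    unfolding lim[symmetric] by (rule nn_integral_liminf) measurable
  also have "\<dots> \<le> limsup (\<lambda>n. \<integral>\<^sup>+\<xi>. ennreal ((norm (fourier H \<xi>))\<^sup>2 * gauss ((1 / real (Suc n)) *\<^sub>R \<xi>)) \<partial>lborel)"
    by (rule Liminf_le_Limsup) simp
  also have "\<dots> \<le> ennreal ((2 * pi) ^ DIM('a)) * ?S"
    by (intro Limsup_bounded always_eventually allI bound) simp
  finally show ?thesis .
qed

text \<open>Continuity gives the limit under the integral and \<open>B * gauss\<close> dominates it;
  the constant is the total mass of the unnormalised Gaussian.\<close>

lemma gauss_average_tendsto:
  fixes H :: "'a::euclidean_space \<Rightarrow> complex"
  assumes c: "continuous_on UNIV H" and B: "\<And>x. norm (H x) \<le> B"
  shows "(\<lambda>n. LINT z|lborel. H (x - (1 / real (Suc n)) *\<^sub>R z) * gauss z) \<longlonglongrightarrow> of_real (sqrt (2 * pi) ^ DIM('a)) * H x"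
proof -
  have [measurable]: "H \<in> borel_measurable borel" using c by (rule borel_measurable_continuous_onI)
  have "(\<lambda>n. LINT z|lborel. H (x - (1 / real (Suc n)) *\<^sub>R z) * gauss z) \<longlonglongrightarrow> (LINT z|lborel. H x * of_real (gauss (z::'a)))"
  proof (rule integral_dominated_convergence[where w="\<lambda>z::'a. B * gauss z"])
    have "(\<lambda>n. H (x - (1 / real (Suc n)) *\<^sub>R z)) \<longlonglongrightarrow> H (x - 0 *\<^sub>R z)" for z
      by (rule continuous_on_tendsto_compose[OF c tendsto_diff[OF tendsto_const tendsto_scaleR[OF LIMSEQ_inverse_Suc tendsto_const]]]) auto
    then show "AE z in lborel. (\<lambda>n. H (x - (1 / real (Suc n)) *\<^sub>R z) * gauss z) \<longlonglongrightarrow> H x * gauss z"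
      by (intro AE_I2 tendsto_mult tendsto_const) simp
  qed (auto simp: norm_mult gauss_integrable B intro!: mult_right_mono)
  also have "(LINT z|lborel. H x * of_real (gauss (z::'a))) = of_real (sqrt (2 * pi) ^ DIM('a)) * H x"
    by (simp add: gauss_integral)
  finally show ?thesis .
qed

lemma bessel_inequality_reverse:
  fixes H :: "'a::euclidean_space \<Rightarrow> complex"
  assumes H: "integrable lborel H" and c: "continuous_on UNIV H" and B: "\<And>x. norm (H x) \<le> B"
  shows "ennreal ((2 * pi) ^ DIM('a)) * (\<integral>\<^sup>+x. ennreal ((norm (H x))\<^sup>2) \<partial>lborel) \<le> (\<integral>\<^sup>+\<xi>. ennreal ((norm (fourier H \<xi>))\<^sup>2) \<partial>lborel)"
proof -
  have [measurable]: "H \<in> borel_measurable borel" using H by auto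
  let ?c = "sqrt (2 * pi) ^ DIM('a)"
  let ?R = "\<integral>\<^sup>+\<xi>. ennreal ((norm (fourier H \<xi>))\<^sup>2) \<partial>lborel"
  let ?K = "\<lambda>\<epsilon>. LINT x|lborel. LINT z|lborel. cnj (H x) * H (x - \<epsilon> *\<^sub>R z) * gauss z"
  have B0: "0 \<le> B" using B norm_ge_zero order_trans by blast
  note c2 = sqrt_2pi_power[of "DIM('a)"]
  have K_eq: "?K \<epsilon> = (LINT x|lborel. cnj (H x) * (LINT z|lborel. H (x - \<epsilon> *\<^sub>R z) * gauss z))" for \<epsilon>
    by (simp add: mult.assoc)
  have inner_bound: "norm (LINT z|lborel. H (x - \<epsilon> *\<^sub>R z) * gauss z) \<le> B * ?c" for x \<epsilon>
  proof -
    have "norm (LINT z|lborel. H (x - \<epsilon> *\<^sub>R z) * gauss z) \<le> (LINT z|lborel. norm (H (x - \<epsilon> *\<^sub>R z) * gauss z))"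
      by (rule integral_norm_bound)
    also have "\<dots> \<le> (LINT z|lborel. B * gauss (z::'a))"
      by (rule integral_mono_AE') (auto simp: norm_mult B B0 gauss_integrable intro!: mult_right_mono)
    finally have "norm (LINT z|lborel. H (x - \<epsilon> *\<^sub>R z) * gauss z) \<le> (LINT z|lborel. B * gauss (z::'a))" .
    then show ?thesis by (simp add: gauss_integral)
  qed
  have "(\<lambda>n. ?K (1 / real (Suc n))) \<longlonglongrightarrow> (LINT x|lborel. cnj (H x) * (of_real ?c * H x))"
    unfolding K_eq
  proof (rule integral_dominated_convergence[where w="\<lambda>x. norm (H x) * (B * ?c)"])
    show "AE x in lborel. (\<lambda>n. cnj (H x) * (LINT z|lborel. H (x - (1 / real (Suc n)) *\<^sub>R z) * gauss z)) \<longlonglongrightarrow> cnj (H x) * (of_real ?c * H x)"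
      by (intro AE_I2 tendsto_mult tendsto_const gauss_average_tendsto[OF c B])
  qed (auto simp: H norm_mult intro!: mult_left_mono inner_bound)
  then have lim: "(\<lambda>n. ennreal (norm (of_real ?c * ?K (1 / real (Suc n))))) \<longlonglongrightarrow> ennreal (norm (of_real ?c * (LINT x|lborel. cnj (H x) * (of_real ?c * H x))))"
    by (intro tendsto_ennrealI tendsto_norm tendsto_mult tendsto_const)
  \<comment> \<open>Bounded and integrable, hence square integrable; so the limit can be read as the
    extended integral of the statement.\<close>
  have H2: "integrable lborel (\<lambda>x. (norm (H x))\<^sup>2)"
    by (rule Bochner_Integration.integrable_bound[OF integrable_mult_right[OF integrable_norm[OF H], of B]])
       (auto simp: power2_eq_square B0 intro!: mult_right_mono B)
  have "(LINT x|lborel. cnj (H x) * (of_real ?c * H x)) = of_real ?c * (LINT x|lborel. of_real ((norm (H x))\<^sup>2))"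
    by (subst integral_mult_right_zero[symmetric], intro Bochner_Integration.integral_cong)
       (simp_all add: complex_norm_square ac_simps del: of_real_power)
  also have "\<dots> = of_real ?c * of_real (LINT x|lborel. (norm (H x))\<^sup>2)"
    by (simp only: integral_complex_of_real)
  finally have "norm (of_real ?c * (LINT x|lborel. cnj (H x) * (of_real ?c * H x))) = norm (complex_of_real (?c * ?c * (LINT x|lborel. (norm (H x))\<^sup>2)))"
    by (simp only: of_real_mult mult.assoc)
  also have "\<dots> = (2 * pi) ^ DIM('a) * (LINT x|lborel. (norm (H x))\<^sup>2)"
    unfolding c2 norm_of_real by simp
  finally have "ennreal (norm (of_real ?c * (LINT x|lborel. cnj (H x) * (of_real ?c * H x)))) = ennreal ((2 * pi) ^ DIM('a)) * (\<integral>\<^sup>+x. ennreal ((norm (H x))\<^sup>2) \<partial>lborel)"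
    using nn_integral_eq_integral[OF H2] by (simp add: ennreal_mult)
  \<comment> \<open>Before the limit: the damping factor is at most 1, so each regularised energy
    stays below the full one.\<close>
  moreover have "ennreal (norm (of_real ?c * ?K \<epsilon>)) \<le> ?R" if "\<epsilon> > 0" for \<epsilon>
  proof -
    have "ennreal (norm (of_real ?c * ?K \<epsilon>)) = ennreal (norm (complex_of_real (LINT \<xi>|lborel. (norm (fourier H \<xi>))\<^sup>2 * gauss (\<epsilon> *\<^sub>R \<xi>))))"
      by (simp only: gauss_energy(2)[OF H that])
    also have "\<dots> = ennreal (LINT \<xi>|lborel. (norm (fourier H \<xi>))\<^sup>2 * gauss (\<epsilon> *\<^sub>R \<xi>))"
      unfolding norm_of_real by simp
    also have "\<dots> = (\<integral>\<^sup>+\<xi>. ennreal ((norm (fourier H \<xi>))\<^sup>2 * gauss (\<epsilon> *\<^sub>R \<xi>)) \<partial>lborel)"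
      by (intro nn_integral_eq_integral[symmetric] gauss_energy[OF H that]) auto
    also have "\<dots> \<le> ?R"
      by (intro nn_integral_mono ennreal_leI mult_right_le_one_le) (auto simp: gauss_le_1)
    finally show ?thesis .
  qed
  ultimately show ?thesis using LIMSEQ_le_const2[OF lim, of ?R] by auto
qed

text \<open>Let \<open>\<epsilon>\<close> tend to 0 in \<open>gauss_summation\<close>. Integrability
  of the transform handles the left side and continuity of \<open>H\<close> the right side, so the
  formula holds at every point, not merely almost everywhere.\<close>

lemma fourier_inversion:
  fixes H :: "'a::euclidean_space \<Rightarrow> complex"
  assumes H: "integrable lborel H" and c: "continuous_on UNIV H" and B: "\<And>x. norm (H x) \<le> B"
    and F: "integrable lborel (fourier H)"
  shows "(LINT \<xi>|lborel. cis (x \<bullet> \<xi>) * fourier H \<xi>) = of_real ((2 * pi) ^ DIM('a)) * H x"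
proof -
  have [measurable]: "H \<in> borel_measurable borel" using H by auto
  let ?c = "sqrt (2 * pi) ^ DIM('a)"
  note c2 = sqrt_2pi_power[of "DIM('a)"]
  have "(\<lambda>n. LINT \<xi>|lborel. cis (x \<bullet> \<xi>) * fourier H \<xi> * gauss ((1 / real (Suc n)) *\<^sub>R \<xi>)) \<longlonglongrightarrow> (LINT \<xi>|lborel. cis (x \<bullet> \<xi>) * fourier H \<xi>)"
  proof (rule integral_dominated_convergence[where w="\<lambda>\<xi>. norm (fourier H \<xi>)"])
    show "AE \<xi> in lborel. (\<lambda>n. cis (x \<bullet> \<xi>) * fourier H \<xi> * gauss ((1 / real (Suc n)) *\<^sub>R \<xi>)) \<longlonglongrightarrow> cis (x \<bullet> \<xi>) * fourier H \<xi>"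
      using tendsto_mult[OF tendsto_const tendsto_of_real[OF gauss_scaled_tendsto[OF LIMSEQ_inverse_Suc]]]
      by (intro AE_I2) fastforce
  qed (auto simp: F norm_mult gauss_le_1 intro!: mult_left_le)
  moreover have "(\<lambda>n. LINT \<xi>|lborel. cis (x \<bullet> \<xi>) * fourier H \<xi> * gauss ((1 / real (Suc n)) *\<^sub>R \<xi>)) \<longlonglongrightarrow> of_real ?c * (of_real ?c * H x)"
    by (subst gauss_summation[OF H]) (auto intro!: tendsto_mult tendsto_const gauss_average_tendsto[OF c B] simp del: of_real_power of_nat_Suc)
  ultimately have "(LINT \<xi>|lborel. cis (x \<bullet> \<xi>) * fourier H \<xi>) = of_real ?c * (of_real ?c * H x)"
    by (rule LIMSEQ_unique)
  then show ?thesis by (simp only: c2[symmetric] of_real_mult mult.assoc)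
qed

section \<open>Weighted square norms and differences\<close>

abbreviation bracket :: "'a::real_normed_vector \<Rightarrow> real" where
  "bracket x \<equiv> 1 + (norm x)\<^sup>2"

lemma dyadic_shell:
  fixes y :: real
  assumes "1 \<le> y"
  obtains j :: nat where "2 ^ j \<le> y" "y < 2 ^ Suc j"
proof -
  define m where "m = (LEAST m. y < 2 ^ m)"
  obtain m0 :: nat where "y < 2 ^ m0" using real_arch_pow[of 2 y] by auto
  then have m: "y < 2 ^ m" unfolding m_def by (rule LeastI)
  with assms have "m \<noteq> 0" by (intro notI) simp
  then obtain j where j: "m = Suc j" by (cases m) auto
  have "\<not> y < 2 ^ j" using not_less_Least[of j "\<lambda>m. y < 2 ^ m"] j by (simp add: m_def[symmetric])
  with m j show thesis by (intro that[of j]) auto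
qed

lemma suminf_geometric_less_top:
  fixes q :: real
  assumes "0 \<le> q" "q < 1" "0 \<le> A"
  shows "(\<Sum>j. ennreal (A * q ^ j)) < \<infinity>"
proof -
  have "(\<lambda>j. A * q ^ j) sums (A * (1 / (1 - q)))"
    using assms by (intro sums_mult geometric_sums) auto
  then show ?thesis using assms by (subst suminf_ennreal_eq) auto
qed

lemma term_le_suminf_ennreal: "(f :: nat \<Rightarrow> ennreal) j \<le> suminf f"
  using sum_le_suminf[of f "{j}"] by simp

text \<open>Where the square root of the bracket lies in \<open>[2^j, 2^(j+1))\<close>, the weight
  is at most \<open>2 powr (- 2 * s * j)\<close> and \<open>x\<close> lies in a ball of radius
  \<open>2^(j+1)\<close>. Summing volumes gives a geometric series of ratio
  \<open>2 powr (n - 2 * s) < 1\<close>, with \<open>n\<close> the dimension.\<close>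

lemma nn_integral_bracket_less_top:
  assumes s: "real DIM('a) < 2 * s"
  shows "(\<integral>\<^sup>+x. ennreal (bracket (x::'a::euclidean_space) powr (- s)) \<partial>lborel) < \<infinity>"
proof -
  let ?n = "DIM('a)"
  let ?V = "unit_ball_vol (real ?n)"
  have s0: "0 < s" using s by (smt (verit) of_nat_0_le_iff)
  have le: "ennreal (bracket x powr (- s)) \<le> (\<Sum>j. ennreal ((2 powr (- 2 * s)) ^ j) * indicator (ball 0 (2 ^ Suc j)) x)"
    for x :: 'a
  proof -
    let ?y = "sqrt (bracket x)"
    have "1 \<le> ?y" by simp
    then obtain j where j: "2 ^ j \<le> ?y" "?y < 2 ^ Suc j" by (rule dyadic_shell)
    have "norm x \<le> ?y" by (rule real_le_rsqrt) simp
    with j have x: "x \<in> ball 0 (2 ^ Suc j)" by simp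
    have "bracket x powr (- s) = ?y powr (- 2 * s)"
      by (subst powr_half_sqrt[symmetric]) (auto simp: powr_powr)
    also have "\<dots> \<le> (2 ^ j) powr (- 2 * s)"
      using j s0 by (intro powr_mono2') auto
    also have "\<dots> = (2 powr (- 2 * s)) ^ j"
      by (simp add: powr_realpow[symmetric] powr_powr mult.commute del: powr_numeral)
    finally have "ennreal (bracket x powr (- s)) \<le> ennreal ((2 powr (- 2 * s)) ^ j) * indicator (ball 0 (2 ^ Suc j)) x"
      using x by (simp add: ennreal_leI)
    then show ?thesis using term_le_suminf_ennreal order_trans by fast
  qed
  have "(\<integral>\<^sup>+x. ennreal (bracket (x::'a) powr (- s)) \<partial>lborel) \<le>
    (\<integral>\<^sup>+x. (\<Sum>j. ennreal ((2 powr (- 2 * s)) ^ j) * indicator (ball 0 (2 ^ Suc j)) (x::'a)) \<partial>lborel)"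
    by (intro nn_integral_mono le)
  also have "\<dots> = (\<Sum>j. \<integral>\<^sup>+x. ennreal ((2 powr (- 2 * s)) ^ j) * indicator (ball 0 (2 ^ Suc j)) (x::'a) \<partial>lborel)"
    by (rule nn_integral_suminf) (intro borel_measurable_times_ennreal borel_measurable_const borel_measurable_indicator, simp)
  also have "\<dots> = (\<Sum>j. ennreal ((2 powr (- 2 * s)) ^ j) * emeasure lborel (ball (0::'a) (2 ^ Suc j)))"
    by (intro suminf_cong nn_integral_cmult_indicator) auto
  also have "\<dots> = (\<Sum>j. ennreal ((?V * 2 ^ ?n) * (2 powr (real ?n - 2 * s)) ^ j))"
  proof (intro suminf_cong)
    fix j
    have "(2 powr (- 2 * s)) ^ j * (?V * (2 ^ Suc j) ^ ?n) = (?V * 2 ^ ?n) * ((2 powr (- 2 * s)) * 2 ^ ?n) ^ j"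
    proof -
      have "(2 ^ Suc j) ^ ?n = ((2::real) ^ ?n) ^ Suc j"
        by (simp only: power_mult[symmetric] mult.commute)
      then have "(2 powr (- 2 * s)) ^ j * (?V * (2 ^ Suc j) ^ ?n) = (2 powr (- 2 * s)) ^ j * (?V * (2 ^ ?n * (2 ^ ?n) ^ j))"
        by (simp only: power_Suc)
      then show ?thesis by (simp only: power_mult_distrib ac_simps)
    qed
    also have "(2::real) powr (- 2 * s) * 2 ^ ?n = 2 powr (real ?n - 2 * s)"
      by (simp add: powr_realpow[symmetric] powr_add[symmetric] algebra_simps)
    finally have e: "(2 powr (- 2 * s)) ^ j * (?V * (2 ^ Suc j) ^ ?n) = (?V * 2 ^ ?n) * (2 powr (real ?n - 2 * s)) ^ j" .
    have "ennreal ((2 powr (- 2 * s)) ^ j) * emeasure lborel (ball (0::'a) (2 ^ Suc j)) = ennreal ((2 powr (- 2 * s)) ^ j) * ennreal (?V * (2 ^ Suc j) ^ ?n)"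
      by (subst emeasure_ball) auto
    also have "\<dots> = ennreal ((2 powr (- 2 * s)) ^ j * (?V * (2 ^ Suc j) ^ ?n))"
      by (rule ennreal_mult[symmetric]) (auto simp: unit_ball_vol_nonneg)
    finally show "ennreal ((2 powr (- 2 * s)) ^ j) * emeasure lborel (ball (0::'a) (2 ^ Suc j)) = ennreal ((?V * 2 ^ ?n) * (2 powr (real ?n - 2 * s)) ^ j)"
      unfolding e .
  qed
  also have "\<dots> < \<infinity>"
    by (rule suminf_geometric_less_top) (use s in \<open>auto simp: powr_less_one\<close>)
  finally show ?thesis .
qed

text \<open>A squared norm on the Fourier side: finiteness of \<open>wnorm2 s (fourier f)\<close>
  expresses Sobolev order \<open>s\<close> of \<open>f\<close>. Extended real values let finiteness
  be the thing that is proved.\<close>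

definition wnorm2 :: "real \<Rightarrow> ('a::euclidean_space \<Rightarrow> complex) \<Rightarrow> ennreal" where
  "wnorm2 s p = (\<integral>\<^sup>+\<xi>. ennreal (bracket \<xi> powr s * (norm (p \<xi>))\<^sup>2) \<partial>lborel)"

lemma bracket_pos: "0 < bracket x"
  by (smt (verit) zero_le_power2)

text \<open>Write the integrand as \<open>bracket powr (s/2)\<close> times the modulus of
  \<open>p\<close>, times \<open>bracket powr ((r - s)/2)\<close>. A product of nonnegative numbers
  is at most the sum of the squares, and the square of the last factor is integrable because
  \<open>s - r\<close> exceeds half the dimension. This is the price of passing from L^2 to
  L^1.\<close>

lemma nn_integral_bracket_norm_less_top:
  fixes p :: "'a::euclidean_space \<Rightarrow> complex"
  assumes r: "r < s - real DIM('a) / 2" and [measurable]: "p \<in> borel_measurable borel" and fin: "wnorm2 s p < \<infinity>"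
  shows "(\<integral>\<^sup>+\<xi>. ennreal (bracket \<xi> powr (r / 2) * norm (p \<xi>)) \<partial>lborel) < \<infinity>"
proof -
  have le: "bracket \<xi> powr (r / 2) * norm (p \<xi>) \<le> bracket \<xi> powr s * (norm (p \<xi>))\<^sup>2 + bracket \<xi> powr (- (s - r))" for \<xi>
  proof -
    let ?w = "bracket \<xi>"
    let ?a = "?w powr (s / 2) * norm (p \<xi>)" and ?b = "?w powr (- (s - r) / 2)"
    have "?w powr (r / 2) * norm (p \<xi>) = ?a * ?b"
    proof -
      have "?w powr (r / 2) = ?w powr (s / 2) * ?b" by (subst powr_add[symmetric]) (simp add: field_simps)
      then show ?thesis by (simp only: ac_simps)
    qed
    also have "\<dots> \<le> ?a\<^sup>2 + ?b\<^sup>2"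
    proof -
      have "0 \<le> ?a * ?b" by simp
      then show ?thesis using sum_squares_bound[of ?a ?b] by linarith
    qed
    also have "?a\<^sup>2 + ?b\<^sup>2 = ?w powr s * (norm (p \<xi>))\<^sup>2 + ?w powr (- (s - r))"
      by (simp add: power_mult_distrib power2_eq_square powr_add[symmetric])
    finally show ?thesis .
  qed
  have "(\<integral>\<^sup>+\<xi>. ennreal (bracket \<xi> powr (r / 2) * norm (p \<xi>)) \<partial>lborel) \<le>
     (\<integral>\<^sup>+\<xi>. ennreal (bracket \<xi> powr s * (norm (p \<xi>))\<^sup>2) + ennreal (bracket \<xi> powr (- (s - r))) \<partial>lborel)"
    using le by (intro nn_integral_mono) (simp add: ennreal_leI flip: ennreal_plus)
  also have "\<dots> = wnorm2 s p + (\<integral>\<^sup>+\<xi>. ennreal (bracket (\<xi>::'a) powr (- (s - r))) \<partial>lborel)"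
    unfolding wnorm2_def by (rule nn_integral_add) measurable
  also have "\<dots> < \<infinity>" using fin nn_integral_bracket_less_top[where 'a='a, of "s - r"] r by simp
  finally show ?thesis .
qed

section \<open>Difference multipliers and their dyadic comparison with the weight\<close>

lemma norm_cis_minus_1_squared: "(norm (cis t - 1))\<^sup>2 = 2 - 2 * cos t"
proof -
  have "(norm (cis t - 1))\<^sup>2 = (cos t - 1)\<^sup>2 + (sin t)\<^sup>2"
    by (simp add: cmod_power2)
  also have "\<dots> = (cos t)\<^sup>2 + (sin t)\<^sup>2 + 1 - 2 * cos t" by (simp add: power2_diff)
  finally show ?thesis by simp
qed

text \<open>The interval stays away from the zeros 0 and \<open>2 * pi\<close> of the multiplier;
  the cosine decreases on it because \<open>2 < pi\<close>.\<close>

lemma norm_cis_minus_1_lower: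
  assumes "1 \<le> \<bar>t\<bar>" "\<bar>t\<bar> \<le> 2"
  shows "2 - 2 * cos 1 \<le> (norm (cis t - 1))\<^sup>2"
proof -
  have "cos \<bar>t\<bar> \<le> cos 1"
    using assms pi_gt3 by (intro cos_monotone_0_pi_le) auto
  then show ?thesis unfolding norm_cis_minus_1_squared by simp
qed

text \<open>The multiplier is at most \<open>\<bar>t\<bar>\<close> and at most 2. Near 0 the square
  of \<open>\<bar>t\<bar>\<close> is bounded by the power \<open>2 * s\<close> because
  \<open>s \<le> 1\<close>, which is why first differences serve only orders up to 1.\<close>

lemma norm_cis_minus_1_upper:
  assumes "0 \<le> s" "s \<le> 1"
  shows "(norm (cis t - 1))\<^sup>2 \<le> 4 * \<bar>t\<bar> powr (2 * s)"
proof (cases "\<bar>t\<bar> \<le> 1")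
  case True
  show ?thesis
  proof (cases "t = 0")
    case False
    have "norm (cis t - 1) \<le> \<bar>t\<bar>"
      using iexp_approx1[of t 0] by (simp add: cis_conv_exp)
    then have "(norm (cis t - 1))\<^sup>2 \<le> \<bar>t\<bar>\<^sup>2" by (intro power_mono) auto
    also have "\<dots> = \<bar>t\<bar> powr 2" using False by (simp add: powr_numeral)
    also have "\<dots> \<le> \<bar>t\<bar> powr (2 * s)" using True assms False by (intro powr_mono') auto
    finally show ?thesis by (smt (verit) powr_ge_zero)
  qed auto
next
  case False
  have "2 - 2 * cos t \<le> 4 * 1" using cos_ge_minus_one[of t] by linarith
  also have "\<dots> \<le> 4 * \<bar>t\<bar> powr (2 * s)" using False assms by (intro mult_left_mono ge_one_powr_ge_zero) auto
  finally show ?thesis unfolding norm_cis_minus_1_squared .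
qed

lemma norm_le_max_coordinate:
  fixes \<xi> :: "'a::euclidean_space"
  obtains b where "b \<in> Basis" "(norm \<xi>)\<^sup>2 \<le> real DIM('a) * (b \<bullet> \<xi>)\<^sup>2"
proof -
  let ?M = "Max ((\<lambda>b. \<bar>\<xi> \<bullet> b\<bar>) ` (Basis :: 'a set))"
  have "?M \<in> (\<lambda>b. \<bar>\<xi> \<bullet> b\<bar>) ` (Basis :: 'a set)" by (intro Max_in) auto
  then obtain b where b: "b \<in> Basis" "?M = \<bar>\<xi> \<bullet> b\<bar>" by blast
  have Mge: "\<bar>\<xi> \<bullet> c\<bar> \<le> \<bar>\<xi> \<bullet> b\<bar>" if "c \<in> Basis" for c
    unfolding b(2)[symmetric] using that by (intro Max_ge) auto
  have "(norm \<xi>)\<^sup>2 = (\<Sum>c\<in>Basis. (\<xi> \<bullet> c)\<^sup>2)"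
    unfolding power2_norm_eq_inner by (subst euclidean_inner) (simp add: power2_eq_square)
  also have "\<dots> \<le> real (card (Basis :: 'a set)) * (\<xi> \<bullet> b)\<^sup>2"
    using Mge by (intro sum_bounded_above) (simp add: abs_le_square_iff[symmetric])
  finally show thesis using b(1) by (intro that[of b]) (simp_all add: inner_commute)
qed

text \<open>If \<open>2\<^sup>j \<le> |\<xi> \<bullet> b| < 2\<^sup>j\<^sup>+\<^sup>1\<close> for the largest coordinate, the multiplier of the difference with
  step \<open>2\<^sup>-\<^sup>j b\<close> is bounded below at \<open>\<xi>\<close>, so the single term \<open>j\<close> already dominates.\<close>

lemma bracket_powr_le_differences:
  fixes \<xi> :: "'a::euclidean_space"
  assumes r: "0 \<le> r"
  shows "ennreal (bracket \<xi> powr r) \<le> ennreal ((1 + real DIM('a)) powr r) *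
    (1 + (\<Sum>b\<in>Basis. \<Sum>j. ennreal (4 powr (r * real (Suc j)) / (2 - 2 * cos 1) * (norm (cis (((1/2) ^ j *\<^sub>R b) \<bullet> \<xi>) - 1))\<^sup>2)))"
    (is "_ \<le> ennreal ?A * (1 + (\<Sum>b\<in>Basis. \<Sum>j. ?t b j))")
proof -
  obtain b where b: "b \<in> Basis" "(norm \<xi>)\<^sup>2 \<le> real DIM('a) * (b \<bullet> \<xi>)\<^sup>2"
    by (rule norm_le_max_coordinate)
  then have nrm: "(norm \<xi>)\<^sup>2 \<le> real DIM('a) * (\<xi> \<bullet> b)\<^sup>2" by (simp add: inner_commute)
  have A0: "0 \<le> ?A" by simp
  have k0: "0 < 2 - 2 * cos (1::real)"
    using cos_monotone_0_pi[of 0 1] pi_gt3 by simp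
  show ?thesis
  \<comment> \<open>Low frequencies are bounded, and the summand 1 takes care of them; otherwise the
    coordinate along \<open>b\<close> selects a dyadic step.\<close>
  proof (cases "\<bar>\<xi> \<bullet> b\<bar> < 1")
    case True
    then have "(\<xi> \<bullet> b)\<^sup>2 \<le> 1" by (simp add: abs_square_le_1)
    then have "real DIM('a) * (\<xi> \<bullet> b)\<^sup>2 \<le> real DIM('a) * 1" by (intro mult_left_mono) auto
    then have "(norm \<xi>)\<^sup>2 \<le> real DIM('a)" using nrm by linarith
    then have "bracket \<xi> powr r \<le> ?A" using r by (intro powr_mono2) auto
    then have "ennreal (bracket \<xi> powr r) \<le> ennreal ?A * 1" by (simp add: ennreal_leI)
    also have "\<dots> \<le> ennreal ?A * (1 + (\<Sum>b\<in>Basis. \<Sum>j. ?t b j))" by (intro mult_left_mono) auto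
    finally show ?thesis .
  next
    case False
    then have ge: "1 \<le> \<bar>\<xi> \<bullet> b\<bar>" by simp
    then obtain j where j: "2 ^ j \<le> \<bar>\<xi> \<bullet> b\<bar>" "\<bar>\<xi> \<bullet> b\<bar> < 2 ^ Suc j" by (rule dyadic_shell)
    have ab: "\<bar>((1/2) ^ j *\<^sub>R b) \<bullet> \<xi>\<bar> = \<bar>\<xi> \<bullet> b\<bar> / 2 ^ j"
      by (simp add: inner_commute[of b] abs_mult power_one_over divide_simps)
    have low: "2 - 2 * cos 1 \<le> (norm (cis (((1/2) ^ j *\<^sub>R b) \<bullet> \<xi>) - 1))\<^sup>2"
      by (rule norm_cis_minus_1_lower) (use j in \<open>simp_all only: ab, simp_all add: field_simps\<close>)
    have "1 \<le> (\<xi> \<bullet> b)\<^sup>2" using power_mono[OF ge, of 2] by simp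
    \<comment> \<open>The whole bracket is controlled by one squared coordinate, which is below
      \<open>(2 ^ Suc j)^2\<close>; this is the source of the powers of 4.\<close>
    then have "1 + (norm \<xi>)\<^sup>2 \<le> (1 + real DIM('a)) * (\<xi> \<bullet> b)\<^sup>2"
      using nrm by (simp add: algebra_simps)
    also have "\<dots> \<le> (1 + real DIM('a)) * (2 ^ Suc j)\<^sup>2"
      using power_mono[OF less_imp_le[OF j(2)], of 2] by (intro mult_left_mono) (simp_all only: power2_abs abs_ge_zero of_nat_0_le_iff add_nonneg_nonneg zero_le_one)
    also have "(2 ^ Suc j)\<^sup>2 = (4::real) ^ Suc j"
    proof -
      have "(2 ^ Suc j)\<^sup>2 = ((2::real)\<^sup>2) ^ Suc j" by (simp only: power_mult[symmetric] mult.commute)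
      then show ?thesis by (simp del: power_Suc)
    qed
    finally have "bracket \<xi> powr r \<le> ((1 + real DIM('a)) * 4 ^ Suc j) powr r"
      using r by (intro powr_mono2) auto
    also have "\<dots> = ?A * 4 powr (r * real (Suc j))"
      by (subst powr_mult) (auto simp: powr_realpow[symmetric] powr_powr mult.commute simp del: power_Suc of_nat_Suc)
    also have "\<dots> \<le> ?A * (4 powr (r * real (Suc j)) / (2 - 2 * cos 1) * (norm (cis (((1/2) ^ j *\<^sub>R b) \<bullet> \<xi>) - 1))\<^sup>2)"
    proof (intro mult_left_mono A0)
      let ?d = "(norm (cis (((1/2) ^ j *\<^sub>R b) \<bullet> \<xi>) - 1))\<^sup>2"
      have "1 \<le> ?d / (2 - 2 * cos 1)" using low k0 by simp
      then have "4 powr (r * real (Suc j)) * 1 \<le> 4 powr (r * real (Suc j)) * (?d / (2 - 2 * cos 1))"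
        by (intro mult_left_mono) auto
      then show "4 powr (r * real (Suc j)) \<le> 4 powr (r * real (Suc j)) / (2 - 2 * cos 1) * ?d"
        by (simp only: mult_1_right times_divide_eq_left times_divide_eq_right)
    qed
    finally have le: "ennreal (bracket \<xi> powr r) \<le> ennreal ?A * ?t b j"
      using k0 by (subst ennreal_mult[symmetric]) (auto intro: ennreal_leI)
    have "?t b j \<le> (\<Sum>j. ?t b j)" by (rule term_le_suminf_ennreal)
    also have "\<dots> \<le> (\<Sum>b\<in>Basis. \<Sum>j. ?t b j)" using b by (intro member_le_sum) auto
    also have "\<dots> \<le> 1 + (\<Sum>b\<in>Basis. \<Sum>j. ?t b j)" by (simp add: le_iff_add add.commute)
    finally have "?t b j \<le> 1 + (\<Sum>b\<in>Basis. \<Sum>j. ?t b j)" .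
    then have "ennreal ?A * ?t b j \<le> ennreal ?A * (1 + (\<Sum>b\<in>Basis. \<Sum>j. ?t b j))"
      by (rule mult_left_mono) simp
    with le show ?thesis by (rule order_trans)
  qed
qed

text \<open>Multiply the pointwise bound by the squared transform and integrate. The difference with
  step \<open>2^(-j)\<close> is estimated by \<open>bessel_inequality\<close> and the hypothesis,
  which gives \<open>4 powr ((r - s) * j)\<close> up to a constant. The series converges because
  \<open>r < s\<close>; for \<open>r = s\<close> all terms of the bound would be equal.\<close>

lemma weighted_fourier_less_top_of_differences:
  fixes G :: "'a::euclidean_space \<Rightarrow> complex"
  assumes G: "integrable lborel G"
    and L2: "(\<integral>\<^sup>+x. ennreal ((norm (G x))\<^sup>2) \<partial>lborel) < \<infinity>"
    and diff: "\<And>b t. b \<in> Basis \<Longrightarrow> 0 < t \<Longrightarrow> t \<le> 1 \<Longrightarrow>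
      (\<integral>\<^sup>+x. ennreal ((norm (G (x + t *\<^sub>R b) - G x))\<^sup>2) \<partial>lborel) \<le> ennreal (C * t powr (2 * s))"
    and r: "0 \<le> r" "r < s" and C: "0 \<le> C"
  shows "wnorm2 r (fourier G) < \<infinity>"
proof -
  have [measurable]: "G \<in> borel_measurable borel" using G by auto
  let ?A = "(1 + real DIM('a)) powr r"
  let ?k = "2 - 2 * cos (1::real)"
  let ?P = "(2 * pi) ^ DIM('a)"
  have k0: "0 < ?k" using cos_monotone_0_pi[of 0 1] pi_gt3 by simp
  let ?c = "\<lambda>j. 4 powr (r * real (Suc j)) / ?k"
  have c0: "0 \<le> ?c j" for j using k0 by simp
  let ?F = "\<lambda>\<xi>. ennreal ((norm (fourier G \<xi>))\<^sup>2)"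
  let ?d = "\<lambda>b j \<xi>. (norm (cis (((1/2) ^ j *\<^sub>R b) \<bullet> \<xi>) - 1))\<^sup>2"
  have dF: "(\<integral>\<^sup>+\<xi>. ennreal (?c j * ?d b j \<xi>) * ?F \<xi> \<partial>lborel) \<le> ennreal ((4 powr r / ?k * ?P * C) * (4 powr (r - s)) ^ j)"
    if b: "b \<in> Basis" for b :: 'a and j
  proof -
    let ?h = "(1/2) ^ j *\<^sub>R b"
    have "(\<integral>\<^sup>+\<xi>. ennreal (?c j * ?d b j \<xi>) * ?F \<xi> \<partial>lborel) = (\<integral>\<^sup>+\<xi>. ennreal (?c j) * ennreal ((norm (fourier (\<lambda>x. G (x + ?h) - G x) \<xi>))\<^sup>2) \<partial>lborel)"
      unfolding fourier_difference[OF G]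
      by (intro nn_integral_cong) (simp add: ennreal_mult[symmetric] c0 norm_mult power_mult_distrib mult.assoc)
    also have "\<dots> = ennreal (?c j) * (\<integral>\<^sup>+\<xi>. ennreal ((norm (fourier (\<lambda>x. G (x + ?h) - G x) \<xi>))\<^sup>2) \<partial>lborel)"
      by (rule nn_integral_cmult) measurable
    also have "\<dots> \<le> ennreal (?c j) * (ennreal ?P * (\<integral>\<^sup>+x. ennreal ((norm (G (x + ?h) - G x))\<^sup>2) \<partial>lborel))"
      by (intro mult_left_mono bessel_inequality Bochner_Integration.integrable_diff integrable_lborel_shift G) auto
    also have "\<dots> \<le> ennreal (?c j) * (ennreal ?P * ennreal (C * ((1/2) ^ j) powr (2 * s)))"
      by (intro mult_left_mono diff b) (auto simp: power_le_one)
    also have "\<dots> = ennreal (?c j * (?P * (C * ((1/2) ^ j) powr (2 * s))))"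
    proof -
      have "ennreal x * (ennreal y * ennreal z) = ennreal (x * (y * z))" if "0 \<le> x" "0 \<le> y" "0 \<le> z" for x y z
        using that by (simp add: ennreal_mult)
      then show ?thesis using C c0 by simp
    qed
    also have "((1/2::real) ^ j) powr (2 * s) = (4 powr (- s)) ^ j"
    proof -
      have "((1/2::real) ^ j) powr (2 * s) = ((1/2) powr (2 * s)) ^ j"
        by (simp add: powr_realpow[symmetric] powr_powr mult.commute del: powr_numeral)
      also have "(1/2::real) powr (2 * s) = 4 powr (- s)"
        by (simp add: powr_divide powr_minus powr_powr[symmetric] inverse_eq_divide)
      finally show ?thesis .
    qed
    also have "?c j * (?P * (C * (4 powr (- s)) ^ j)) = (4 powr r / ?k * ?P * C) * (4 powr (r - s)) ^ j"
    proof -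
      have "4 powr (r * real (Suc j)) = 4 powr r * (4 powr r) ^ j"
        by (simp add: powr_add powr_realpow[symmetric] powr_powr algebra_simps)
      moreover have "(4 powr (r - s)) ^ j = (4 powr r) ^ j * (4 powr (- s)) ^ j"
        by (simp add: powr_add[symmetric] power_mult_distrib[symmetric])
      ultimately show ?thesis by (simp only: times_divide_eq_left times_divide_eq_right ac_simps)
    qed
    finally show ?thesis .
  qed
  have "wnorm2 r (fourier G) \<le>
    (\<integral>\<^sup>+\<xi>. ennreal ?A * ((1 + (\<Sum>b\<in>Basis. \<Sum>j. ennreal (?c j * ?d b j \<xi>))) * ?F \<xi>) \<partial>lborel)"
  unfolding wnorm2_def
  proof (intro nn_integral_mono)
    fix \<xi> :: 'a
    have "ennreal (bracket \<xi> powr r * (norm (fourier G \<xi>))\<^sup>2) = ennreal (bracket \<xi> powr r) * ?F \<xi>"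
      by (simp add: ennreal_mult)
    also have "\<dots> \<le> (ennreal ?A * (1 + (\<Sum>b\<in>Basis. \<Sum>j. ennreal (?c j * ?d b j \<xi>)))) * ?F \<xi>"
      by (intro mult_right_mono bracket_powr_le_differences r) simp
    finally show "ennreal (bracket \<xi> powr r * (norm (fourier G \<xi>))\<^sup>2) \<le> ennreal ?A * ((1 + (\<Sum>b\<in>Basis. \<Sum>j. ennreal (?c j * ?d b j \<xi>))) * ?F \<xi>)"
      by (simp only: mult.assoc)
  qed
  also have "\<dots> = ennreal ?A * ((\<integral>\<^sup>+\<xi>. ?F \<xi> \<partial>lborel) + (\<Sum>b\<in>Basis. \<Sum>j. \<integral>\<^sup>+\<xi>. ennreal (?c j * ?d b j \<xi>) * ?F \<xi> \<partial>lborel))"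
  proof -
    have "(\<integral>\<^sup>+\<xi>. (\<Sum>b\<in>Basis. \<Sum>j. ennreal (?c j * ?d b j \<xi>) * ?F \<xi>) \<partial>lborel)
        = (\<Sum>b\<in>Basis. \<integral>\<^sup>+\<xi>. (\<Sum>j. ennreal (?c j * ?d b j \<xi>) * ?F \<xi>) \<partial>lborel)"
      by (rule nn_integral_sum) measurable
    also have "\<dots> = (\<Sum>b\<in>Basis. \<Sum>j. \<integral>\<^sup>+\<xi>. ennreal (?c j * ?d b j \<xi>) * ?F \<xi> \<partial>lborel)"
      by (intro sum.cong refl nn_integral_suminf) measurable
    finally have e: "(\<integral>\<^sup>+\<xi>. (\<Sum>b\<in>Basis. \<Sum>j. ennreal (?c j * ?d b j \<xi>) * ?F \<xi>) \<partial>lborel)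
        = (\<Sum>b\<in>Basis. \<Sum>j. \<integral>\<^sup>+\<xi>. ennreal (?c j * ?d b j \<xi>) * ?F \<xi> \<partial>lborel)" .
    have "(\<integral>\<^sup>+\<xi>. ennreal ?A * ((1 + (\<Sum>b\<in>Basis. \<Sum>j. ennreal (?c j * ?d b j \<xi>))) * ?F \<xi>) \<partial>lborel)
      = ennreal ?A * (\<integral>\<^sup>+\<xi>. ?F \<xi> + (\<Sum>b\<in>Basis. \<Sum>j. ennreal (?c j * ?d b j \<xi>) * ?F \<xi>) \<partial>lborel)"
      unfolding distrib_right sum_distrib_right mult_1_left ennreal_suminf_multc[symmetric]
      by (rule nn_integral_cmult) measurable
    also have "(\<integral>\<^sup>+\<xi>. ?F \<xi> + (\<Sum>b\<in>Basis. \<Sum>j. ennreal (?c j * ?d b j \<xi>) * ?F \<xi>) \<partial>lborel)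
      = (\<integral>\<^sup>+\<xi>. ?F \<xi> \<partial>lborel) + (\<integral>\<^sup>+\<xi>. (\<Sum>b\<in>Basis. \<Sum>j. ennreal (?c j * ?d b j \<xi>) * ?F \<xi>) \<partial>lborel)"
      by (rule nn_integral_add) measurable
    finally show ?thesis unfolding e .
  qed
  also have "\<dots> \<le> ennreal ?A * (ennreal ?P * (\<integral>\<^sup>+x. ennreal ((norm (G x))\<^sup>2) \<partial>lborel) +
    (\<Sum>b\<in>(Basis::'a set). \<Sum>j. ennreal ((4 powr r / ?k * ?P * C) * (4 powr (r - s)) ^ j)))"
    by (intro mult_left_mono add_mono bessel_inequality G sum_mono suminf_le dF) auto
  also have "\<dots> < \<infinity>"
  proof -
    have "(\<Sum>j. ennreal ((4 powr r / ?k * ?P * C) * (4 powr (r - s)) ^ j)) < \<infinity>"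
      by (rule suminf_geometric_less_top) (use r C k0 in \<open>auto simp: powr_less_one\<close>)
    then show ?thesis using L2
      by (simp add: ennreal_mult_less_top of_nat_less_top)
  qed
  finally show ?thesis .
qed

section \<open>Smooth functions and smooth domains\<close>

lemma smooth_on_differentiable:
  "smooth_on S f \<Longrightarrow> x \<in> S \<Longrightarrow> f differentiable (at x)"
  unfolding smooth_on_def by (drule bspec[OF _ lists.Nil]) simp

lemma smooth_on_has_derivative:
  "smooth_on S f \<Longrightarrow> x \<in> S \<Longrightarrow> (f has_derivative frechet_derivative f (at x)) (at x)"
  using smooth_on_differentiable frechet_derivative_works by blast

text \<open>\<open>smooth_on\<close> speaks of differentiability only, but of all iterated partials:
  a differentiable first partial is continuous.\<close>

lemma smooth_on_isCont_partial:
  assumes "smooth_on S f" "x \<in> S" "b \<in> Basis"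
  shows "isCont (\<lambda>z. frechet_derivative f (at z) b) x"
proof -
  have "[b] \<in> lists Basis" using assms by simp
  then have "iter_deriv [b] f differentiable (at x)"
    by (rule bspec[OF assms(1)[unfolded smooth_on_def], THEN bspec]) fact
  then show ?thesis using differentiable_imp_continuous_within by fastforce
qed

text \<open>A bound through finitely many values, so that continuity of the partial derivatives
  controls the derivative as a linear map.\<close>

lemma linear_norm_le_Basis:
  fixes D :: "'a::euclidean_space \<Rightarrow> 'b::real_normed_vector"
  assumes "linear D"
  shows "norm (D v) \<le> (\<Sum>b\<in>Basis. norm (D b)) * norm v"
proof -
  have "D v = D (\<Sum>b\<in>Basis. (v \<bullet> b) *\<^sub>R b)" by (simp add: euclidean_representation)
  also have "\<dots> = (\<Sum>b\<in>Basis. (v \<bullet> b) *\<^sub>R D b)"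
    using assms by (simp add: linear_sum linear_scale)
  also have "norm \<dots> \<le> (\<Sum>b\<in>Basis. norm ((v \<bullet> b) *\<^sub>R D b))" by (rule norm_sum)
  also have "\<dots> \<le> (\<Sum>b\<in>Basis. norm (D b) * norm v)"
    by (intro sum_mono) (simp add: mult.commute[of "norm (D _)"] mult_right_mono Basis_le_norm)
  finally show ?thesis by (simp add: sum_distrib_right)
qed

lemma smooth_on_Lipschitz:
  fixes f :: "'a::euclidean_space \<Rightarrow> 'b::real_normed_vector"
  assumes f: "smooth_on UNIV f" and K: "compact K" "convex K"
  obtains L where "0 \<le> L" "\<And>x y. x \<in> K \<Longrightarrow> y \<in> K \<Longrightarrow> norm (f x - f y) \<le> L * norm (x - y)"
proof -
  let ?S = "\<lambda>z. \<Sum>b\<in>Basis. norm (frechet_derivative f (at z) b)"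
  have "continuous_on K ?S"
    by (intro continuous_intros continuous_at_imp_continuous_on ballI smooth_on_isCont_partial[OF f]) auto
  then have "bounded (?S ` K)" using K by (intro compact_imp_bounded compact_continuous_image)
  then obtain L where L: "0 < L" "\<And>z. z \<in> K \<Longrightarrow> norm (?S z) \<le> L"
    by (auto simp: bounded_pos)
  have "norm (f x - f y) \<le> L * norm (x - y)" if "x \<in> K" "y \<in> K" for x y
  proof (rule differentiable_bound[OF K(2) _ _ that])
    fix z assume z: "z \<in> K"
    show "(f has_derivative frechet_derivative f (at z)) (at z within K)"
      using smooth_on_has_derivative[OF f] has_derivative_at_withinI by blast
    have lin: "linear (frechet_derivative f (at z))"
      using smooth_on_has_derivative[OF f, of z] has_derivative_linear by blast
    show "onorm (frechet_derivative f (at z)) \<le> L"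
    proof (rule onorm_le)
      fix v
      have "norm (frechet_derivative f (at z) v) \<le> ?S z * norm v" by (rule linear_norm_le_Basis[OF lin])
      also have "\<dots> \<le> L * norm v" using L(2)[OF z] by (intro mult_right_mono) auto
      finally show "norm (frechet_derivative f (at z) v) \<le> L * norm v" .
    qed
  qed
  then show thesis using L(1) by (intro that[of L]) auto
qed

text \<open>In the plane, the \<open>\<delta>\<close>-neighbourhood of such a set has area \<open>O(\<delta>)\<close>.\<close>

definition linearly_covered :: "'a::metric_space set \<Rightarrow> bool" where
  "linearly_covered S \<longleftrightarrow> (\<exists>C. \<forall>\<delta>. 0 < \<delta> \<and> \<delta> \<le> 1 \<longrightarrow>
     (\<exists>F. finite F \<and> real (card F) * \<delta> \<le> C \<and> S \<subseteq> (\<Union>z\<in>F. cball z \<delta>)))"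

lemma linearly_covered_mono: "linearly_covered T \<Longrightarrow> S \<subseteq> T \<Longrightarrow> linearly_covered S"
  unfolding linearly_covered_def by (meson order_trans)

lemma linearly_covered_empty: "linearly_covered {}"
  unfolding linearly_covered_def by (intro exI[of _ 0] allI impI exI[of _ "{}"]) simp

lemma linearly_covered_Un:
  assumes "linearly_covered S" "linearly_covered T"
  shows "linearly_covered (S \<union> T)"
proof -
  obtain C where C: "\<And>\<delta>. 0 < \<delta> \<Longrightarrow> \<delta> \<le> 1 \<Longrightarrow> \<exists>F. finite F \<and> real (card F) * \<delta> \<le> C \<and> S \<subseteq> (\<Union>z\<in>F. cball z \<delta>)"
    using assms(1) unfolding linearly_covered_def by blast
  obtain D where D: "\<And>\<delta>. 0 < \<delta> \<Longrightarrow> \<delta> \<le> 1 \<Longrightarrow> \<exists>F. finite F \<and> real (card F) * \<delta> \<le> D \<and> T \<subseteq> (\<Union>z\<in>F. cball z \<delta>)"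
    using assms(2) unfolding linearly_covered_def by blast
  have "\<exists>F. finite F \<and> real (card F) * \<delta> \<le> C + D \<and> S \<union> T \<subseteq> (\<Union>z\<in>F. cball z \<delta>)" if \<delta>: "0 < \<delta>" "\<delta> \<le> 1" for \<delta>
  proof -
    obtain F where F: "finite F" "real (card F) * \<delta> \<le> C" "S \<subseteq> (\<Union>z\<in>F. cball z \<delta>)" using C[OF \<delta>] by blast
    obtain G where G: "finite G" "real (card G) * \<delta> \<le> D" "T \<subseteq> (\<Union>z\<in>G. cball z \<delta>)" using D[OF \<delta>] by blast
    have "real (card (F \<union> G)) \<le> real (card F) + real (card G)"
      using card_Un_le[of F G] by linarith
    then have "real (card (F \<union> G)) * \<delta> \<le> (real (card F) + real (card G)) * \<delta>"
      using \<delta> by (intro mult_right_mono) auto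
    then have "real (card (F \<union> G)) * \<delta> \<le> C + D" using F(2) G(2) by (simp add: distrib_right)
    then show ?thesis using F G by (intro exI[of _ "F \<union> G"]) auto
  qed
  then show ?thesis unfolding linearly_covered_def by blast
qed

lemma linearly_covered_compact:
  fixes S :: "'a::metric_space set"
  assumes "compact S" and loc: "\<And>p. p \<in> S \<Longrightarrow> \<exists>r>0. linearly_covered (S \<inter> ball p r)"
  shows "linearly_covered S"
proof -
  obtain r where r: "\<And>p. p \<in> S \<Longrightarrow> 0 < r p \<and> linearly_covered (S \<inter> ball p (r p))" using loc by metis
  obtain D where D: "D \<subseteq> S" "finite D" "S \<subseteq> (\<Union>p\<in>D. ball p (r p))"
  proof (rule compactE_image[OF assms(1), of S "\<lambda>p. ball p (r p)"])
    show "S \<subseteq> (\<Union>p\<in>S. ball p (r p))" using r by fastforce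
  qed auto
  have "linearly_covered (S \<inter> (\<Union>p\<in>E. ball p (r p)))" if "finite E" "E \<subseteq> S" for E
    using that
  proof (induction E rule: finite_induct)
    case empty
    then show ?case by (simp add: linearly_covered_empty)
  next
    case (insert p E)
    then show ?case using r by (simp add: Int_Un_distrib linearly_covered_Un)
  qed
  then show ?thesis using D linearly_covered_mono by (metis Int_absorb2)
qed

text \<open>On \<open>S\<close> a point is determined by \<open>q x\<close>, with Lipschitz inverse.
  Cut the range of \<open>q\<close> into cells of length \<open>\<delta> / K\<close> and keep one
  point of \<open>S\<close> per occupied cell: two points of one cell are at most
  \<open>\<delta>\<close> apart. Working with \<open>K * q x / \<delta>\<close> covers
  \<open>K = 0\<close> as well.\<close>

lemma linearly_covered_expansive:
  fixes S :: "'a::metric_space set" and q :: "'a \<Rightarrow> real"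
  assumes q: "\<And>x y. x \<in> S \<Longrightarrow> y \<in> S \<Longrightarrow> dist x y \<le> K * \<bar>q x - q y\<bar>"
    and R: "\<And>x. x \<in> S \<Longrightarrow> \<bar>q x\<bar> \<le> R" and K: "0 \<le> K"
  shows "linearly_covered S"
  unfolding linearly_covered_def
\<comment> \<open>At most \<open>2 * K * \<bar>R\<bar> / \<delta> + 2\<close> cells occur, and
  \<open>\<delta> \<le> 1\<close>. The absolute value is there for empty \<open>S\<close>, where
  \<open>R\<close> may be negative.\<close>
proof (rule exI[of _ "2 * K * \<bar>R\<bar> + 2"], intro allI impI)
  fix \<delta> :: real assume "0 < \<delta> \<and> \<delta> \<le> 1"
  then have \<delta>: "0 < \<delta>" "\<delta> \<le> 1" by auto
  define m where "m x = \<lfloor>K * q x / \<delta>\<rfloor>" for x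
  \<comment> \<open>A representative in \<open>S\<close> of the cell with index
    \<open>i\<close>.\<close>
  define c where "c i = (SOME x. x \<in> S \<and> m x = i)" for i
  have c: "c (m x) \<in> S \<and> m (c (m x)) = m x" if "x \<in> S" for x
    unfolding c_def by (rule someI[of _ x]) (use that in simp)
  let ?A = "K * \<bar>R\<bar> / \<delta>"
  have "m ` S \<subseteq> {\<lfloor>- ?A\<rfloor>..\<lfloor>?A\<rfloor>}"
  proof
    fix i assume "i \<in> m ` S"
    then obtain x where x: "x \<in> S" "i = m x" by auto
    have "\<bar>q x\<bar> \<le> \<bar>R\<bar>" using R[OF x(1)] by linarith
    then have "\<bar>K * q x\<bar> \<le> K * \<bar>R\<bar>" using K by (simp add: abs_mult mult_left_mono)
    then have "- ?A \<le> K * q x / \<delta>" "K * q x / \<delta> \<le> ?A"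
      using \<delta> by (auto simp: field_simps abs_le_iff)
    then show "i \<in> {\<lfloor>- ?A\<rfloor>..\<lfloor>?A\<rfloor>}" unfolding x(2) m_def by (auto intro: floor_mono)
  qed
  then have fin: "finite (m ` S)" and "card (m ` S) \<le> card {\<lfloor>- ?A\<rfloor>..\<lfloor>?A\<rfloor>}"
    by (rule finite_subset, simp, rule card_mono[rotated], simp)
  moreover have "real (card {\<lfloor>- ?A\<rfloor>..\<lfloor>?A\<rfloor>}) \<le> 2 * ?A + 2"
  proof -
    have "0 \<le> ?A" using K \<delta> by simp
    then have "\<lfloor>- ?A\<rfloor> \<le> \<lfloor>?A\<rfloor>" by (intro floor_mono) linarith
    then show ?thesis by simp linarith
  qed
  moreover have "card (c ` m ` S) \<le> card (m ` S)" by (rule card_image_le[OF fin])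
  ultimately have "real (card (c ` m ` S)) \<le> 2 * ?A + 2" by linarith
  then have "real (card (c ` m ` S)) * \<delta> \<le> (2 * ?A + 2) * \<delta>" using \<delta> by (intro mult_right_mono) auto
  also have "\<dots> = 2 * K * \<bar>R\<bar> + 2 * \<delta>" using \<delta> by (simp add: field_simps)
  also have "\<dots> \<le> 2 * K * \<bar>R\<bar> + 2" using \<delta> by simp
  finally have card: "real (card (c ` m ` S)) * \<delta> \<le> 2 * K * \<bar>R\<bar> + 2" .
  have "S \<subseteq> (\<Union>z\<in>c ` m ` S. cball z \<delta>)"
  proof
    fix x assume x: "x \<in> S"
    let ?z = "c (m x)"
    have "m ?z = m x" "?z \<in> S" using c[OF x] by auto
    then have "\<bar>K * q ?z / \<delta> - K * q x / \<delta>\<bar> \<le> 1" unfolding m_def by linarith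
    moreover have "K * q ?z / \<delta> - K * q x / \<delta> = K * (q ?z - q x) / \<delta>"
      by (simp add: diff_divide_distrib right_diff_distrib)
    ultimately have "K * \<bar>q ?z - q x\<bar> / \<delta> \<le> 1" using \<delta> K by (simp add: abs_mult)
    then have "K * \<bar>q ?z - q x\<bar> \<le> \<delta>" using \<delta> by (simp add: pos_divide_le_eq)
    then have "dist ?z x \<le> \<delta>" using q[OF \<open>?z \<in> S\<close> x] by linarith
    then show "x \<in> (\<Union>z\<in>c ` m ` S. cball z \<delta>)" using x by auto
  qed
  with fin card show "\<exists>F. finite F \<and> real (card F) * \<delta> \<le> 2 * K * \<bar>R\<bar> + 2 \<and> S \<subseteq> (\<Union>z\<in>F. cball z \<delta>)"
    by (intro exI[of _ "c ` m ` S"]) auto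
qed

text \<open>The coordinates are named by two distinct indices in either order, since either partial
  derivative may be the nonzero one in \<open>frontier_linearly_covered\<close>.\<close>

lemma vec2_split:
  fixes x :: "real^2" and i j :: 2
  assumes "i \<noteq> j"
  shows "norm x \<le> \<bar>x $ i\<bar> + \<bar>x $ j\<bar>"
    and "linear D \<Longrightarrow> D x = (x $ i) *\<^sub>R D (axis i 1) + (x $ j) *\<^sub>R D (axis j 1)"
proof -
  have ij: "i = 1 \<and> j = 2 \<or> i = 2 \<and> j = 1" using assms exhaust_2 by metis
  show "norm x \<le> \<bar>x $ i\<bar> + \<bar>x $ j\<bar>"
    using norm_le_l1_cart[of x] ij by (auto simp: UNIV_2)
  assume D: "linear D"
  have "x = (x $ 1) *\<^sub>R axis 1 1 + (x $ 2) *\<^sub>R axis 2 1"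
    by (simp add: vec_eq_iff forall_2 axis_def)
  then have "D x = D ((x $ 1) *\<^sub>R axis 1 1 + (x $ 2) *\<^sub>R axis 2 1)" by (rule arg_cong)
  also have "\<dots> = (x $ 1) *\<^sub>R D (axis 1 1) + (x $ 2) *\<^sub>R D (axis 2 1)"
    by (simp only: linear_add[OF D] linear_scale[OF D])
  finally show "D x = (x $ i) *\<^sub>R D (axis i 1) + (x $ j) *\<^sub>R D (axis j 1)"
    using ij by auto
qed

text \<open>Near a boundary point \<open>p\<close>, closeness of the derivative of \<open>\<rho>\<close> to its value at \<open>p\<close> makes the zero
  set of \<open>\<rho>\<close> a Lipschitz graph over the coordinate \<open>j\<close>; the implicit function theorem is not needed.\<close>

lemma frontier_linearly_covered:
  fixes \<Omega> :: "(real^2) set"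
  assumes \<Omega>: "compact \<Omega>" "smooth_boundary \<Omega>"
  shows "linearly_covered (frontier \<Omega>)"
proof (rule linearly_covered_compact)
  show "compact (frontier \<Omega>)" using \<Omega>(1) by (rule compact_frontier)
  have clo: "closed \<Omega>" using \<Omega>(1) compact_imp_closed by blast
  fix p assume p: "p \<in> frontier \<Omega>"
  obtain U and \<rho> :: "real^2 \<Rightarrow> real" where ch: "open U \<and> p \<in> U \<and> smooth_on U \<rho> \<and>
      (\<forall>x\<in>U. \<exists>v. frechet_derivative \<rho> (at x) v \<noteq> 0) \<and> \<Omega> \<inter> U = {x \<in> U. \<rho> x \<le> 0}"
    using bspec[OF \<Omega>(2)[unfolded smooth_boundary_def] p] by (elim exE) (rule that)
  from ch have U: "open U" "p \<in> U" "smooth_on U \<rho>" by simp_all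
  from ch have \<Omega>U: "\<Omega> \<inter> U = {x \<in> U. \<rho> x \<le> 0}" by (elim conjE)
  from ch have nz: "\<forall>x\<in>U. \<exists>v. frechet_derivative \<rho> (at x) v \<noteq> 0" by (elim conjE)
  define D where "D z = frechet_derivative \<rho> (at z)" for z
  have der: "(\<rho> has_derivative D z) (at z)" if "z \<in> U" for z
    unfolding D_def using smooth_on_has_derivative[OF U(3) that] .
  have lin: "linear (D z)" if "z \<in> U" for z using der[OF that] has_derivative_linear by blast
  obtain v where v: "D p v \<noteq> 0" using bspec[OF nz U(2)] unfolding D_def by (elim exE)
  have "D p (axis 1 1) \<noteq> 0 \<or> D p (axis 2 1) \<noteq> 0"
  proof (rule ccontr)
    assume "\<not> ?thesis"
    then show False using v vec2_split(2)[of 1 2 "D p" v] lin[OF U(2)] by simp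
  qed
  then obtain i where i: "D p (axis i 1) \<noteq> 0" by blast
  have "\<exists>j. i \<noteq> j"
  proof (rule ccontr)
    assume "\<not> ?thesis"
    then have "(UNIV :: 2 set) = {i}" by auto
    then have "CARD(2) = card {i}" by (rule arg_cong)
    then show False by simp
  qed
  then obtain j where j: "i \<noteq> j" by blast
  \<comment> \<open>Half of the nonzero partial derivative, so that the linearisation error can be
    absorbed into the term of coordinate \<open>i\<close>.\<close>
  define \<epsilon> where "\<epsilon> = \<bar>D p (axis i 1)\<bar> / 2"
  have \<epsilon>: "0 < \<epsilon>" using i by (simp add: \<epsilon>_def)
  \<comment> \<open>Continuity is available for the partial derivatives, so they measure how close
    \<open>D z\<close> is to \<open>D p\<close>.\<close>
  let ?S = "\<lambda>z. \<Sum>b\<in>Basis. norm (D z b - D p b)"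
  have cont: "isCont ?S p"
    unfolding D_def by (intro continuous_intros smooth_on_isCont_partial[OF U(3) U(2)])
  obtain r1 where r1: "0 < r1" "\<And>z. dist z p < r1 \<Longrightarrow> dist (?S z) (?S p) < \<epsilon>"
    using spec[OF cont[unfolded continuous_at_eps_delta], of \<epsilon>] \<epsilon> by (elim impE exE conjE) (auto intro: that)
  have r1': "?S z \<le> \<epsilon>" if "dist z p < r1" for z
    using r1(2)[OF that] by (simp add: dist_real_def sum_nonneg)
  obtain r2 where r2: "0 < r2" "ball p r2 \<subseteq> U" using U(1,2) open_contains_ball by blast
  define r where "r = min r1 r2"
  have r: "0 < r" "ball p r \<subseteq> U" "\<And>z. z \<in> ball p r \<Longrightarrow> ?S z \<le> \<epsilon>"
    using r1(1) r2 r1' by (auto simp: r_def dist_commute)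
  have lip: "\<bar>\<rho> y - \<rho> x - D p (y - x)\<bar> \<le> norm (y - x) * \<epsilon>" if xy: "x \<in> ball p r" "y \<in> ball p r" for x y
  proof -
    have "norm (\<rho> y - \<rho> x - D p (y - x)) \<le> norm (y - x) * \<epsilon>"
    proof (rule differentiable_bound_linearization[where S="ball p r"])
      show "x + t *\<^sub>R (y - x) \<in> ball p r" if "t \<in> {0..1}" for t
      proof -
        have "x + t *\<^sub>R (y - x) \<in> closed_segment x y"
          using that by (auto simp: in_segment algebra_simps intro!: exI[of _ t])
        then show ?thesis using closed_segment_subset[OF xy convex_ball] by blast
      qed
      show "(\<rho> has_derivative D z) (at z within ball p r)" if "z \<in> ball p r" for z
        using der r(2) that has_derivative_at_withinI by blast
      show "onorm (D z - D p) \<le> \<epsilon>" if z: "z \<in> ball p r" for z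
      proof (rule onorm_le)
        fix w
        have "linear (\<lambda>i. D z i - D p i)" using lin z r(2) U(2) by (intro linear_compose_sub) auto
        then have "norm (D z w - D p w) \<le> ?S z * norm w" by (rule linear_norm_le_Basis)
        also have "\<dots> \<le> \<epsilon> * norm w" using r(3)[OF z] by (rule mult_right_mono) simp
        finally show "norm ((D z - D p) w) \<le> \<epsilon> * norm w" by simp
      qed
      show "p \<in> ball p r" using r by simp
    qed
    then show ?thesis by simp
  qed
  \<comment> \<open>A negative value would persist nearby and make \<open>x\<close> an interior
    point of \<open>\<Omega>\<close>; a positive value is excluded because \<open>\<Omega>\<close>
    is closed and contains \<open>x\<close>.\<close>
  have zero: "\<rho> x = 0" if x: "x \<in> frontier \<Omega>" "x \<in> U" for x
  proof (rule ccontr)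
    assume "\<rho> x \<noteq> 0"
    moreover have "x \<in> \<Omega>" using frontier_subset_closed[OF clo] x(1) by (rule subsetD)
    ultimately have "\<rho> x < 0" using \<Omega>U x by force
    moreover have "continuous_on U \<rho>"
      using der by (intro continuous_at_imp_continuous_on ballI has_derivative_continuous) blast
    ultimately have "open (U \<inter> \<rho> -` {..<0})" "x \<in> U \<inter> \<rho> -` {..<0}"
      using U(1) x by (auto intro: continuous_open_preimage)
    moreover have "U \<inter> \<rho> -` {..<0} \<subseteq> \<Omega>" using \<Omega>U by force
    ultimately have "x \<in> interior \<Omega>" by (meson interiorI)
    then show False using x by (simp add: frontier_def)
  qed
  \<comment> \<open>This is \<open>(\<bar>D p (axis j 1)\<bar> + \<epsilon>) / \<epsilon>\<close>,
    obtained by solving the linearised inequality below for coordinate \<open>i\<close>. The later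
    \<open>L + 1\<close> adds coordinate \<open>j\<close> itself.\<close>
  define L where "L = 2 * \<bar>D p (axis j 1)\<bar> / \<bar>D p (axis i 1)\<bar> + 1"
  have L0: "0 \<le> L" by (simp add: L_def)
  have "dist x y \<le> (L + 1) * \<bar>x $ j - y $ j\<bar>" if "x \<in> frontier \<Omega> \<inter> ball p r" "y \<in> frontier \<Omega> \<inter> ball p r" for x y
  proof -
    let ?w = "y - x"
    have "\<rho> x = 0" "\<rho> y = 0" using zero that r(2) by blast+
    then have "\<bar>D p ?w\<bar> \<le> norm ?w * \<epsilon>" using lip[of x y] that by auto
    also have "\<dots> \<le> (\<bar>?w $ i\<bar> + \<bar>?w $ j\<bar>) * \<epsilon>" using \<epsilon> by (intro mult_right_mono vec2_split(1)[OF j]) auto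
    finally have "\<bar>D p ?w\<bar> \<le> (\<bar>?w $ i\<bar> + \<bar>?w $ j\<bar>) * \<epsilon>" .
    moreover have "D p ?w = (?w $ i) * D p (axis i 1) + (?w $ j) * D p (axis j 1)"
      using vec2_split(2)[OF j lin[OF U(2)], of ?w] by simp
    moreover have "\<bar>?w $ i * D p (axis i 1)\<bar> = \<bar>?w $ i\<bar> * (2 * \<epsilon>)" by (simp add: abs_mult \<epsilon>_def)
    moreover have "\<bar>?w $ j * D p (axis j 1)\<bar> = \<bar>?w $ j\<bar> * \<bar>D p (axis j 1)\<bar>" by (simp add: abs_mult)
    ultimately have "\<bar>?w $ i\<bar> * (2 * \<epsilon>) \<le> \<bar>?w $ j\<bar> * \<bar>D p (axis j 1)\<bar> + (\<bar>?w $ i\<bar> + \<bar>?w $ j\<bar>) * \<epsilon>"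
      by linarith
    then have "\<bar>?w $ i\<bar> * \<epsilon> \<le> \<bar>?w $ j\<bar> * (\<bar>D p (axis j 1)\<bar> + \<epsilon>)" by (simp add: algebra_simps)
    also have "\<bar>D p (axis j 1)\<bar> + \<epsilon> = L * \<epsilon>" using i by (simp add: L_def \<epsilon>_def field_simps)
    finally have "\<bar>?w $ i\<bar> * \<epsilon> \<le> (L * \<bar>?w $ j\<bar>) * \<epsilon>" by (simp add: ac_simps)
    then have "\<bar>?w $ i\<bar> \<le> L * \<bar>?w $ j\<bar>" using \<epsilon> by (simp only: mult_le_cancel_right_pos)
    then have "norm ?w \<le> (L + 1) * \<bar>?w $ j\<bar>" using vec2_split(1)[OF j, of ?w] by (simp add: algebra_simps)
    then show ?thesis by (simp add: dist_norm norm_minus_commute abs_minus_commute)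
  qed
  moreover have "\<bar>x $ j\<bar> \<le> norm p + r" if "x \<in> frontier \<Omega> \<inter> ball p r" for x
  proof -
    have "norm x \<le> norm p + norm (x - p)" by (rule norm_triangle_sub)
    also have "norm (x - p) \<le> r" using that by (auto simp: dist_norm norm_minus_commute)
    finally show ?thesis using component_le_norm_cart[of x j] by linarith
  qed
  ultimately have "linearly_covered (frontier \<Omega> \<inter> ball p r)"
    using L0 by (intro linearly_covered_expansive[where q="\<lambda>x. x $ j" and K="L + 1" and R="norm p + r"]) auto
  then show "\<exists>r>0. linearly_covered (frontier \<Omega> \<inter> ball p r)" using r(1) by blast
qed

text \<open>If exactly one of \<open>x\<close> and \<open>x + h\<close> lies in
  \<open>\<Omega>\<close>, the segment between them meets the frontier, so \<open>x\<close> is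
  within \<open>2 * norm h\<close> of a centre of the cover. There are O(1/|h|) such discs, each of
  area O(|h|^2). A bound linear in \<open>norm h\<close> for squared differences corresponds to
  order 1/2.\<close>

lemma cutoff_difference_L2:
  fixes u :: "real^2 \<Rightarrow> real"
  assumes u: "smooth_on UNIV u" and \<Omega>: "compact \<Omega>" "smooth_boundary \<Omega>" "\<Omega> \<subseteq> ball 0 1"
  obtains C where "0 \<le> C" "\<And>h. norm h \<le> 1 \<Longrightarrow>
    (\<integral>\<^sup>+x. ennreal ((u (x + h) * indicator \<Omega> (x + h) - u x * indicator \<Omega> x)\<^sup>2) \<partial>lborel) \<le> ennreal (C * norm h)"
proof -
  let ?f = "\<lambda>x. u x * indicator \<Omega> x"
  obtain L where L: "0 \<le> L" "\<And>x y. x \<in> cball 0 1 \<Longrightarrow> y \<in> cball 0 1 \<Longrightarrow> norm (u x - u y) \<le> L * norm (x - y)"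
    using smooth_on_Lipschitz[OF u compact_cball convex_cball] by blast
  have "continuous_on \<Omega> u"
    using smooth_on_differentiable[OF u] by (intro continuous_at_imp_continuous_on ballI differentiable_imp_continuous_within) auto
  then have "bounded (u ` \<Omega>)" using \<Omega> by (intro compact_imp_bounded compact_continuous_image)
  then obtain M where M: "0 < M" "\<And>x. x \<in> \<Omega> \<Longrightarrow> \<bar>u x\<bar> \<le> M" by (auto simp: bounded_pos)
  obtain A where A: "\<And>\<delta>. 0 < \<delta> \<Longrightarrow> \<delta> \<le> 1 \<Longrightarrow> \<exists>F. finite F \<and> real (card F) * \<delta> \<le> A \<and> frontier \<Omega> \<subseteq> (\<Union>z\<in>F. cball z \<delta>)"
    using frontier_linearly_covered[OF \<Omega>(1,2)] unfolding linearly_covered_def by blast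
  have A0: "0 \<le> A" using A[of 1] by force
  let ?V = "unit_ball_vol 2"
  \<comment> \<open>First summand: points not separated from their translate by the boundary,
    integrated over the unit disc. Second summand: \<open>card F\<close> discs of radius
    \<open>2 * \<delta>\<close>, with jump at most \<open>M\<close> and
    \<open>card F * \<delta> \<le> A\<close>.\<close>
  let ?C = "L\<^sup>2 * ?V + 4 * M\<^sup>2 * ?V * A"
  have em: "emeasure lborel (cball (z::real^2) r) = ennreal (?V * r\<^sup>2)" if "0 \<le> r" for z r
    using emeasure_cball[OF that, of z] by simp
  have V0: "0 \<le> ?V" by simp
  have C0: "0 \<le> ?C" using V0 A0 by simp
  have "(\<integral>\<^sup>+x. ennreal ((?f (x + h) - ?f x)\<^sup>2) \<partial>lborel) \<le> ennreal (?C * norm h)" if h: "norm h \<le> 1" for h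
  proof (cases "h = 0")
    case False
    define \<delta> where "\<delta> = norm h"
    have \<delta>: "0 < \<delta>" "\<delta> \<le> 1" using False h by (auto simp: \<delta>_def)
    obtain F where F: "finite F" "real (card F) * \<delta> \<le> A" "frontier \<Omega> \<subseteq> (\<Union>z\<in>F. cball z \<delta>)"
      using A[OF \<delta>] by blast
    have bad: "\<exists>z\<in>F. x \<in> cball z (2 * \<delta>)" if "(x \<in> \<Omega>) \<noteq> (x + h \<in> \<Omega>)" for x
    proof -
      have "closed_segment x (x + h) \<inter> frontier \<Omega> \<noteq> {}"
        using that by (intro connected_Int_frontier) auto
      then obtain y where y: "y \<in> closed_segment x (x + h)" "y \<in> frontier \<Omega>" by blast
      have "dist x y \<le> \<delta>" using segment_bound(1)[OF y(1)] by (simp add: dist_norm \<delta>_def norm_minus_commute)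
      moreover obtain z where "z \<in> F" "dist z y \<le> \<delta>" using F(3) y(2) by auto
      ultimately show ?thesis using dist_triangle[of z x y] by (intro bexI[of _ z]) (auto simp: dist_commute)
    qed
    have "(?f (x + h) - ?f x)\<^sup>2 \<le> (L * \<delta>)\<^sup>2 * indicator (cball 0 1) x + (\<Sum>z\<in>F. M\<^sup>2 * indicator (cball z (2 * \<delta>)) x)" for x
    proof -
      have s0: "0 \<le> (\<Sum>z\<in>F. M\<^sup>2 * indicator (cball z (2 * \<delta>)) x)" by (intro sum_nonneg) simp
      show ?thesis
      proof (cases "(x \<in> \<Omega>) = (x + h \<in> \<Omega>)")
        case True
        show ?thesis
        proof (cases "x \<in> \<Omega>")
          case xin: True
          then have "x \<in> cball 0 1" "x + h \<in> cball 0 1" using True \<Omega>(3) by (force simp: subset_iff)+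
          then have "\<bar>u (x + h) - u x\<bar> \<le> L * \<delta>" using L(2)[of "x + h" x] by (simp add: \<delta>_def)
          then have "(u (x + h) - u x)\<^sup>2 \<le> (L * \<delta>)\<^sup>2" by (metis abs_ge_zero power2_abs power_mono)
          then show ?thesis using s0 xin True \<open>x \<in> cball 0 1\<close> by simp
        next
          case False
          then show ?thesis using s0 True by simp
        qed
      next
        case ne: False
        then obtain z where z: "z \<in> F" "x \<in> cball z (2 * \<delta>)" using bad by blast
        \<comment> \<open>One of the two values is 0, so a single bound \<open>M\<close>
          suffices.\<close>
        have "\<bar>?f (x + h) - ?f x\<bar> \<le> M" using M ne by (auto simp: indicator_def)
        then have "(?f (x + h) - ?f x)\<^sup>2 \<le> M\<^sup>2" by (metis abs_ge_zero power2_abs power_mono)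
        also have "\<dots> = M\<^sup>2 * indicator (cball z (2 * \<delta>)) x" using z by simp
        also have "\<dots> \<le> (\<Sum>z\<in>F. M\<^sup>2 * indicator (cball z (2 * \<delta>)) x)"
          using z F(1) by (intro member_le_sum) auto
        finally show ?thesis by (simp add: add_increasing)
      qed
    qed
    then have "(\<integral>\<^sup>+x. ennreal ((?f (x + h) - ?f x)\<^sup>2) \<partial>lborel) \<le>
      (\<integral>\<^sup>+x. ennreal ((L * \<delta>)\<^sup>2) * indicator (cball 0 1) x + (\<Sum>z\<in>F. ennreal (M\<^sup>2) * indicator (cball z (2 * \<delta>)) x) \<partial>lborel)"
    proof (intro nn_integral_mono)
      fix x
      assume le: "\<And>x. (?f (x + h) - ?f x)\<^sup>2 \<le> (L * \<delta>)\<^sup>2 * indicator (cball 0 1) x + (\<Sum>z\<in>F. M\<^sup>2 * indicator (cball z (2 * \<delta>)) x)"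
      have "ennreal ((?f (x + h) - ?f x)\<^sup>2) \<le> ennreal ((L * \<delta>)\<^sup>2 * indicator (cball 0 1) x + (\<Sum>z\<in>F. M\<^sup>2 * indicator (cball z (2 * \<delta>)) x))"
        by (intro ennreal_leI le)
      also have "\<dots> = ennreal ((L * \<delta>)\<^sup>2 * indicator (cball 0 1) x) + (\<Sum>z\<in>F. ennreal (M\<^sup>2 * indicator (cball z (2 * \<delta>)) x))"
        by (subst ennreal_plus) (auto intro!: sum_nonneg)
      also have "\<dots> = ennreal ((L * \<delta>)\<^sup>2) * indicator (cball 0 1) x + (\<Sum>z\<in>F. ennreal (M\<^sup>2) * indicator (cball z (2 * \<delta>)) x)"
        by (intro arg_cong2[of _ _ _ _ "(+)"] sum.cong refl) (simp_all only: ennreal_mult' zero_le_power2 ennreal_indicator indicator_pos_le ennreal_mult)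
      finally show "ennreal ((?f (x + h) - ?f x)\<^sup>2) \<le> ennreal ((L * \<delta>)\<^sup>2) * indicator (cball 0 1) x + (\<Sum>z\<in>F. ennreal (M\<^sup>2) * indicator (cball z (2 * \<delta>)) x)" .
    qed
    also have "\<dots> = ennreal ((L * \<delta>)\<^sup>2) * emeasure lborel (cball (0::real^2) 1) + (\<Sum>z\<in>F. ennreal (M\<^sup>2) * emeasure lborel (cball z (2 * \<delta>)))"
    proof -
      have m: "(\<lambda>x. ennreal c * indicator (cball (z::real^2) r) x) \<in> borel_measurable lborel" for c z r
        by (intro borel_measurable_times_ennreal borel_measurable_const borel_measurable_indicator) simp
      have i: "(\<integral>\<^sup>+x. ennreal c * indicator (cball (z::real^2) r) x \<partial>lborel) = ennreal c * emeasure lborel (cball z r)" for c z r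
        by (rule nn_integral_cmult_indicator) simp
      show ?thesis by (simp only: nn_integral_add[OF m borel_measurable_sum[OF m]] nn_integral_sum[OF m] i)
    qed
    also have "\<dots> = ennreal ((L * \<delta>)\<^sup>2 * ?V + real (card F) * (M\<^sup>2 * (?V * (2 * \<delta>)\<^sup>2)))"
    proof -
      have "(\<Sum>z\<in>F. ennreal (M\<^sup>2) * emeasure lborel (cball z (2 * \<delta>))) = (\<Sum>z\<in>F. ennreal (M\<^sup>2 * (?V * (2 * \<delta>)\<^sup>2)))"
        using \<delta> V0 by (intro sum.cong refl) (simp only: em ennreal_mult zero_le_power2 mult_nonneg_nonneg less_imp_le zero_le_numeral)
      also have "\<dots> = ennreal (\<Sum>z\<in>F. M\<^sup>2 * (?V * (2 * \<delta>)\<^sup>2))" using V0 by (intro sum_ennreal) simp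
      also have "\<dots> = ennreal (real (card F) * (M\<^sup>2 * (?V * (2 * \<delta>)\<^sup>2)))" by simp
      finally have e: "(\<Sum>z\<in>F. ennreal (M\<^sup>2) * emeasure lborel (cball z (2 * \<delta>))) = ennreal (real (card F) * (M\<^sup>2 * (?V * (2 * \<delta>)\<^sup>2)))" .
      have "ennreal ((L * \<delta>)\<^sup>2) * emeasure lborel (cball (0::real^2) 1) = ennreal ((L * \<delta>)\<^sup>2 * ?V)"
        using em[of 1 0] V0 by (simp add: ennreal_mult)
      then show ?thesis unfolding e using V0 by (subst ennreal_plus) auto
    qed
    also have "\<dots> \<le> ennreal (?C * \<delta>)"
    proof (rule ennreal_leI)
      have "(L * \<delta>)\<^sup>2 * ?V = L\<^sup>2 * ?V * \<delta> * \<delta>" by (simp add: power2_eq_square)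
      also have "\<dots> \<le> L\<^sup>2 * ?V * \<delta> * 1" using \<delta> V0 by (intro mult_left_mono) auto
      finally have 1: "(L * \<delta>)\<^sup>2 * ?V \<le> L\<^sup>2 * ?V * \<delta>" by simp
      have "real (card F) * (M\<^sup>2 * (?V * (2 * \<delta>)\<^sup>2)) = (4 * M\<^sup>2 * ?V * \<delta>) * (real (card F) * \<delta>)"
        by (simp add: power2_eq_square)
      also have "\<dots> \<le> (4 * M\<^sup>2 * ?V * \<delta>) * A" using \<delta> V0 F(2) by (intro mult_left_mono) auto
      finally have 2: "real (card F) * (M\<^sup>2 * (?V * (2 * \<delta>)\<^sup>2)) \<le> (4 * M\<^sup>2 * ?V * \<delta>) * A" .
      have "?C * \<delta> = L\<^sup>2 * ?V * \<delta> + (4 * M\<^sup>2 * ?V * \<delta>) * A" unfolding distrib_right by (simp only: ac_simps)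
      then show "(L * \<delta>)\<^sup>2 * ?V + real (card F) * (M\<^sup>2 * (?V * (2 * \<delta>)\<^sup>2)) \<le> ?C * \<delta>"
        using 1 2 by linarith
    qed
    finally show ?thesis by (simp add: \<delta>_def)
  qed simp
  then show thesis using C0 by (intro that) auto
qed

section \<open>Schwartz functions and tempered distributions\<close>

lemma smooth_on_continuous: "smooth_on UNIV f \<Longrightarrow> continuous_on UNIV f"
  by (intro continuous_at_imp_continuous_on ballI differentiable_imp_continuous_within smooth_on_differentiable) auto

lemma smooth_on_borel_measurable: "smooth_on UNIV f \<Longrightarrow> f \<in> borel_measurable borel"
  by (intro borel_measurable_continuous_onI smooth_on_continuous)

lemma schwartz_borel_measurable: "f \<in> schwartz \<Longrightarrow> f \<in> borel_measurable borel"
  by (auto simp: schwartz_def intro: smooth_on_borel_measurable)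

lemma schwartz_decay:
  assumes "f \<in> schwartz"
  obtains B where "0 \<le> B" "\<And>x. norm x ^ k * norm (f x) \<le> B"
proof -
  have "\<forall>vs\<in>lists Basis. bounded (range (\<lambda>x. norm x ^ k *\<^sub>R iter_deriv vs f x))"
    using assms unfolding schwartz_def by blast
  from bspec[OF this lists.Nil] obtain B where "0 < B" "\<And>x. norm x ^ k * norm (f x) \<le> B"
    by (auto simp: bounded_pos)
  then show thesis by (intro that[of B]) auto
qed

lemma integrable_bracket:
  assumes "real DIM('a) < 2 * s"
  shows "integrable lborel (\<lambda>x::'a::euclidean_space. bracket x powr (- s))"
  using nn_integral_bracket_less_top[OF assms] by (intro integrableI_nonneg) auto

text \<open>With \<open>m\<close> the dimension, decay of orders 0 and \<open>2 * m\<close> together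
  gives the bound \<open>bracket x powr (- m)\<close>, which is integrable because
  \<open>m < 2 * m\<close>.\<close>

lemma schwartz_integrable:
  fixes f :: "'a::euclidean_space \<Rightarrow> complex"
  assumes f: "f \<in> schwartz"
  shows "integrable lborel f"
proof -
  define m where "m = DIM('a)"
  have m: "0 < m" "real DIM('a) < 2 * real m" by (auto simp: m_def)
  obtain A where A: "0 \<le> A" "\<And>x. norm x ^ 0 * norm (f x) \<le> A" using schwartz_decay[OF f] by blast
  obtain B where B: "0 \<le> B" "\<And>x. norm x ^ (2 * m) * norm (f x) \<le> B" using schwartz_decay[OF f] by blast
  have "norm (f x) \<le> (2 ^ m * (A + B)) * bracket x powr (- real m)" for x
  proof -
    let ?y = "(norm x)\<^sup>2"
    have "(1 + ?y) ^ m \<le> (2 * max 1 ?y) ^ m" by (intro power_mono) auto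
    also have "\<dots> = 2 ^ m * max 1 ?y ^ m" by (simp add: power_mult_distrib)
    also have "\<dots> \<le> 2 ^ m * (1 + ?y ^ m)" by (intro mult_left_mono) (auto simp: max_def)
    finally have "(1 + ?y) ^ m * norm (f x) \<le> 2 ^ m * (1 + ?y ^ m) * norm (f x)"
      by (rule mult_right_mono) simp
    also have "\<dots> = 2 ^ m * (norm x ^ 0 * norm (f x) + norm x ^ (2 * m) * norm (f x))"
      unfolding power_mult by (simp add: algebra_simps)
    also have "\<dots> \<le> 2 ^ m * (A + B)" using A B by (intro mult_left_mono add_mono) auto
    finally have "(1 + ?y) ^ m * norm (f x) \<le> 2 ^ m * (A + B)" .
    moreover have "0 < 1 + ?y" by (simp add: add_pos_nonneg)
    ultimately show ?thesis
      by (simp add: powr_minus powr_realpow field_simps)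
  qed
  then have "norm (f x) \<le> norm ((2 ^ m * (A + B)) * bracket x powr (- real m))" for x
    by (metis abs_ge_self order_trans real_norm_def)
  then show ?thesis
    using schwartz_borel_measurable[OF f]
    by (intro Bochner_Integration.integrable_bound[OF integrable_mult_right[OF integrable_bracket[OF m(2)], of "2 ^ m * (A + B)"]]) auto
qed

text \<open>At index 0 only the empty list and the power 0 remain, so this seminorm is the supremum
  norm; \<open>schwartz_decay\<close> provides an upper bound for the supremum.\<close>

lemma norm_le_schwartz_norm:
  assumes f: "f \<in> schwartz"
  shows "norm (f x) \<le> schwartz_norm 0 f"
proof -
  have *: "{vs \<in> lists Basis. length vs \<le> 0} = {[] :: 'a list}" by auto
  have "schwartz_norm 0 f = (SUP x. norm (f x))" unfolding schwartz_norm_def * by simp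
  moreover obtain B where "\<And>x. norm x ^ 0 * norm (f x) \<le> B" using schwartz_decay[OF f] by blast
  ultimately show ?thesis by (auto intro!: cSUP_upper bdd_aboveI)
qed

lemma integrable_mult_schwartz:
  fixes H :: "'a::euclidean_space \<Rightarrow> complex"
  assumes H: "integrable lborel H" and f: "f \<in> schwartz"
  shows "integrable lborel (\<lambda>x. H x * f x)"
proof -
  have [measurable]: "H \<in> borel_measurable borel" "f \<in> borel_measurable borel"
    using H schwartz_borel_measurable[OF f] by auto
  have "norm (H x * f x) \<le> norm (schwartz_norm 0 f * norm (H x))" for x
    using norm_le_schwartz_norm[OF f, of x] mult_mono[of "norm (f x)" "\<bar>schwartz_norm 0 f\<bar>" "norm (H x)" "norm (H x)"]
    by (simp add: norm_mult abs_mult mult.commute)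
  then show ?thesis
    by (intro Bochner_Integration.integrable_bound[OF integrable_mult_right[OF integrable_norm[OF H], of "schwartz_norm 0 f"]]) auto
qed

lemma dist_of_lborel:
  assumes "H \<in> borel_measurable borel" "f \<in> borel_measurable borel"
  shows "dist_of H f = (LINT x|lborel. H x * f x)"
  unfolding dist_of_def using assms by (intro integral_completion) auto

text \<open>The pairing is bounded by the L^1 norm of \<open>H\<close> times the supremum of the
  test function, so the seminorm of index 0 is enough.\<close>

lemma tempered_distribution_dist_of:
  fixes H :: "'a::euclidean_space \<Rightarrow> complex"
  assumes H: "integrable lborel H"
  shows "tempered_distribution (dist_of H)"
  unfolding tempered_distribution_def
proof (intro conjI ballI allI)
  have Hm [measurable]: "H \<in> borel_measurable borel" using H by auto
  fix f :: "'a \<Rightarrow> complex" assume f: "f \<in> schwartz"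
  note fm [measurable] = schwartz_borel_measurable[OF f]
  show "dist_of H (\<lambda>x. f x + g x) = dist_of H f + dist_of H g" if g: "g \<in> schwartz" for g
  proof -
    note [measurable] = schwartz_borel_measurable[OF g]
    show ?thesis using integrable_mult_schwartz[OF H f] integrable_mult_schwartz[OF H g]
      by (simp add: dist_of_lborel distrib_left)
  qed
  show "dist_of H (\<lambda>x. c * f x) = c * dist_of H f" for c
    by (simp add: dist_of_lborel mult.left_commute)
next
  have [measurable]: "H \<in> borel_measurable borel" using H by auto
  have "norm (dist_of H f) \<le> (LINT x|lborel. norm (H x)) * schwartz_norm 0 f" if f: "f \<in> schwartz" for f
  proof -
    have [measurable]: "f \<in> borel_measurable borel" using schwartz_borel_measurable[OF f] .
    have "norm (LINT x|lborel. H x * f x) \<le> (LINT x|lborel. norm (H x * f x))" by (rule integral_norm_bound)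
    also have "\<dots> \<le> (LINT x|lborel. norm (H x) * schwartz_norm 0 f)"
      using integrable_mult_schwartz[OF H f] H
      by (intro integral_mono integrable_norm integrable_mult_left)
         (auto simp: norm_mult intro!: mult_left_mono norm_le_schwartz_norm f)
    finally show ?thesis by (simp add: dist_of_lborel)
  qed
  then show "\<exists>N C. \<forall>f\<in>schwartz. norm (dist_of H f) \<le> C * schwartz_norm N f" by blast
qed

text \<open>The witness in \<open>H_space\<close> is the ordinary transform of \<open>H\<close>:
  \<open>fourier_multiplication\<close> identifies it with the distributional one, and its
  boundedness makes the pairings with Schwartz functions integrable.\<close>

lemma dist_of_in_H_space:
  fixes H :: "'a::euclidean_space \<Rightarrow> complex"
  assumes H: "integrable lborel H"
    and fin: "Lp_norm p lebesgue (\<lambda>\<xi>. of_real (bracket \<xi> powr (t / 2)) * fourier H \<xi>) < \<infinity>"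
  shows "dist_of H \<in> H_space t p"
proof -
  have Hm [measurable]: "H \<in> borel_measurable borel" using H by auto
  have Fm [measurable]: "fourier H \<in> borel_measurable borel" using fourier_measurable[OF Hm, of "\<lambda>x. x" borel] by simp
  have "integrable lebesgue (\<lambda>\<xi>. fourier H \<xi> * f \<xi>) \<and> dist_fourier (dist_of H) f = dist_of (fourier H) f"
    if f: "f \<in> schwartz" for f
  proof
    have fm [measurable]: "f \<in> borel_measurable borel" using schwartz_borel_measurable[OF f] .
    have Ff [measurable]: "fourier f \<in> borel_measurable borel" using fourier_measurable[OF fm, of "\<lambda>x. x" borel] by simp
    have fi: "integrable lborel f" by (rule schwartz_integrable[OF f])
    have "integrable lborel (\<lambda>\<xi>. fourier H \<xi> * f \<xi>)"
    proof (rule Bochner_Integration.integrable_bound[OF integrable_mult_right[OF fi, of "of_real (LINT x|lborel. norm (H x))"]])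
      show "AE \<xi> in lborel. norm (fourier H \<xi> * f \<xi>) \<le> norm (of_real (LINT x|lborel. norm (H x)) * f \<xi>)"
        using norm_fourier_le[OF H] by (intro AE_I2) (auto simp: norm_mult intro!: mult_right_mono)
    qed measurable
    then show "integrable lebesgue (\<lambda>\<xi>. fourier H \<xi> * f \<xi>)" by (subst integrable_completion) auto
    show "dist_fourier (dist_of H) f = dist_of (fourier H) f"
      unfolding dist_fourier_def dist_of_lborel[OF Hm Ff] dist_of_lborel[OF Fm fm]
      by (rule fourier_multiplication[OF H fi, symmetric])
  qed
  moreover have "fourier H \<in> borel_measurable lebesgue" by (rule measurable_completion) simp
  ultimately show ?thesis
    unfolding H_space_def using tempered_distribution_dist_of[OF H] fin
    by (intro CollectI conjI bexI[of _ "fourier H"]) auto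
qed

text \<open>\<open>wnorm2\<close> is the square of the norm in question, and lowering the order is
  free because the bracket is at least 1.\<close>

lemma dist_of_in_H_space_2:
  fixes H :: "'a::euclidean_space \<Rightarrow> complex"
  assumes H: "integrable lborel H"
    and fin: "wnorm2 t (fourier H) < \<infinity>"
    and "t' \<le> t"
  shows "dist_of H \<in> H_space t' 2"
proof (rule dist_of_in_H_space[OF H])
  have "(bracket \<xi> powr (t' / 2) * norm (fourier H \<xi>)) powr 2 \<le> bracket \<xi> powr t * (norm (fourier H \<xi>))\<^sup>2" for \<xi>
  proof -
    have "(bracket \<xi> powr (t' / 2) * norm (fourier H \<xi>)) powr 2 = bracket \<xi> powr t' * (norm (fourier H \<xi>))\<^sup>2"
      by (simp add: powr_mult powr_powr)
    also have "\<dots> \<le> bracket \<xi> powr t * (norm (fourier H \<xi>))\<^sup>2"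
      using \<open>t' \<le> t\<close> by (intro mult_right_mono powr_mono) auto
    finally show ?thesis .
  qed
  then have "(\<integral>\<^sup>+\<xi>. ennreal (norm (of_real (bracket \<xi> powr (t' / 2)) * fourier H \<xi>) powr 2) \<partial>lborel) \<le> wnorm2 t (fourier H)"
    unfolding wnorm2_def by (intro nn_integral_mono ennreal_leI) (simp add: norm_mult)
  then have "(\<integral>\<^sup>+\<xi>. ennreal (norm (of_real (bracket \<xi> powr (t' / 2)) * fourier H \<xi>) powr 2) \<partial>lborel) < \<infinity>"
    using fin by (rule le_less_trans)
  then show "Lp_norm 2 lebesgue (\<lambda>\<xi>. of_real (bracket \<xi> powr (t' / 2)) * fourier H \<xi>) < \<infinity>"
    by (simp add: Lp_norm_def nn_integral_completion Let_def less_top)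
qed

lemma dist_of_in_H_space_1:
  fixes H :: "'a::euclidean_space \<Rightarrow> complex"
  assumes H: "integrable lborel H" and fin: "wnorm2 t (fourier H) < \<infinity>" and t': "t' < t - real DIM('a) / 2"
  shows "dist_of H \<in> H_space t' 1"
proof (rule dist_of_in_H_space[OF H])
  have "H \<in> borel_measurable borel" using H by auto
  then have "fourier H \<in> borel_measurable borel" using fourier_measurable[of H "\<lambda>x. x" borel] by simp
  from nn_integral_bracket_norm_less_top[OF t' this fin]
  show "Lp_norm 1 lebesgue (\<lambda>\<xi>. of_real (bracket \<xi> powr (t' / 2)) * fourier H \<xi>) < \<infinity>"
    by (simp add: Lp_norm_def nn_integral_completion Let_def less_top norm_mult)
qed

text \<open>A class containing a Gaussian and closed under partial derivatives, so that every
  \<open>iter_deriv\<close> of a Gaussian is covered by one decay estimate.\<close>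

inductive gauss_span :: "real \<Rightarrow> 'a::euclidean_space \<Rightarrow> ('a \<Rightarrow> complex) \<Rightarrow> bool" for c a where
  base: "gauss_span c a (\<lambda>x. of_real (exp (- c * ((x - a) \<bullet> (x - a)))))"
| add: "gauss_span c a f \<Longrightarrow> gauss_span c a g \<Longrightarrow> gauss_span c a (\<lambda>x. f x + g x)"
| scale: "gauss_span c a f \<Longrightarrow> gauss_span c a (\<lambda>x. of_real r * f x)"
| coord: "gauss_span c a f \<Longrightarrow> gauss_span c a (\<lambda>x. of_real ((x - a) \<bullet> v) * f x)"

text \<open>Real coefficients suffice: differentiating the base function produces a linear
  coordinate factor, and the product rule applied to \<open>coord\<close> gives one term of the form
  \<open>coord\<close> and one of the form \<open>scale\<close>.\<close>

lemma gauss_span_has_derivative: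
  "gauss_span c a f \<Longrightarrow> \<exists>D. (\<forall>x. (f has_derivative D x) (at x)) \<and> (\<forall>v. gauss_span c a (\<lambda>x. D x v))"
proof (induction rule: gauss_span.induct)
  case base
  let ?e = "\<lambda>x. exp (- c * ((x - a) \<bullet> (x - a)))"
  have "((\<lambda>x. complex_of_real (?e x)) has_derivative (\<lambda>v. of_real ((x - a) \<bullet> ((- 2 * c) *\<^sub>R v)) * of_real (?e x))) (at x)" for x
  proof -
    have "(?e has_derivative (\<lambda>v. ((x - a) \<bullet> ((- 2 * c) *\<^sub>R v)) * ?e x)) (at x)"
      by (auto intro!: derivative_eq_intros simp: inner_commute algebra_simps)
    from has_derivative_of_real[OF this] show ?thesis by simp
  qed
  then show ?case using gauss_span.coord[OF gauss_span.base, of c a]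
    by (intro exI[of _ "\<lambda>x v. of_real ((x - a) \<bullet> ((- 2 * c) *\<^sub>R v)) * of_real (?e x)"]) blast
next
  case (add f g)
  then obtain D E where D: "\<forall>x. (f has_derivative D x) (at x)" "\<forall>v. gauss_span c a (\<lambda>x. D x v)"
    and E: "\<forall>x. (g has_derivative E x) (at x)" "\<forall>v. gauss_span c a (\<lambda>x. E x v)" by blast
  then show ?case
    by (intro exI[of _ "\<lambda>x v. D x v + E x v"]) (auto intro: has_derivative_add gauss_span.add)
next
  case (scale f r)
  then obtain D where D: "\<forall>x. (f has_derivative D x) (at x)" "\<forall>v. gauss_span c a (\<lambda>x. D x v)" by blast
  then show ?case
    by (intro exI[of _ "\<lambda>x v. of_real r * D x v"]) (auto intro: has_derivative_mult_right gauss_span.scale)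
next
  case (coord f w)
  then obtain D where D: "\<forall>x. (f has_derivative D x) (at x)" "\<forall>v. gauss_span c a (\<lambda>x. D x v)" by blast
  have "((\<lambda>x. of_real ((x - a) \<bullet> w) * f x) has_derivative (\<lambda>v. of_real ((x - a) \<bullet> w) * D x v + of_real (v \<bullet> w) * f x)) (at x)" for x
  proof -
    have "((\<lambda>x. (x - a) \<bullet> w) has_derivative (\<lambda>v. v \<bullet> w)) (at x)" by (auto intro!: derivative_eq_intros)
    from has_derivative_mult[OF has_derivative_of_real[OF this] D(1)[rule_format]] show ?thesis .
  qed
  moreover have "gauss_span c a (\<lambda>x. of_real ((x - a) \<bullet> w) * D x v + of_real (v \<bullet> w) * f x)" for v
    by (rule gauss_span.add[OF gauss_span.coord[OF D(2)[rule_format]] gauss_span.scale[OF coord.hyps]])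
  ultimately show ?case
    by (intro exI[of _ "\<lambda>x v. of_real ((x - a) \<bullet> w) * D x v + of_real (v \<bullet> w) * f x"]) blast
qed

text \<open>For positive \<open>k\<close> the inequality \<open>(1 + y / k) ^ k \<le> exp y\<close>
  with \<open>y = c * t^2\<close> bounds \<open>t ^ (2 * k) * exp (- c * t^2)\<close> by
  \<open>(k / c) ^ k\<close>; the given power then follows from
  \<open>t ^ k \<le> 1 + t ^ (2 * k)\<close>.\<close>

lemma power_times_exp_bounded:
  fixes c :: real
  assumes c: "0 < c"
  shows "\<exists>B. \<forall>t\<ge>0. t ^ k * exp (- c * t\<^sup>2) \<le> B"
proof (cases "k = 0")
  case False
  have "t ^ k * exp (- c * t\<^sup>2) \<le> 1 + (real k / c) ^ k" if t: "0 \<le> t" for t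
  proof -
    have "(c * t\<^sup>2 / real k) ^ k \<le> (1 + c * t\<^sup>2 / real k) ^ k"
      using c by (intro power_mono) auto
    also have "\<dots> \<le> exp (c * t\<^sup>2)"
    proof (rule exp_ge_one_plus_x_over_n_power_n)
      have "0 \<le> c * t\<^sup>2" using c by simp
      then show "- real k \<le> c * t\<^sup>2" by linarith
    qed (use False in simp)
    finally have "(c * t\<^sup>2 / real k) ^ k * exp (- c * t\<^sup>2) \<le> exp (c * t\<^sup>2) * exp (- c * t\<^sup>2)"
      by (rule mult_right_mono) simp
    then have "(c * t\<^sup>2 / real k) ^ k * exp (- c * t\<^sup>2) \<le> 1" by (simp flip: exp_add)
    then have "(real k / c) ^ k * ((c * t\<^sup>2 / real k) ^ k * exp (- c * t\<^sup>2)) \<le> (real k / c) ^ k * 1"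
      using c by (intro mult_left_mono) auto
    moreover have "(real k / c) ^ k * (c * t\<^sup>2 / real k) ^ k = (t\<^sup>2) ^ k"
      using c False by (simp flip: power_mult_distrib)
    ultimately have "(t\<^sup>2) ^ k * exp (- c * t\<^sup>2) \<le> (real k / c) ^ k" by (simp add: mult.assoc[symmetric])
    moreover have "t ^ k \<le> 1 + (t\<^sup>2) ^ k"
    proof (cases "t \<le> 1")
      case True
      then have "t ^ k \<le> 1" using t by (simp add: power_le_one)
      then show ?thesis by (simp add: add_increasing2)
    next
      case False
      then have "t ^ k \<le> (t\<^sup>2) ^ k" by (intro power_mono) (auto simp: power2_eq_square)
      then show ?thesis by simp
    qed
    then have "t ^ k * exp (- c * t\<^sup>2) \<le> (1 + (t\<^sup>2) ^ k) * exp (- c * t\<^sup>2)" by (rule mult_right_mono) simp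
    moreover have "exp (- c * t\<^sup>2) \<le> 1" using c by simp
    ultimately show ?thesis unfolding distrib_right mult_1_left by linarith
  qed
  then show ?thesis by blast
next
  case True
  show ?thesis using c by (intro exI[of _ 1]) (simp add: True)
qed

text \<open>The induction treats all exponents \<open>k\<close> at once, because a coordinate factor
  costs one more power of \<open>norm x\<close>.\<close>

lemma gauss_span_bounded:
  fixes a :: "'a::euclidean_space"
  assumes c: "0 < c"
  shows "gauss_span c a f \<Longrightarrow> \<exists>B. \<forall>x. norm x ^ k * norm (f x) \<le> B"
proof (induction arbitrary: k rule: gauss_span.induct)
  case base
  obtain B0 where B0: "\<And>t. 0 \<le> t \<Longrightarrow> t ^ 0 * exp (- c * t\<^sup>2) \<le> B0" using power_times_exp_bounded[OF c] by blast
  obtain B where B: "\<And>t. 0 \<le> t \<Longrightarrow> t ^ k * exp (- c * t\<^sup>2) \<le> B" using power_times_exp_bounded[OF c] by blast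
  have "norm x ^ k * norm (complex_of_real (exp (- c * ((x - a) \<bullet> (x - a))))) \<le> 2 ^ k * (B + norm a ^ k * B0)" for x
  proof -
    let ?t = "norm (x - a)"
    have "norm x \<le> ?t + norm a" using norm_triangle_ineq[of "x - a" a] by simp
    then have "norm x ^ k \<le> (2 * max ?t (norm a)) ^ k" by (intro power_mono) auto
    also have "\<dots> \<le> 2 ^ k * (?t ^ k + norm a ^ k)"
      by (auto simp: power_mult_distrib max_def)
    finally have "norm x ^ k * exp (- c * ?t\<^sup>2) \<le> 2 ^ k * (?t ^ k + norm a ^ k) * exp (- c * ?t\<^sup>2)"
      by (rule mult_right_mono) simp
    also have "\<dots> = 2 ^ k * (?t ^ k * exp (- c * ?t\<^sup>2) + norm a ^ k * (?t ^ 0 * exp (- c * ?t\<^sup>2)))"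
      by (simp add: algebra_simps)
    also have "\<dots> \<le> 2 ^ k * (B + norm a ^ k * B0)"
      by (intro mult_left_mono add_mono B B0) auto
    finally show ?thesis by (simp only: norm_of_real abs_exp_cancel dot_square_norm)
  qed
  then show ?case by blast
next
  case (add f g)
  obtain B C where "\<forall>x. norm x ^ k * norm (f x) \<le> B" "\<forall>x. norm x ^ k * norm (g x) \<le> C" using add.IH by meson
  moreover have "norm x ^ k * norm (f x + g x) \<le> norm x ^ k * norm (f x) + norm x ^ k * norm (g x)" for x
    unfolding distrib_left[symmetric] by (intro mult_left_mono norm_triangle_ineq) auto
  ultimately show ?case by (intro exI[of _ "B + C"]) (meson add_mono order_trans)
next
  case (scale f r)
  obtain B where "\<forall>x. norm x ^ k * norm (f x) \<le> B" using scale.IH by meson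
  then show ?case by (intro exI[of _ "\<bar>r\<bar> * B"]) (simp add: norm_mult mult.left_commute mult_left_mono)
next
  case (coord f v)
  obtain B where B: "\<forall>x. norm x ^ k * norm (f x) \<le> B" using coord.IH by meson
  obtain C where C: "\<forall>x. norm x ^ Suc k * norm (f x) \<le> C" using coord.IH by meson
  have "norm x ^ k * norm (of_real ((x - a) \<bullet> v) * f x) \<le> norm v * C + norm a * norm v * B" for x
  proof -
    have "\<bar>(x - a) \<bullet> v\<bar> \<le> norm (x - a) * norm v" by (rule Cauchy_Schwarz_ineq2)
    also have "\<dots> \<le> (norm x + norm a) * norm v" by (intro mult_right_mono norm_triangle_ineq4) auto
    finally have "norm x ^ k * (\<bar>(x - a) \<bullet> v\<bar> * norm (f x)) \<le> norm x ^ k * ((norm x + norm a) * norm v * norm (f x))"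
      by (intro mult_left_mono mult_right_mono) auto
    also have "\<dots> = norm v * (norm x ^ Suc k * norm (f x)) + norm a * norm v * (norm x ^ k * norm (f x))"
      by (simp add: algebra_simps)
    also have "\<dots> \<le> norm v * C + norm a * norm v * B" using B C by (intro add_mono mult_left_mono) auto
    finally show ?thesis by (simp add: norm_mult)
  qed
  then show ?case by blast
qed

lemma gauss_span_iter_deriv: "gauss_span c a f \<Longrightarrow> gauss_span c a (iter_deriv vs f)"
proof (induction vs)
  case (Cons v vs)
  then obtain D where D: "\<forall>x. (iter_deriv vs f has_derivative D x) (at x)" "\<forall>v. gauss_span c a (\<lambda>x. D x v)"
    using gauss_span_has_derivative by blast
  then have "frechet_derivative (iter_deriv vs f) (at x) = D x" for x
    by (metis frechet_derivative_at)
  then show ?case using D(2) by simp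
qed simp

lemma gauss_span_schwartz:
  assumes c: "0 < c" and f: "gauss_span c a f"
  shows "f \<in> schwartz"
proof -
  have "smooth_on UNIV f"
    unfolding smooth_on_def differentiable_def
    using gauss_span_has_derivative[OF gauss_span_iter_deriv[OF f]] by blast
  moreover have "bounded (range (\<lambda>x. norm x ^ k *\<^sub>R iter_deriv vs f x))" for k vs
    using gauss_span_bounded[OF c gauss_span_iter_deriv[OF f], of k vs] by (auto simp: bounded_iff)
  ultimately show ?thesis by (simp add: schwartz_def)
qed

lemma gauss_schwartz:
  fixes a :: "'a::euclidean_space"
  assumes "r \<noteq> 0"
  shows "(\<lambda>x. of_real (gauss (r *\<^sub>R (x - a)))) \<in> schwartz"
proof (rule gauss_span_schwartz)
  show "gauss_span (r\<^sup>2 / 2) a (\<lambda>x. of_real (gauss (r *\<^sub>R (x - a))))"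
    using gauss_span.base[of "r\<^sup>2 / 2" a] by (simp add: gauss_def power_mult_distrib dot_square_norm)
qed (use assms in simp)

text \<open>Testing the Fourier transform against Gaussians concentrated at a point turns the
  essential bound into a bound at every point.\<close>

lemma H_space_infinity_fourier_bound:
  fixes k k' :: "'a::euclidean_space \<Rightarrow> complex"
  assumes k': "integrable lborel k'" and k: "k \<in> borel_measurable lebesgue" and eq: "AE x in lebesgue. k x = k' x"
    and mem: "dist_of k \<in> H_space l \<infinity>" and l: "0 \<le> l"
  obtains C where "0 \<le> C" "\<And>\<xi>. norm (fourier k' \<xi>) \<le> C * bracket \<xi> powr (- l / 2)"
proof -
  have km [measurable]: "k' \<in> borel_measurable borel" using k' by auto
  have Fm [measurable]: "fourier k' \<in> borel_measurable borel" using fourier_measurable[OF km, of "\<lambda>x. x" borel] by simp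
  \<comment> \<open>The expected decay. It is continuous, and bounded by 1 because
    \<open>0 \<le> l\<close>, as the limit of its Gaussian averages requires.\<close>
  define W where "W \<xi> = bracket \<xi> powr (- l / 2)" for \<xi> :: 'a
  have W1: "0 < W \<xi>" "W \<xi> \<le> 1" for \<xi>
  proof -
    have "1 + (norm \<xi>)\<^sup>2 \<noteq> 0" by (smt (verit) zero_le_power2)
    then show "0 < W \<xi>" by (simp add: W_def)
    have "W \<xi> \<le> bracket \<xi> powr 0" unfolding W_def using l by (intro powr_mono) auto
    then show "W \<xi> \<le> 1" using \<open>1 + (norm \<xi>)\<^sup>2 \<noteq> 0\<close> by simp
  qed
  have Wcont: "continuous_on UNIV (\<lambda>\<xi>. complex_of_real (W \<xi>))"
    unfolding W_def by (intro continuous_intros) (smt (verit) zero_le_power2)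
  have Wm [measurable]: "W \<in> borel_measurable borel" unfolding W_def by measurable
  have Wcm: "(\<lambda>\<xi>. complex_of_real (W \<xi>)) \<in> borel_measurable borel" by measurable
  obtain h where h: "h \<in> borel_measurable lebesgue"
    "\<And>f. f \<in> schwartz \<Longrightarrow> integrable lebesgue (\<lambda>\<xi>. h \<xi> * f \<xi>) \<and> dist_fourier (dist_of k) f = dist_of h f"
    "Lp_norm \<infinity> lebesgue (\<lambda>\<xi>. of_real (bracket \<xi> powr (l / 2)) * h \<xi>) < \<infinity>"
    using mem unfolding H_space_def by blast
  define e where "e = esssup lebesgue (\<lambda>\<xi>. ennreal (norm (of_real (bracket \<xi> powr (l / 2)) * h \<xi>)))"
  define C where "C = enn2real e"
  have e: "e = ennreal C" using h(3) unfolding C_def e_def Lp_norm_def by (simp add: less_top)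
  have C0: "0 \<le> C" by (simp add: C_def)
  have "AE \<xi> in lebesgue. ennreal (norm (of_real (bracket \<xi> powr (l / 2)) * h \<xi>)) \<le> e"
    unfolding e_def by (rule esssup_AE)
  then have hC: "AE \<xi> in lebesgue. norm (h \<xi>) \<le> C * W \<xi>"
  proof eventually_elim
    case (elim \<xi>)
    have p: "0 < 1 + (norm \<xi>)\<^sup>2" by (smt (verit) zero_le_power2)
    from elim have "bracket \<xi> powr (l / 2) * norm (h \<xi>) \<le> C"
      unfolding e using C0 by (simp add: norm_mult)
    then have "W \<xi> * (bracket \<xi> powr (l / 2) * norm (h \<xi>)) \<le> W \<xi> * C"
      using W1 by (intro mult_left_mono) (auto simp: less_imp_le)
    moreover have "W \<xi> * bracket \<xi> powr (l / 2) = 1"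
      using p by (simp add: W_def powr_add[symmetric])
    ultimately have "1 * norm (h \<xi>) \<le> W \<xi> * C" by (simp only: mult.assoc[symmetric])
    then show ?case by (simp only: mult_1_left mult.commute)
  qed
  have "norm (fourier k' a) \<le> C * W a" for a
  proof -
    let ?r = "\<lambda>n. 1 / real (Suc n)"
    let ?g = "\<lambda>n \<xi>. gauss (real (Suc n) *\<^sub>R (\<xi> - a))"
    \<comment> \<open>Rescaling to a fixed Gaussian. The same power of \<open>?r n\<close> arises
      for both functions compared below and cancels.\<close>
    have resc: "(LINT \<xi>|lborel. G \<xi> * ?g n \<xi>) = (?r n) ^ DIM('a) *\<^sub>R (LINT z|lborel. G (a - ?r n *\<^sub>R z) * gauss z)"
      if [measurable]: "G \<in> borel_measurable borel" for G :: "'a \<Rightarrow> complex" and n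
    proof -
      have "(LINT \<xi>|lborel. G \<xi> * ?g n \<xi>) = \<bar>- ?r n\<bar> ^ DIM('a) *\<^sub>R (LINT z|lborel. G (a + (- ?r n) *\<^sub>R z) * ?g n (a + (- ?r n) *\<^sub>R z))"
        by (rule lborel_integral_affine, measurable)
      then show ?thesis by (simp del: of_nat_Suc)
    qed
    have gi: "integrable lborel (?g n)" for n
      using integrable_lborel_affine[OF gauss_integrable, of "real (Suc n)" "- real (Suc n) *\<^sub>R a"]
      by (simp add: scaleR_diff_right algebra_simps)
    \<comment> \<open>At each scale the average of the transform is a pairing with \<open>h\<close>,
      and \<open>h\<close> is bounded by \<open>C * W\<close> almost everywhere.\<close>
    have step: "norm (LINT z|lborel. fourier k' (a - ?r n *\<^sub>R z) * gauss z) \<le> C * norm (LINT z|lborel. of_real (W (a - ?r n *\<^sub>R z)) * complex_of_real (gauss z))" for n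
    proof -
      let ?f = "\<lambda>\<xi>. complex_of_real (?g n \<xi>)"
      have f: "?f \<in> schwartz" by (rule gauss_schwartz) simp
      note fm [measurable] = schwartz_borel_measurable[OF f]
      have Ff [measurable]: "fourier ?f \<in> borel_measurable borel" using fourier_measurable[OF fm, of "\<lambda>x. x" borel] by simp
      have "(LINT \<xi>|lborel. fourier k' \<xi> * ?f \<xi>) = (LINT x|lborel. k' x * fourier ?f x)"
        by (rule fourier_multiplication[OF k' schwartz_integrable[OF f]])
      also have "\<dots> = (LINT x|lebesgue. k' x * fourier ?f x)"
        by (rule integral_completion[symmetric]) measurable
      \<comment> \<open>The distribution is given by \<open>k\<close>, the transform is computed
        from its Borel representative \<open>k'\<close>.\<close>
      also have "\<dots> = (LINT x|lebesgue. k x * fourier ?f x)"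
      proof (rule integral_cong_AE)
        have kl: "k' \<in> borel_measurable lebesgue" by (rule measurable_completion) simp
        have fl: "fourier ?f \<in> borel_measurable lebesgue" by (rule measurable_completion) simp
        show "(\<lambda>x. k' x * fourier ?f x) \<in> borel_measurable lebesgue" using kl fl by (rule borel_measurable_times)
        show "(\<lambda>x. k x * fourier ?f x) \<in> borel_measurable lebesgue" using k fl by (rule borel_measurable_times)
        show "AE x in lebesgue. k' x * fourier ?f x = k x * fourier ?f x" using eq by eventually_elim simp
      qed
      also have "\<dots> = (LINT \<xi>|lebesgue. h \<xi> * ?f \<xi>)"
        using h(2)[OF f] by (simp add: dist_fourier_def dist_of_def)
      finally have "ennreal (norm (LINT \<xi>|lborel. fourier k' \<xi> * ?f \<xi>)) \<le> (\<integral>\<^sup>+\<xi>. norm (h \<xi> * ?f \<xi>) \<partial>lebesgue)"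
        using norm_integral_le_nn_integral[of lebesgue "\<lambda>\<xi>. h \<xi> * ?f \<xi>"] by simp
      also have "\<dots> \<le> (\<integral>\<^sup>+\<xi>. ennreal (C * (W \<xi> * ?g n \<xi>)) \<partial>lebesgue)"
        using hC by (intro nn_integral_mono_AE) (auto elim!: eventually_mono simp: norm_mult mult.assoc[symmetric] intro!: ennreal_leI mult_right_mono)
      also have "\<dots> = (\<integral>\<^sup>+\<xi>. ennreal (C * (W \<xi> * ?g n \<xi>)) \<partial>lborel)" by (rule nn_integral_completion)
      also have "\<dots> = ennreal (LINT \<xi>|lborel. C * (W \<xi> * ?g n \<xi>))"
      proof (rule nn_integral_eq_integral)
        show "integrable lborel (\<lambda>\<xi>. C * (W \<xi> * ?g n \<xi>))"
          by (intro integrable_mult_right, rule Bochner_Integration.integrable_bound[OF gi[of n]])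
             (use W1 in \<open>auto simp: abs_mult less_imp_le intro!: mult_left_le_one_le\<close>)
      qed (use W1 C0 in \<open>auto simp: less_imp_le\<close>)
      finally have "norm (LINT \<xi>|lborel. fourier k' \<xi> * ?f \<xi>) \<le> C * (LINT \<xi>|lborel. W \<xi> * ?g n \<xi>)"
        using C0 W1 by (simp add: less_imp_le)
      also have "(LINT \<xi>|lborel. W \<xi> * ?g n \<xi>) \<le> norm (complex_of_real (LINT \<xi>|lborel. W \<xi> * ?g n \<xi>))"
        by (simp only: norm_of_real abs_ge_self)
      also have "complex_of_real (LINT \<xi>|lborel. W \<xi> * ?g n \<xi>) = (LINT \<xi>|lborel. of_real (W \<xi>) * ?f \<xi>)"
        unfolding integral_complex_of_real[symmetric] by simp
      finally have "norm (LINT \<xi>|lborel. fourier k' \<xi> * ?f \<xi>) \<le> C * norm (LINT \<xi>|lborel. of_real (W \<xi>) * ?f \<xi>)"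
        using C0 by (simp add: mult_left_mono)
      then have "(?r n) ^ DIM('a) * norm (LINT z|lborel. fourier k' (a - ?r n *\<^sub>R z) * gauss z) \<le>
          (?r n) ^ DIM('a) * (C * norm (LINT z|lborel. of_real (W (a - ?r n *\<^sub>R z)) * complex_of_real (gauss z)))"
        unfolding resc[OF Fm] resc[OF Wcm]
        by (simp add: mult.left_commute abs_mult power_divide del: of_nat_Suc)
      then show ?thesis by (rule mult_left_le_imp_le) simp
    qed
    have Fc: "continuous_on UNIV (fourier k')"
      using tendsto_fourier[OF k'] by (intro continuous_at_imp_continuous_on ballI) (auto simp: continuous_at_sequentially comp_def)
    let ?c = "sqrt (2 * pi) ^ DIM('a)"
    \<comment> \<open>Continuity of both functions turns averages into values at
      \<open>a\<close>.\<close>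
    have "norm (of_real ?c * fourier k' a) \<le> C * norm (of_real ?c * complex_of_real (W a))"
    proof (rule LIMSEQ_le)
      show "(\<lambda>n. norm (LINT z|lborel. fourier k' (a - ?r n *\<^sub>R z) * gauss z)) \<longlonglongrightarrow> norm (of_real ?c * fourier k' a)"
        by (intro tendsto_norm gauss_average_tendsto[OF Fc norm_fourier_le[OF k']])
      show "(\<lambda>n. C * norm (LINT z|lborel. of_real (W (a - ?r n *\<^sub>R z)) * complex_of_real (gauss z))) \<longlonglongrightarrow> C * norm (of_real ?c * complex_of_real (W a))"
        using W1 by (intro tendsto_intros gauss_average_tendsto[OF Wcont, of 1]) (auto simp: less_imp_le)
    qed (use step in auto)
    then have "?c * norm (fourier k' a) \<le> ?c * (C * W a)"
      unfolding norm_mult norm_of_real using W1(1)[of a] by (simp add: mult.left_commute)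
    then show ?thesis by (rule mult_left_le_imp_le) simp
  qed
  then show thesis using C0 by (intro that[of C]) (auto simp: W_def)
qed

section \<open>Fourier transforms of test functions\<close>

lemma test_function_derivative:
  assumes f: "test_function f" and b: "b \<in> Basis"
  shows "test_function (\<lambda>x. frechet_derivative f (at x) b)"
proof -
  have sm: "smooth_on UNIV f" and cpt: "compact (closure {x. f x \<noteq> 0})"
    using f by (auto simp: test_function_def)
  \<comment> \<open>The innermost derivative is the last entry of the list, so partials of a partial
    are iterated partials of \<open>f\<close>.\<close>
  have app: "iter_deriv vs (iter_deriv [b] f) = iter_deriv (vs @ [b]) f" for vs
    by (induction vs) auto
  have "smooth_on UNIV (iter_deriv [b] f)"
    unfolding smooth_on_def app using sm b by (auto simp: smooth_on_def)
  moreover have "{x. frechet_derivative f (at x) b \<noteq> 0} \<subseteq> closure {x. f x \<noteq> 0}"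
  proof (rule subsetI, rule ccontr)
    fix x assume x: "x \<in> {x. frechet_derivative f (at x) b \<noteq> 0}" "x \<notin> closure {x. f x \<noteq> 0}"
    have "(f has_derivative (\<lambda>_. 0)) (at x)"
      by (rule has_derivative_transform_within_open[of "\<lambda>_. 0" _ x UNIV "- closure {x. f x \<noteq> 0}"])
         (use x closure_subset[of "{x. f x \<noteq> 0}"] in auto)
    then have "frechet_derivative f (at x) = (\<lambda>_. 0)" by (metis frechet_derivative_at)
    with x show False by simp
  qed
  then have "closure {x. frechet_derivative f (at x) b \<noteq> 0} \<subseteq> closure {x. f x \<noteq> 0}"
    by (simp add: closure_minimal)
  then have "compact (closure {x. frechet_derivative f (at x) b \<noteq> 0})"
    using compact_Int_closed[OF cpt closed_closure] by (metis inf.absorb2)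
  ultimately show ?thesis by (simp add: test_function_def)
qed

lemma test_function_support:
  fixes f :: "'a::euclidean_space \<Rightarrow> 'b::real_normed_vector"
  assumes "test_function f"
  obtains R where "0 < R" "\<And>x. R < norm x \<Longrightarrow> f x = 0"
proof -
  have "bounded (closure {x. f x \<noteq> 0})" using assms compact_imp_bounded by (auto simp: test_function_def)
  then obtain R where R: "0 < R" "\<And>x. x \<in> closure {x. f x \<noteq> 0} \<Longrightarrow> norm x \<le> R" by (auto simp: bounded_pos)
  show thesis
  proof (rule that[OF R(1)])
    fix x :: 'a assume "R < norm x"
    then show "f x = 0" using R(2)[of x] closure_subset[of "{x. f x \<noteq> 0}"] by force
  qed
qed

lemma test_function_borel_measurable: "test_function f \<Longrightarrow> f \<in> borel_measurable borel"
  by (auto simp: test_function_def intro: smooth_on_borel_measurable)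

lemma test_function_bounded:
  fixes f :: "'a::euclidean_space \<Rightarrow> 'b::real_normed_vector"
  assumes f: "test_function f"
  obtains B where "0 < B" "\<And>x. norm (f x) \<le> B"
proof -
  obtain R where R: "0 < R" "\<And>x. R < norm x \<Longrightarrow> f x = 0" using test_function_support[OF f] by blast
  have "continuous_on (cball 0 R) f"
    using f smooth_on_continuous continuous_on_subset by (fastforce simp: test_function_def)
  then have "bounded (f ` cball 0 R)" by (intro compact_imp_bounded compact_continuous_image) auto
  then obtain B where B: "0 < B" "\<And>x. x \<in> cball 0 R \<Longrightarrow> norm (f x) \<le> B" by (auto simp: bounded_pos)
  have "norm (f x) \<le> B" for x using B R by (cases "norm x \<le> R") auto
  then show thesis using B(1) that by blast
qed

lemma integrable_indicator_cball: "integrable lborel (\<lambda>x::'a::euclidean_space. c * indicator (cball z r) x :: real)"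
  using emeasure_lborel_cball_finite[of z r] by (intro integrable_mult_right integrable_real_indicator) auto

lemma integrable_bounded_support:
  fixes f :: "'a::euclidean_space \<Rightarrow> 'b::{banach, second_countable_topology}"
  assumes "f \<in> borel_measurable borel" "\<And>x. norm (f x) \<le> B" "\<And>x. R < norm x \<Longrightarrow> f x = 0"
  shows "integrable lborel f"
proof (rule Bochner_Integration.integrable_bound[OF integrable_indicator_cball[of B 0 R]])
  show "AE x in lborel. norm (f x) \<le> norm (B * indicator (cball 0 R) x)"
    using assms(2,3) by (intro AE_I2) (force simp: indicator_def split: if_splits intro: order_trans[OF _ abs_ge_self])
qed (use assms in simp)

lemma test_function_integrable:
  fixes f :: "'a::euclidean_space \<Rightarrow> 'b::{banach, second_countable_topology}"
  assumes f: "test_function f"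
  shows "integrable lborel f"
  using test_function_bounded[OF f] test_function_support[OF f] test_function_borel_measurable[OF f]
  by (metis integrable_bounded_support)

text \<open>Stated along a sequence of steps, the form in which dominated convergence uses it in
  \<open>fourier_derivative\<close>.\<close>

lemma has_derivative_difference_quotient:
  fixes f :: "'a::real_normed_vector \<Rightarrow> complex"
  assumes D: "(f has_derivative D) (at x)" and v: "v \<noteq> 0"
  shows "(\<lambda>n. (f (x + (1 / real (Suc n)) *\<^sub>R v) - f x) / of_real (1 / real (Suc n))) \<longlonglongrightarrow> D v"
proof -
  let ?t = "\<lambda>n. 1 / real (Suc n)"
  have t: "0 < ?t n" for n by simp
  have lin: "D (c *\<^sub>R w) = of_real c * D w" for c w
    using linear_scale[OF has_derivative_linear[OF D], of c w] by (simp add: scaleR_conv_of_real)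
  have lim0: "(\<lambda>n. ?t n *\<^sub>R v) \<longlonglongrightarrow> 0"
    using tendsto_scaleR[OF LIMSEQ_inverse_Suc tendsto_const[of v]] by simp
  have "filterlim (\<lambda>n. ?t n *\<^sub>R v) (at 0) sequentially"
    unfolding filterlim_at using v lim0 by (simp del: of_nat_Suc)
  then have "(\<lambda>n. norm (f (x + ?t n *\<^sub>R v) - f x - D (?t n *\<^sub>R v)) / norm (?t n *\<^sub>R v)) \<longlonglongrightarrow> 0"
    by (rule filterlim_compose[OF conjunct2[OF D[unfolded has_derivative_at]]])
  then have lim: "(\<lambda>n. norm v * (norm (f (x + ?t n *\<^sub>R v) - f x - D (?t n *\<^sub>R v)) / norm (?t n *\<^sub>R v))) \<longlonglongrightarrow> norm v * 0"
    by (intro tendsto_mult tendsto_const)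
  have "norm v * (norm (f (x + ?t n *\<^sub>R v) - f x - D (?t n *\<^sub>R v)) / norm (?t n *\<^sub>R v)) =
      norm ((f (x + ?t n *\<^sub>R v) - f x) / of_real (?t n) - D v)" for n
  proof -
    have *: "A / of_real \<tau> - D v = (A - D (\<tau> *\<^sub>R v)) / of_real \<tau>"
      "norm v * (norm A / norm (\<tau> *\<^sub>R v)) = norm (A / of_real \<tau>)" if "0 < \<tau>" for \<tau> :: real and A :: complex
      using that v by (simp_all add: lin diff_divide_distrib norm_divide)
    show ?thesis by (simp only: *[OF t])
  qed
  with lim show ?thesis by (simp add: tendsto_norm_zero_iff LIM_zero_iff)
qed

lemma cis_difference_quotient:
  "(\<lambda>n. (cis (1 / real (Suc n) * u) - 1) / of_real (1 / real (Suc n))) \<longlonglongrightarrow> \<i> * of_real u"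
proof -
  have "((\<lambda>t. \<i> * complex_of_real (t * u)) has_derivative (\<lambda>h. \<i> * of_real (h * u))) (at 0)"
    by (intro has_derivative_mult_right has_derivative_of_real has_derivative_mult_left has_derivative_ident)
  from has_derivative_compose[OF this DERIV_exp[unfolded has_field_derivative_def]]
  have "((\<lambda>t. exp (\<i> * of_real (t * u))) has_derivative (\<lambda>h. exp (\<i> * of_real (0 * u)) * (\<i> * of_real (h * u)))) (at 0)" .
  from has_derivative_difference_quotient[OF this, of 1] show ?thesis
    by (simp add: cis_conv_exp)
qed

text \<open>Instead of integration by parts, both sides are limits of the transforms of difference
  quotients: one by dominated convergence with a Lipschitz constant on a ball as bound, the other by
  \<open>fourier_difference\<close>.\<close>

lemma fourier_derivative:
  fixes f :: "'a::euclidean_space \<Rightarrow> complex"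
  assumes f: "test_function f" and b: "b \<in> Basis"
  shows "fourier (\<lambda>x. frechet_derivative f (at x) b) \<xi> = \<i> * of_real (b \<bullet> \<xi>) * fourier f \<xi>"
proof -
  have sm: "smooth_on UNIV f" using f by (simp add: test_function_def)
  have fm [measurable]: "f \<in> borel_measurable borel" by (rule test_function_borel_measurable[OF f])
  have dm [measurable]: "(\<lambda>x. frechet_derivative f (at x) b) \<in> borel_measurable borel"
    by (rule test_function_borel_measurable[OF test_function_derivative[OF f b]])
  have fi: "integrable lborel f" by (rule test_function_integrable[OF f])
  let ?t = "\<lambda>n. 1 / real (Suc n)"
  have t: "0 < ?t n" "?t n \<le> 1" for n by auto
  obtain R where R: "0 < R" "\<And>x. R < norm x \<Longrightarrow> f x = 0" using test_function_support[OF f] by blast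
  \<comment> \<open>With steps at most 1 the quotients vanish outside radius \<open>R + 1\<close>,
    and the shifted arguments stay within \<open>R + 2\<close>.\<close>
  obtain L where L: "0 \<le> L" "\<And>x y. x \<in> cball 0 (R + 2) \<Longrightarrow> y \<in> cball 0 (R + 2) \<Longrightarrow> norm (f x - f y) \<le> L * norm (x - y)"
    using smooth_on_Lipschitz[OF sm compact_cball convex_cball] by blast
  let ?q = "\<lambda>n x. (f (x + ?t n *\<^sub>R b) - f x) / of_real (?t n)"
  have nb: "norm (?t n *\<^sub>R b) = ?t n" for n using b by simp
  have q_bound: "norm (?q n x) \<le> L * indicator (cball 0 (R + 1)) x" for n x
  proof (cases "norm x \<le> R + 1")
    case True
    have "norm (x + ?t n *\<^sub>R b) \<le> R + 2"
      using norm_triangle_ineq[of x "?t n *\<^sub>R b"] True nb[of n] t[of n] by linarith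
    then have "norm (f (x + ?t n *\<^sub>R b) - f x) \<le> L * ?t n"
      using L(2)[of "x + ?t n *\<^sub>R b" x] True nb[of n] by simp
    then have "norm (?q n x) \<le> L"
      unfolding norm_divide norm_of_real abs_of_pos[OF t(1)] pos_divide_le_eq[OF t(1)] .
    then show ?thesis using True by simp
  next
    case False
    have "norm x \<le> norm (x + ?t n *\<^sub>R b) + norm (?t n *\<^sub>R b)"
      using norm_triangle_ineq4[of "x + ?t n *\<^sub>R b" "?t n *\<^sub>R b"] by simp
    then have "R < norm (x + ?t n *\<^sub>R b)" using False nb[of n] t[of n] by linarith
    then show ?thesis using False R by simp
  qed
  have q_lim: "(\<lambda>n. ?q n x) \<longlonglongrightarrow> frechet_derivative f (at x) b" for x
    using smooth_on_has_derivative[OF sm] b by (intro has_derivative_difference_quotient) auto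
  have "(\<lambda>n. LINT x|lborel. cis (- (x \<bullet> \<xi>)) * ?q n x) \<longlonglongrightarrow> (LINT x|lborel. cis (- (x \<bullet> \<xi>)) * frechet_derivative f (at x) b)"
  proof (rule integral_dominated_convergence[where w="\<lambda>x. L * indicator (cball 0 (R + 1)) x"])
    show "AE x in lborel. (\<lambda>n. cis (- (x \<bullet> \<xi>)) * ?q n x) \<longlonglongrightarrow> cis (- (x \<bullet> \<xi>)) * frechet_derivative f (at x) b"
      by (intro AE_I2 tendsto_mult tendsto_const q_lim)
    show "AE x in lborel. norm (cis (- (x \<bullet> \<xi>)) * ?q n x) \<le> L * indicator (cball 0 (R + 1)) x" for n
      using q_bound by (intro AE_I2) (simp only: norm_mult norm_cis mult_1_left)
  qed (use integrable_indicator_cball in auto)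
  then have lim1: "(\<lambda>n. fourier (?q n) \<xi>) \<longlonglongrightarrow> fourier (\<lambda>x. frechet_derivative f (at x) b) \<xi>"
    by (simp only: fourier_lborel[OF dm]) (subst fourier_lborel, auto)
  have "fourier (?q n) \<xi> = (cis (?t n * (b \<bullet> \<xi>)) - 1) / of_real (?t n) * fourier f \<xi>" for n
  proof -
    have "fourier (?q n) \<xi> = (LINT x|lborel. cis (- (x \<bullet> \<xi>)) * ?q n x)"
      by (rule fourier_lborel) measurable
    also have "\<dots> = (LINT x|lborel. cis (- (x \<bullet> \<xi>)) * (f (x + ?t n *\<^sub>R b) - f x)) / of_real (?t n)"
      by (simp only: times_divide_eq_right integral_divide_zero)
    also have "(LINT x|lborel. cis (- (x \<bullet> \<xi>)) * (f (x + ?t n *\<^sub>R b) - f x)) = fourier (\<lambda>x. f (x + ?t n *\<^sub>R b) - f x) \<xi>"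
      by (rule fourier_lborel[symmetric]) measurable
    also have "fourier (\<lambda>x. f (x + ?t n *\<^sub>R b) - f x) \<xi> / of_real (?t n) = (cis (?t n * (b \<bullet> \<xi>)) - 1) / of_real (?t n) * fourier f \<xi>"
      by (simp only: fourier_difference[OF fi] inner_scaleR_left times_divide_eq_left)
    finally show ?thesis .
  qed
  then have "(\<lambda>n. fourier (?q n) \<xi>) \<longlonglongrightarrow> \<i> * of_real (b \<bullet> \<xi>) * fourier f \<xi>"
    using tendsto_mult[OF cis_difference_quotient[of "b \<bullet> \<xi>"] tendsto_const[of "fourier f \<xi>"]] by simp
  with lim1 show ?thesis by (rule LIMSEQ_unique)
qed

lemma fourier_coordinate_decay:
  fixes f :: "'a::euclidean_space \<Rightarrow> complex"
  assumes b: "b \<in> Basis"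
  shows "test_function f \<Longrightarrow> \<exists>C. \<forall>\<xi>. \<bar>b \<bullet> \<xi>\<bar> ^ m * norm (fourier f \<xi>) \<le> C"
proof (induction m arbitrary: f)
  case 0
  then show ?case using norm_fourier_le[OF test_function_integrable[OF 0]] by auto
next
  case (Suc m)
  obtain C where C: "\<And>\<xi>. \<bar>b \<bullet> \<xi>\<bar> ^ m * norm (fourier (\<lambda>x. frechet_derivative f (at x) b) \<xi>) \<le> C"
    using Suc.IH[OF test_function_derivative[OF Suc.prems b]] by blast
  then show ?case
    unfolding fourier_derivative[OF Suc.prems b] by (intro exI[of _ C]) (simp add: norm_mult mult.assoc mult.left_commute)
qed

text \<open>The largest coordinate of \<open>\<xi>\<close> controls the bracket, and the transform
  decays to every order in each coordinate; finitely many coordinates allow a common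
  constant.\<close>

lemma test_function_weighted_fourier_less_top:
  fixes f :: "'a::euclidean_space \<Rightarrow> complex"
  assumes f: "test_function f"
  shows "wnorm2 s (fourier f) < \<infinity>"
proof -
  \<comment> \<open>Decay \<open>bracket powr (- m)\<close> of the transform leaves the exponent
    \<open>s - 2 * m \<le> - m\<close> after squaring, and \<open>bracket powr (- m)\<close> is
    integrable.\<close>
  obtain m :: nat where m: "\<bar>s\<bar> + real DIM('a) \<le> real m" using real_arch_simple by blast
  have "\<forall>b\<in>Basis. \<exists>C. \<forall>\<xi>. \<bar>b \<bullet> \<xi>\<bar> ^ (2 * m) * norm (fourier f \<xi>) \<le> C"
    using fourier_coordinate_decay f by blast
  then obtain C where C: "\<And>b \<xi>. b \<in> Basis \<Longrightarrow> \<bar>b \<bullet> \<xi>\<bar> ^ (2 * m) * norm (fourier f \<xi>) \<le> C b" by metis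
  define C0 where "C0 = (LINT x|lborel. norm (f x))"
  have C0: "norm (fourier f \<xi>) \<le> C0" for \<xi> unfolding C0_def by (rule norm_fourier_le[OF test_function_integrable[OF f]])
  have Cb: "0 \<le> C b" if "b \<in> Basis" for b by (rule order_trans[OF _ C[OF that, of 0]]) simp
  define K where "K = (1 + real DIM('a)) ^ m * (C0 + (\<Sum>b\<in>Basis. C b))"
  have K: "bracket \<xi> ^ m * norm (fourier f \<xi>) \<le> K" for \<xi>
  proof -
    obtain b where b: "b \<in> Basis" "(norm \<xi>)\<^sup>2 \<le> real DIM('a) * (b \<bullet> \<xi>)\<^sup>2"
      using norm_le_max_coordinate[of \<xi>] by (metis inner_commute)
    have "1 + (norm \<xi>)\<^sup>2 \<le> (1 + real DIM('a)) * max 1 ((b \<bullet> \<xi>)\<^sup>2)"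
    proof -
      have "real DIM('a) * (b \<bullet> \<xi>)\<^sup>2 \<le> real DIM('a) * max 1 ((b \<bullet> \<xi>)\<^sup>2)" by (intro mult_left_mono) auto
      then show ?thesis using b(2) unfolding distrib_right by linarith
    qed
    then have "bracket \<xi> ^ m \<le> ((1 + real DIM('a)) * max 1 ((b \<bullet> \<xi>)\<^sup>2)) ^ m" by (intro power_mono) auto
    also have "\<dots> \<le> (1 + real DIM('a)) ^ m * (1 + \<bar>b \<bullet> \<xi>\<bar> ^ (2 * m))"
      unfolding power_mult_distrib power_mult power2_abs by (intro mult_left_mono) (auto simp: max_def)
    finally have "bracket \<xi> ^ m * norm (fourier f \<xi>) \<le> (1 + real DIM('a)) ^ m * (1 + \<bar>b \<bullet> \<xi>\<bar> ^ (2 * m)) * norm (fourier f \<xi>)"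
      by (rule mult_right_mono) simp
    also have "\<dots> = (1 + real DIM('a)) ^ m * (norm (fourier f \<xi>) + \<bar>b \<bullet> \<xi>\<bar> ^ (2 * m) * norm (fourier f \<xi>))"
      by (simp add: algebra_simps)
    also have "\<dots> \<le> K" unfolding K_def
      using member_le_sum[OF b(1), of C] Cb by (intro mult_left_mono add_mono C0 order_trans[OF C[OF b(1)]]) auto
    finally show ?thesis .
  qed
  have K0: "0 \<le> K" by (rule order_trans[OF _ K[of 0]]) simp
  have "bracket \<xi> powr s * (norm (fourier f \<xi>))\<^sup>2 \<le> K\<^sup>2 * bracket \<xi> powr (- real m)" for \<xi>
  proof -
    let ?w = "bracket \<xi>"
    have w: "0 < ?w" by (smt (verit) zero_le_power2)
    have "norm (fourier f \<xi>) \<le> K * ?w powr (- real m)"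
      using K[of \<xi>] w by (simp add: powr_minus powr_realpow field_simps)
    then have "(norm (fourier f \<xi>))\<^sup>2 \<le> (K * ?w powr (- real m))\<^sup>2" by (intro power_mono) auto
    moreover have "(K * ?w powr (- real m))\<^sup>2 = K\<^sup>2 * ?w powr (- 2 * real m)"
      by (simp add: power_mult_distrib power2_eq_square[of "_ powr _"] flip: powr_add)
    ultimately have "?w powr s * (norm (fourier f \<xi>))\<^sup>2 \<le> ?w powr s * (K\<^sup>2 * ?w powr (- 2 * real m))"
      by (intro mult_left_mono) auto
    also have "\<dots> = K\<^sup>2 * ?w powr (s - 2 * real m)" by (simp add: powr_add[symmetric] mult.left_commute)
    also have "\<dots> \<le> K\<^sup>2 * ?w powr (- real m)" using m by (intro mult_left_mono powr_mono) auto
    finally show ?thesis .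
  qed
  then have "wnorm2 s (fourier f) \<le>
     (\<integral>\<^sup>+\<xi>. ennreal (K\<^sup>2) * ennreal (bracket (\<xi>::'a) powr (- real m)) \<partial>lborel)"
    unfolding wnorm2_def by (intro nn_integral_mono) (simp add: ennreal_leI flip: ennreal_mult)
  also have "\<dots> = ennreal (K\<^sup>2) * (\<integral>\<^sup>+\<xi>. ennreal (bracket (\<xi>::'a) powr (- real m)) \<partial>lborel)"
    by (rule nn_integral_cmult) measurable
  also have "\<dots> < \<infinity>"
  proof -
    have "0 < real DIM('a)" by simp
    then have "real DIM('a) < 2 * real m" using m by linarith
    then show ?thesis using nn_integral_bracket_less_top[where 'a='a, of "real m"] by (simp add: ennreal_mult_less_top)
  qed
  finally show ?thesis .
qed

section \<open>The Fourier side of multiplication\<close>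

text \<open>The bracket at \<open>\<xi>\<close> is at most 4 times the larger of the other two. The
  additive form, not the product form, is what lets the convolution estimate cancel one bracket per
  term.\<close>

lemma bracket_peetre:
  assumes s: "0 \<le> s"
  shows "bracket \<xi> powr s \<le> 4 powr s * (bracket (\<xi> - \<zeta>) powr s + bracket \<zeta> powr s)"
proof -
  let ?a = "1 + (norm (\<xi> - \<zeta>))\<^sup>2" and ?b = "bracket \<zeta>"
  have "norm \<xi> \<le> norm (\<xi> - \<zeta>) + norm \<zeta>" using norm_triangle_ineq[of "\<xi> - \<zeta>" \<zeta>] by simp
  then have "(norm \<xi>)\<^sup>2 \<le> (norm (\<xi> - \<zeta>) + norm \<zeta>)\<^sup>2" by (intro power_mono) auto
  also have "\<dots> \<le> 2 * (norm (\<xi> - \<zeta>))\<^sup>2 + 2 * (norm \<zeta>)\<^sup>2"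
    using sum_squares_bound[of "norm (\<xi> - \<zeta>)" "norm \<zeta>"] by (simp add: power2_sum)
  finally have "(norm \<xi>)\<^sup>2 \<le> 2 * (norm (\<xi> - \<zeta>))\<^sup>2 + 2 * (norm \<zeta>)\<^sup>2" .
  moreover define m where "m = max ?a ?b"
  moreover have "?a \<le> m" "?b \<le> m" by (simp_all add: m_def)
  ultimately have "1 + (norm \<xi>)\<^sup>2 \<le> 4 * m" by linarith
  then have "1 + (norm \<xi>)\<^sup>2 \<le> 4 * max ?a ?b" by (simp only: m_def)
  then have "bracket \<xi> powr s \<le> (4 * max ?a ?b) powr s" using s by (intro powr_mono2) auto
  also have "\<dots> = 4 powr s * max ?a ?b powr s" by (rule powr_mult)
  also have "\<dots> \<le> 4 powr s * (?a powr s + ?b powr s)" by (intro mult_left_mono) (auto simp: max_def)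
  finally show ?thesis .
qed

text \<open>Cauchy--Schwarz against \<open>(w(\<xi> - \<zeta>) w(\<zeta>))\<^sup>-\<^sup>s\<^sup>/\<^sup>2\<close>, \<open>w\<close> the bracket: by the Peetre type inequality
  the square integral of this weight in \<open>\<zeta>\<close> is \<open>O(w(\<xi>)\<^sup>-\<^sup>s)\<close>.\<close>

lemma convolution_wnorm2:
  fixes p q :: "'a::euclidean_space \<Rightarrow> complex"
  assumes s: "0 \<le> s"
    and [measurable]: "p \<in> borel_measurable borel" "q \<in> borel_measurable borel"
  shows "wnorm2 s (\<lambda>\<xi>. LINT \<zeta>|lborel. q (\<xi> - \<zeta>) * p \<zeta>) \<le>
    ennreal (2 * 4 powr s) * (\<integral>\<^sup>+\<zeta>. ennreal (bracket (\<zeta>::'a) powr (- s)) \<partial>lborel) * wnorm2 s p * wnorm2 s q"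
proof -
  let ?w = "\<lambda>\<xi>::'a. 1 + (norm \<xi>)\<^sup>2"
  let ?I = "\<integral>\<^sup>+\<zeta>. ennreal (?w \<zeta> powr (- s)) \<partial>lborel"
  let ?K = "ennreal (2 * 4 powr s) * ?I"
  have w: "0 < ?w \<xi>" for \<xi> by (rule bracket_pos)
  let ?A = "\<lambda>\<xi> \<zeta>. (?w (\<xi> - \<zeta>) * ?w \<zeta>) powr (- s / 2)"
  let ?B = "\<lambda>\<xi> \<zeta>. (?w (\<xi> - \<zeta>) * ?w \<zeta>) powr (s / 2) * (norm (q (\<xi> - \<zeta>)) * norm (p \<zeta>))"
  let ?Q = "\<lambda>\<xi> \<zeta>. ennreal (?w (\<xi> - \<zeta>) powr s * (norm (q (\<xi> - \<zeta>)))\<^sup>2) * ennreal (?w \<zeta> powr s * (norm (p \<zeta>))\<^sup>2)"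
  have pt: "ennreal (?w \<xi> powr s * (norm (LINT \<zeta>|lborel. q (\<xi> - \<zeta>) * p \<zeta>))\<^sup>2) \<le> ?K * (\<integral>\<^sup>+\<zeta>. ?Q \<xi> \<zeta> \<partial>lborel)" for \<xi>
  proof -
    have AB: "?A \<xi> \<zeta> * ?B \<xi> \<zeta> = norm (q (\<xi> - \<zeta>) * p \<zeta>)" for \<zeta>
    proof -
      have "?A \<xi> \<zeta> * (?w (\<xi> - \<zeta>) * ?w \<zeta>) powr (s / 2) = 1"
        using w by (simp add: powr_add[symmetric] less_imp_neq[symmetric])
      then show ?thesis by (simp only: mult.assoc[symmetric] mult_1_left norm_mult)
    qed
    \<comment> \<open>Expanding the product, one bracket cancels in each of the two terms; what
      remains has \<open>\<zeta>\<close>-integral \<open>?I\<close> for every \<open>\<xi>\<close>,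
      after a reflection in the second term.\<close>
    have A2: "?w \<xi> powr s * (?A \<xi> \<zeta>)\<^sup>2 \<le> 4 powr s * (?w \<zeta> powr (- s) + ?w (\<xi> - \<zeta>) powr (- s))" for \<zeta>
    proof -
      have "(?A \<xi> \<zeta>)\<^sup>2 = ?w (\<xi> - \<zeta>) powr (- s) * ?w \<zeta> powr (- s)"
      proof -
        have "(?A \<xi> \<zeta>)\<^sup>2 = (?w (\<xi> - \<zeta>) * ?w \<zeta>) powr (- s)"
          unfolding power2_eq_square[of "_ powr _"] powr_add[symmetric] by simp
        then show ?thesis using w by (simp only: powr_mult less_imp_le)
      qed
      then have "?w \<xi> powr s * (?A \<xi> \<zeta>)\<^sup>2 \<le> (4 powr s * (?w (\<xi> - \<zeta>) powr s + ?w \<zeta> powr s)) * (?w (\<xi> - \<zeta>) powr (- s) * ?w \<zeta> powr (- s))"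
        using bracket_peetre[OF s] by (simp only:) (intro mult_right_mono, auto)
      also have "\<dots> = 4 powr s * ((?w (\<xi> - \<zeta>) powr s * ?w (\<xi> - \<zeta>) powr (- s)) * ?w \<zeta> powr (- s) + (?w \<zeta> powr s * ?w \<zeta> powr (- s)) * ?w (\<xi> - \<zeta>) powr (- s))"
        by (simp add: algebra_simps)
      also have "\<dots> = 4 powr s * (?w \<zeta> powr (- s) + ?w (\<xi> - \<zeta>) powr (- s))"
        using w by (simp add: powr_add[symmetric] less_imp_neq[symmetric])
      finally show ?thesis .
    qed
    have B2: "(?B \<xi> \<zeta>)\<^sup>2 = (?w (\<xi> - \<zeta>) powr s * (norm (q (\<xi> - \<zeta>)))\<^sup>2) * (?w \<zeta> powr s * (norm (p \<zeta>))\<^sup>2)" for \<zeta>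
    proof -
      have "(?w (\<xi> - \<zeta>) powr (s / 2))\<^sup>2 = ?w (\<xi> - \<zeta>) powr s" "(?w \<zeta> powr (s / 2))\<^sup>2 = ?w \<zeta> powr s"
        by (simp_all add: power2_eq_square powr_add[symmetric])
      moreover have "(?w (\<xi> - \<zeta>) * ?w \<zeta>) powr (s / 2) = ?w (\<xi> - \<zeta>) powr (s / 2) * ?w \<zeta> powr (s / 2)"
        by (rule powr_mult)
      ultimately show ?thesis by (simp only: power_mult_distrib ac_simps)
    qed
    \<comment> \<open>Valid also where the convolution integral fails to exist, since it is 0
      there.\<close>
    have "ennreal (norm (LINT \<zeta>|lborel. q (\<xi> - \<zeta>) * p \<zeta>)) \<le> (\<integral>\<^sup>+\<zeta>. ennreal (?A \<xi> \<zeta>) * ennreal (?B \<xi> \<zeta>) \<partial>lborel)"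
      by (rule order_trans[OF norm_integral_le_nn_integral], intro nn_integral_mono)
         (simp only: AB[symmetric] ennreal_mult' powr_ge_zero order_refl)
    then have "(ennreal (norm (LINT \<zeta>|lborel. q (\<xi> - \<zeta>) * p \<zeta>)))\<^sup>2 \<le> (\<integral>\<^sup>+\<zeta>. ennreal (?A \<xi> \<zeta>) * ennreal (?B \<xi> \<zeta>) \<partial>lborel)\<^sup>2"
      by (rule power_mono) simp
    also have "\<dots> \<le> (\<integral>\<^sup>+\<zeta>. (ennreal (?A \<xi> \<zeta>))\<^sup>2 \<partial>lborel) * (\<integral>\<^sup>+\<zeta>. (ennreal (?B \<xi> \<zeta>))\<^sup>2 \<partial>lborel)"
      by (rule Cauchy_Schwarz_nn_integral) measurable
    also have "(\<integral>\<^sup>+\<zeta>. (ennreal (?B \<xi> \<zeta>))\<^sup>2 \<partial>lborel) = (\<integral>\<^sup>+\<zeta>. ?Q \<xi> \<zeta> \<partial>lborel)"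
    proof (rule nn_integral_cong)
      fix \<zeta> :: 'a
      have "(ennreal (?B \<xi> \<zeta>))\<^sup>2 = ennreal ((?B \<xi> \<zeta>)\<^sup>2)" by (rule ennreal_power) simp
      also have "\<dots> = ?Q \<xi> \<zeta>" unfolding B2 by (rule ennreal_mult) simp_all
      finally show "(ennreal (?B \<xi> \<zeta>))\<^sup>2 = ?Q \<xi> \<zeta>" .
    qed
    finally have cs: "(ennreal (norm (LINT \<zeta>|lborel. q (\<xi> - \<zeta>) * p \<zeta>)))\<^sup>2 \<le> (\<integral>\<^sup>+\<zeta>. (ennreal (?A \<xi> \<zeta>))\<^sup>2 \<partial>lborel) * (\<integral>\<^sup>+\<zeta>. ?Q \<xi> \<zeta> \<partial>lborel)" .
    have wA: "ennreal (?w \<xi> powr s) * (\<integral>\<^sup>+\<zeta>. (ennreal (?A \<xi> \<zeta>))\<^sup>2 \<partial>lborel) \<le> ?K"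
    proof -
      have "ennreal (?w \<xi> powr s) * (\<integral>\<^sup>+\<zeta>. (ennreal (?A \<xi> \<zeta>))\<^sup>2 \<partial>lborel) = (\<integral>\<^sup>+\<zeta>. ennreal (?w \<xi> powr s) * (ennreal (?A \<xi> \<zeta>))\<^sup>2 \<partial>lborel)"
        by (rule nn_integral_cmult[symmetric]) measurable
      also have "\<dots> \<le> (\<integral>\<^sup>+\<zeta>. ennreal (4 powr s) * (ennreal (?w \<zeta> powr (- s)) + ennreal (?w (\<xi> - \<zeta>) powr (- s))) \<partial>lborel)"
        using A2 by (intro nn_integral_mono) (simp add: ennreal_power ennreal_leI flip: ennreal_mult ennreal_plus)
      also have "\<dots> = ennreal (4 powr s) * (\<integral>\<^sup>+\<zeta>. ennreal (?w \<zeta> powr (- s)) + ennreal (?w (\<xi> - \<zeta>) powr (- s)) \<partial>lborel)"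
        by (rule nn_integral_cmult) measurable
      also have "\<dots> = ennreal (4 powr s) * (?I + (\<integral>\<^sup>+\<zeta>. ennreal (?w (\<xi> - \<zeta>) powr (- s)) \<partial>lborel))"
        by (intro arg_cong2[of _ _ _ _ "(*)"] refl nn_integral_add) measurable
      also have "\<dots> = ennreal (4 powr s) * (?I + ?I)"
        by (intro arg_cong2[of _ _ _ _ "(*)"] arg_cong2[of _ _ _ _ "(+)"] refl nn_integral_lborel_reflect[of "\<lambda>\<zeta>. ennreal (?w \<zeta> powr (- s))" \<xi>]) measurable
      also have "\<dots> = ?K"
        by (simp only: mult_2 ennreal_plus powr_ge_zero distrib_left distrib_right)
      finally show ?thesis .
    qed
    have "ennreal (?w \<xi> powr s * (norm (LINT \<zeta>|lborel. q (\<xi> - \<zeta>) * p \<zeta>))\<^sup>2) = ennreal (?w \<xi> powr s) * (ennreal (norm (LINT \<zeta>|lborel. q (\<xi> - \<zeta>) * p \<zeta>)))\<^sup>2"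
      by (simp add: ennreal_mult ennreal_power)
    also have "\<dots> \<le> ennreal (?w \<xi> powr s) * ((\<integral>\<^sup>+\<zeta>. (ennreal (?A \<xi> \<zeta>))\<^sup>2 \<partial>lborel) * (\<integral>\<^sup>+\<zeta>. ?Q \<xi> \<zeta> \<partial>lborel))"
      by (intro mult_left_mono cs) simp
    also have "\<dots> \<le> ?K * (\<integral>\<^sup>+\<zeta>. ?Q \<xi> \<zeta> \<partial>lborel)"
      unfolding mult.assoc[symmetric, of "ennreal (?w \<xi> powr s)"] by (intro mult_right_mono wA) simp
    finally show ?thesis .
  qed
  have "wnorm2 s (\<lambda>\<xi>. LINT \<zeta>|lborel. q (\<xi> - \<zeta>) * p \<zeta>) \<le> (\<integral>\<^sup>+\<xi>. ?K * (\<integral>\<^sup>+\<zeta>. ?Q \<xi> \<zeta> \<partial>lborel) \<partial>lborel)"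
    unfolding wnorm2_def by (intro nn_integral_mono pt)
  also have "\<dots> = ?K * (\<integral>\<^sup>+\<xi>. \<integral>\<^sup>+\<zeta>. ?Q \<xi> \<zeta> \<partial>lborel \<partial>lborel)"
    by (rule nn_integral_cmult) measurable
  also have "(\<integral>\<^sup>+\<xi>. \<integral>\<^sup>+\<zeta>. ?Q \<xi> \<zeta> \<partial>lborel \<partial>lborel) = (\<integral>\<^sup>+\<zeta>. \<integral>\<^sup>+\<xi>. ?Q \<xi> \<zeta> \<partial>lborel \<partial>lborel)"
    by (rule lborel_pair.Fubini'[symmetric]) measurable
  also have "\<dots> = (\<integral>\<^sup>+\<zeta>. wnorm2 s q * ennreal (?w \<zeta> powr s * (norm (p \<zeta>))\<^sup>2) \<partial>lborel)"
  proof (intro nn_integral_cong)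
    fix \<zeta> :: 'a
    have "(\<integral>\<^sup>+\<xi>. ?Q \<xi> \<zeta> \<partial>lborel) = (\<integral>\<^sup>+\<xi>. ennreal (?w (\<xi> - \<zeta>) powr s * (norm (q (\<xi> - \<zeta>)))\<^sup>2) \<partial>lborel) * ennreal (?w \<zeta> powr s * (norm (p \<zeta>))\<^sup>2)"
      by (rule nn_integral_multc) measurable
    also have "(\<integral>\<^sup>+\<xi>. ennreal (?w (\<xi> - \<zeta>) powr s * (norm (q (\<xi> - \<zeta>)))\<^sup>2) \<partial>lborel) = wnorm2 s q"
      unfolding wnorm2_def using nn_integral_lborel_shift[of "\<lambda>\<xi>. ennreal (?w \<xi> powr s * (norm (q \<xi>))\<^sup>2)" "- \<zeta>"] by simp
    finally show "(\<integral>\<^sup>+\<xi>. ?Q \<xi> \<zeta> \<partial>lborel) = wnorm2 s q * ennreal (?w \<zeta> powr s * (norm (p \<zeta>))\<^sup>2)" .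
  qed
  also have "\<dots> = wnorm2 s q * wnorm2 s p"
    unfolding wnorm2_def[of s p] by (rule nn_integral_cmult) measurable
  finally show ?thesis by (simp only: ac_simps)
qed

text \<open>\<open>F\<close> enters through its representation by \<open>p\<close>, so Fubini rests
  on the integrability of \<open>G\<close> and \<open>p\<close>; the powers of \<open>2 * pi\<close>
  are hidden in \<open>p\<close>.\<close>

lemma fourier_mult_convolution:
  fixes G F p :: "'a::euclidean_space \<Rightarrow> complex"
  assumes G: "integrable lborel G" and p: "integrable lborel p"
    and F: "\<And>x. F x = (LINT \<zeta>|lborel. cis (x \<bullet> \<zeta>) * p \<zeta>)" and [measurable]: "F \<in> borel_measurable borel"
  shows "fourier (\<lambda>x. G x * F x) \<xi> = (LINT \<zeta>|lborel. fourier G (\<xi> - \<zeta>) * p \<zeta>)"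
proof -
  have Gm [measurable]: "G \<in> borel_measurable borel" and [measurable]: "p \<in> borel_measurable borel" using G p by auto
  have "fourier (\<lambda>x. G x * F x) \<xi> = (LINT x|lborel. cis (- (x \<bullet> \<xi>)) * (G x * F x))"
    by (rule fourier_lborel) measurable
  also have "\<dots> = (LINT x|lborel. LINT \<zeta>|lborel. cis (- (x \<bullet> \<xi>)) * (G x * (cis (x \<bullet> \<zeta>) * p \<zeta>)))"
    by (simp add: F p)
  also have "\<dots> = (LINT \<zeta>|lborel. LINT x|lborel. cis (- (x \<bullet> \<xi>)) * (G x * (cis (x \<bullet> \<zeta>) * p \<zeta>)))"
    by (rule lborel_pair.Fubini_integral[symmetric], rule integrable_lborel_pair_bound[OF _ G p]) (auto simp: norm_mult)
  also have "\<dots> = (LINT \<zeta>|lborel. fourier G (\<xi> - \<zeta>) * p \<zeta>)"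
  proof (intro Bochner_Integration.integral_cong refl)
    fix \<zeta> :: 'a
    have "cis (- (x \<bullet> \<xi>)) * (G x * (cis (x \<bullet> \<zeta>) * p \<zeta>)) = cis (- (x \<bullet> (\<xi> - \<zeta>))) * G x * p \<zeta>" for x
    proof -
      have "cis (- (x \<bullet> (\<xi> - \<zeta>))) = cis (- (x \<bullet> \<xi>)) * cis (x \<bullet> \<zeta>)" by (simp add: cis_mult inner_diff_right)
      then show ?thesis by (simp only: ac_simps)
    qed
    then show "(LINT x|lborel. cis (- (x \<bullet> \<xi>)) * (G x * (cis (x \<bullet> \<zeta>) * p \<zeta>))) = fourier G (\<xi> - \<zeta>) * p \<zeta>"
      by (simp only: fourier_lborel[OF Gm] integral_mult_left_zero)
  qed
  finally show ?thesis .
qed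

text \<open>A factor \<open>F\<close> acts on transforms as convolution with \<open>p\<close> and
  multiplies \<open>wnorm2 s\<close> by at most \<open>M\<close>. So the transform of
  \<open>G * F ^ j\<close> has squared norm at most \<open>M ^ j * N\<close>, and the factorials of
  the exponential series win. The factor \<open>G\<close> keeps every term integrable, the constant
  one included.\<close>

lemma fourier_exp_wnorm2:
  fixes G :: "'a::euclidean_space \<Rightarrow> complex" and F :: "'a \<Rightarrow> real"
  assumes s: "real DIM('a) < 2 * s"
    and G: "integrable lborel G" and G2: "wnorm2 s (fourier G) < \<infinity>"
    and p: "integrable lborel p" and p2: "wnorm2 s p < \<infinity>"
    and F: "\<And>x. of_real (F x) = (LINT \<zeta>|lborel. cis (x \<bullet> \<zeta>) * p \<zeta>)" and Fm [measurable]: "F \<in> borel_measurable borel"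
    and B: "\<And>x. \<bar>F x\<bar> \<le> B"
  shows "wnorm2 s (fourier (\<lambda>x. G x * of_real (exp (- F x)))) < \<infinity>"
proof -
  have s0: "0 \<le> s" using s by (smt (verit) of_nat_0_le_iff)
  have Gm [measurable]: "G \<in> borel_measurable borel" and pm [measurable]: "p \<in> borel_measurable borel" using G p by auto
  let ?h = "\<lambda>j x. G x * of_real (F x) ^ j"
  define q where "q j = fourier (?h j)" for j
  define I where "I = (\<integral>\<^sup>+\<zeta>. ennreal (bracket (\<zeta>::'a) powr (- s)) \<partial>lborel)"
  have Ifin: "I < \<infinity>" unfolding I_def by (rule nn_integral_bracket_less_top[OF s])
  define M where "M = enn2real (ennreal (2 * 4 powr s) * I * wnorm2 s p)"
  have M: "ennreal M = ennreal (2 * 4 powr s) * I * wnorm2 s p" "0 \<le> M"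
    unfolding M_def using Ifin p2 by (auto simp: ennreal_mult_less_top less_top)
  define N where "N = enn2real (wnorm2 s (fourier G))"
  have N: "ennreal N = wnorm2 s (fourier G)" "0 \<le> N" unfolding N_def using G2 by (auto simp: less_top)
  have B0: "0 \<le> B" by (rule order_trans[OF abs_ge_zero B])
  have hi: "integrable lborel (?h j)" for j
  proof (rule Bochner_Integration.integrable_bound[OF integrable_mult_right[OF G, of "of_real (B ^ j)"]])
    show "AE x in lborel. norm (?h j x) \<le> norm (of_real (B ^ j) * G x)"
      using B B0 by (intro AE_I2) (auto simp: norm_mult norm_power mult.commute[of "B ^ j"] intro!: mult_left_mono power_mono)
  qed measurable
  have qm [measurable]: "q j \<in> borel_measurable borel" for j
    unfolding q_def using fourier_measurable[of "?h j" "\<lambda>x. x" borel] by simp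
  have qN: "wnorm2 s (q j) \<le> ennreal (M ^ j * N)" for j
  proof (induction j)
    case 0
    then show ?case by (simp add: q_def N)
  next
    case (Suc j)
    have "?h (Suc j) = (\<lambda>x. ?h j x * of_real (F x))" by (auto simp: ac_simps)
    then have "q (Suc j) = (\<lambda>\<xi>. LINT \<zeta>|lborel. q j (\<xi> - \<zeta>) * p \<zeta>)"
      unfolding q_def using fourier_mult_convolution[OF hi p F, of j] by auto
    then have "wnorm2 s (q (Suc j)) \<le> ennreal M * wnorm2 s (q j)"
      unfolding M I_def using convolution_wnorm2[OF s0 pm qm[of j]] by simp
    also have "\<dots> \<le> ennreal M * ennreal (M ^ j * N)" by (intro mult_left_mono Suc) simp
    also have "\<dots> = ennreal (M ^ Suc j * N)" using M(2) N(2) by (simp add: mult.assoc flip: ennreal_mult)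
    finally show ?case .
  qed
  let ?E = "\<lambda>x. G x * of_real (exp (- F x))"
  let ?c = "\<lambda>j. (- 1) ^ j / fact j :: complex"
  let ?S = "\<lambda>n x. G x * of_real (\<Sum>j<n. (- F x) ^ j / fact j)"
  \<comment> \<open>Convergence at each \<open>\<xi>\<close> is enough, because the norm estimate
    comes from the pointwise bound below.\<close>
  have lim: "(\<lambda>n. fourier (?S n) \<xi>) \<longlonglongrightarrow> fourier ?E \<xi>" for \<xi>
  proof -
    have Sm: "?S n \<in> borel_measurable borel" for n by measurable
    have Em: "?E \<in> borel_measurable borel" by measurable
    have "(\<lambda>n. LINT x|lborel. cis (- (x \<bullet> \<xi>)) * ?S n x) \<longlonglongrightarrow> (LINT x|lborel. cis (- (x \<bullet> \<xi>)) * ?E x)"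
    proof (rule integral_dominated_convergence[where w="\<lambda>x. exp B * norm (G x)"])
      have "(\<lambda>n. \<Sum>j<n. (- F x) ^ j / fact j) \<longlonglongrightarrow> exp (- F x)" for x
        using exp_converges[of "- F x"] unfolding sums_def by (simp add: divide_inverse_commute)
      then show "AE x in lborel. (\<lambda>n. cis (- (x \<bullet> \<xi>)) * ?S n x) \<longlonglongrightarrow> cis (- (x \<bullet> \<xi>)) * ?E x"
        by (intro AE_I2 tendsto_mult tendsto_const tendsto_of_real)
      have "\<bar>\<Sum>j<n. (- F x) ^ j / fact j\<bar> \<le> exp B" for n x
      proof -
        have "\<bar>\<Sum>j<n. (- F x) ^ j / fact j\<bar> \<le> (\<Sum>j<n. \<bar>(- F x) ^ j / fact j\<bar>)" by (rule sum_abs)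
        also have "\<dots> \<le> (\<Sum>j<n. B ^ j / fact j)"
          using B by (intro sum_mono) (auto simp: abs_mult power_abs intro!: divide_right_mono power_mono)
        also have "\<dots> \<le> exp B"
          using exp_converges[of B] B0 unfolding sums_iff
          by (intro order_trans[OF sum_le_suminf[of "\<lambda>j. B ^ j / fact j"]]) (auto simp: divide_inverse_commute)
        finally show ?thesis .
      qed
      then show "AE x in lborel. norm (cis (- (x \<bullet> \<xi>)) * ?S n x) \<le> exp B * norm (G x)" for n
        by (intro AE_I2) (simp only: norm_mult norm_cis mult_1_left norm_of_real, subst mult.commute, intro mult_right_mono, auto)
      show "integrable lborel (\<lambda>x. exp B * norm (G x))" using G by simp
    qed measurable
    then show ?thesis unfolding fourier_lborel[OF Sm] fourier_lborel[OF Em] .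
  qed
  have Sq: "fourier (?S n) \<xi> = (\<Sum>j<n. ?c j * q j \<xi>)" for n \<xi>
  proof -
    have "?S n x = (\<Sum>j<n. ?c j * ?h j x)" for x
      unfolding of_real_sum sum_distrib_left by (intro sum.cong refl) (simp add: power_minus[of "of_real _"] power_minus[of "F x"])
    then have "fourier (?S n) \<xi> = fourier (\<lambda>x. \<Sum>j<n. ?c j * ?h j x) \<xi>" by simp
    also have "\<dots> = (LINT x|lborel. (\<Sum>j<n. cis (- (x \<bullet> \<xi>)) * (?c j * ?h j x)))"
      by (subst fourier_lborel) (measurable, simp only: sum_distrib_left)
    also have "\<dots> = (\<Sum>j<n. (LINT x|lborel. cis (- (x \<bullet> \<xi>)) * (?c j * ?h j x)))"
      by (intro Bochner_Integration.integral_sum integrable_cis_mult integrable_mult_right hi) measurable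
    also have "\<dots> = (\<Sum>j<n. ?c j * (LINT x|lborel. cis (- (x \<bullet> \<xi>)) * ?h j x))"
      by (simp only: mult.left_commute[of "cis _"] integral_mult_right_zero)
    also have "\<dots> = (\<Sum>j<n. ?c j * q j \<xi>)"
      unfolding q_def by (intro sum.cong refl arg_cong2[of _ _ _ _ "(*)"] fourier_lborel[symmetric]) measurable
    finally show ?thesis .
  qed
  \<comment> \<open>Cauchy-Schwarz with the weight \<open>1 / fact j\<close> split evenly,
    \<open>1 / sqrt (fact j)\<close> in each factor, turns the square of the series into a series of
    squares. This stands in for the triangle inequality in the weighted space.\<close>
  have bound: "ennreal ((norm (fourier ?E \<xi>))\<^sup>2) \<le> ennreal (exp 1) * (\<Sum>j. ennreal ((norm (q j \<xi>))\<^sup>2 / fact j))" for \<xi>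
  proof (rule LIMSEQ_le_const2)
    show "(\<lambda>n. ennreal ((norm (fourier (?S n) \<xi>))\<^sup>2)) \<longlonglongrightarrow> ennreal ((norm (fourier ?E \<xi>))\<^sup>2)"
      by (intro tendsto_ennrealI tendsto_power tendsto_norm lim)
    have "ennreal ((norm (fourier (?S n) \<xi>))\<^sup>2) \<le> ennreal (exp 1) * (\<Sum>j. ennreal ((norm (q j \<xi>))\<^sup>2 / fact j))" for n
    proof -
      have "norm (fourier (?S n) \<xi>) \<le> (\<Sum>j<n. (1 / sqrt (fact j)) * (norm (q j \<xi>) / sqrt (fact j)))"
        unfolding Sq by (rule order_trans[OF norm_sum]) (auto simp: norm_mult norm_divide norm_power intro!: sum_mono)
      then have "(norm (fourier (?S n) \<xi>))\<^sup>2 \<le> (\<Sum>j<n. (1 / sqrt (fact j)) * (norm (q j \<xi>) / sqrt (fact j)))\<^sup>2"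
        by (rule power_mono) simp
      also have "\<dots> \<le> (\<Sum>j<n. (1 / sqrt (fact j))\<^sup>2) * (\<Sum>j<n. (norm (q j \<xi>) / sqrt (fact j))\<^sup>2)"
        by (rule Cauchy_Schwarz_ineq_sum)
      also have "\<dots> = (\<Sum>j<n. 1 / fact j) * (\<Sum>j<n. (norm (q j \<xi>))\<^sup>2 / fact j)"
        by (simp add: power_divide)
      also have "\<dots> \<le> exp 1 * (\<Sum>j<n. (norm (q j \<xi>))\<^sup>2 / fact j)"
      proof (rule mult_right_mono)
        show "(\<Sum>j<n. 1 / fact j) \<le> exp (1::real)"
          using exp_converges[of "1::real"] unfolding sums_iff
          by (intro order_trans[OF sum_le_suminf[of "\<lambda>j. 1 / fact j"]]) (auto simp: divide_inverse_commute)
      qed (auto intro: sum_nonneg)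
      finally have "ennreal ((norm (fourier (?S n) \<xi>))\<^sup>2) \<le> ennreal (exp 1 * (\<Sum>j<n. (norm (q j \<xi>))\<^sup>2 / fact j))"
        by (rule ennreal_leI)
      also have "\<dots> = ennreal (exp 1) * (\<Sum>j<n. ennreal ((norm (q j \<xi>))\<^sup>2 / fact j))"
        by (subst sum_ennreal) (auto simp: ennreal_mult sum_nonneg)
      also have "\<dots> \<le> ennreal (exp 1) * (\<Sum>j. ennreal ((norm (q j \<xi>))\<^sup>2 / fact j))"
        by (intro mult_left_mono sum_le_suminf) auto
      finally show ?thesis .
    qed
    then show "\<exists>N. \<forall>n\<ge>N. ennreal ((norm (fourier (?S n) \<xi>))\<^sup>2) \<le> ennreal (exp 1) * (\<Sum>j. ennreal ((norm (q j \<xi>))\<^sup>2 / fact j))"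
      by blast
  qed
  have "wnorm2 s (fourier ?E) \<le> (\<integral>\<^sup>+\<xi>. ennreal (exp 1) * (\<Sum>j. ennreal (1 / fact j) * ennreal (bracket \<xi> powr s * (norm (q j \<xi>))\<^sup>2)) \<partial>lborel)"
    unfolding wnorm2_def
  proof (intro nn_integral_mono)
    fix \<xi> :: 'a
    let ?W = "bracket \<xi> powr s"
    have "ennreal (?W * (norm (fourier ?E \<xi>))\<^sup>2) \<le> ennreal ?W * (ennreal (exp 1) * (\<Sum>j. ennreal ((norm (q j \<xi>))\<^sup>2 / fact j)))"
      by (simp add: ennreal_mult mult_left_mono bound)
    also have "\<dots> = ennreal (exp 1) * (\<Sum>j. ennreal ?W * ennreal ((norm (q j \<xi>))\<^sup>2 / fact j))"
      by (simp only: ennreal_suminf_cmult mult.left_commute)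
    also have "(\<lambda>j. ennreal ?W * ennreal ((norm (q j \<xi>))\<^sup>2 / fact j)) = (\<lambda>j. ennreal (1 / fact j) * ennreal (?W * (norm (q j \<xi>))\<^sup>2))"
      by (auto simp flip: ennreal_mult)
    finally show "ennreal (?W * (norm (fourier ?E \<xi>))\<^sup>2) \<le> ennreal (exp 1) * (\<Sum>j. ennreal (1 / fact j) * ennreal (?W * (norm (q j \<xi>))\<^sup>2))" .
  qed
  also have "\<dots> = ennreal (exp 1) * (\<integral>\<^sup>+\<xi>. (\<Sum>j. ennreal (1 / fact j) * ennreal (bracket \<xi> powr s * (norm (q j \<xi>))\<^sup>2)) \<partial>lborel)"
    by (rule nn_integral_cmult) measurable
  also have "(\<integral>\<^sup>+\<xi>. (\<Sum>j. ennreal (1 / fact j) * ennreal (bracket \<xi> powr s * (norm (q j \<xi>))\<^sup>2)) \<partial>lborel) =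
      (\<Sum>j. \<integral>\<^sup>+\<xi>. ennreal (1 / fact j) * ennreal (bracket \<xi> powr s * (norm (q j \<xi>))\<^sup>2) \<partial>lborel)"
    by (rule nn_integral_suminf) measurable
  also have "\<dots> = (\<Sum>j. ennreal (1 / fact j) * wnorm2 s (q j))"
    unfolding wnorm2_def by (intro suminf_cong nn_integral_cmult) measurable
  also have "ennreal (exp 1) * \<dots> \<le> ennreal (exp 1) * (\<Sum>j. ennreal (1 / fact j) * ennreal (M ^ j * N))"
    by (intro mult_left_mono suminf_le qN) auto
  also have "(\<lambda>j. ennreal (1 / fact j) * ennreal (M ^ j * N)) = (\<lambda>j. ennreal (N * (M ^ j / fact j)))"
    using M N by (auto simp: mult.commute simp flip: ennreal_mult)
  also have "(\<Sum>j. ennreal (N * (M ^ j / fact j))) = ennreal (N * exp M)"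
  proof (rule suminf_ennreal_eq)
    show "(\<lambda>j. N * (M ^ j / fact j)) sums (N * exp M)"
      using sums_mult[OF exp_converges[of M], of N] by (simp add: divide_inverse_commute)
  qed (use M N in auto)
  finally show ?thesis by (simp add: ennreal_mult_less_top order_le_less_trans)
qed

section \<open>Convolutions and integrals along segments\<close>

text \<open>\<open>convol\<close> with the substitution made and over Borel measure: the integrable
  kernel sits at the integration variable and dominates all translates of a bounded
  \<open>f\<close>.\<close>

definition conv :: "('a::euclidean_space \<Rightarrow> real) \<Rightarrow> ('a \<Rightarrow> real) \<Rightarrow> 'a \<Rightarrow> real" where
  "conv K f x = (LINT z|lborel. K z * f (x - z))"

lemma borel_measurable_conv [measurable]:
  assumes [measurable]: "K \<in> borel_measurable borel" "f \<in> borel_measurable borel"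
  shows "conv K f \<in> borel_measurable borel"
  unfolding conv_def[abs_def] by measurable

lemma integrable_conv_kernel:
  fixes K f :: "'a::euclidean_space \<Rightarrow> real"
  assumes K: "integrable lborel K" and [measurable]: "f \<in> borel_measurable borel" and M: "\<And>x. \<bar>f x\<bar> \<le> M"
  shows "integrable lborel (\<lambda>z. K z * f (x - z))"
proof -
  have [measurable]: "K \<in> borel_measurable borel" using K by auto
  show ?thesis
    by (rule Bochner_Integration.integrable_bound[OF integrable_mult_right[OF K, of M]])
       (auto simp: abs_mult mult.commute[of M] intro!: mult_left_mono order_trans[OF M])
qed

lemma conv_bounds:
  fixes K f :: "'a::euclidean_space \<Rightarrow> real"
  assumes K: "integrable lborel K" "\<And>x. 0 \<le> K x" and [measurable]: "f \<in> borel_measurable borel"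
    and f: "\<And>x. 0 \<le> f x" "\<And>x. f x \<le> M"
  shows "0 \<le> conv K f x" "conv K f x \<le> (LINT x|lborel. K x) * M"
proof -
  show "0 \<le> conv K f x" unfolding conv_def using K f by (intro Bochner_Integration.integral_nonneg) auto
  have "conv K f x \<le> (LINT z|lborel. K z * M)"
    unfolding conv_def using K f by (intro integral_mono integrable_conv_kernel[where M=M] integrable_mult_left) (auto intro: mult_left_mono)
  then show "conv K f x \<le> (LINT x|lborel. K x) * M" by simp
qed

lemma conv_integrable_pair:
  fixes K f :: "'a::euclidean_space \<Rightarrow> real"
  assumes K: "integrable lborel K" and f: "integrable lborel f"
  shows "integrable (lborel \<Otimes>\<^sub>M lborel) (\<lambda>(x, z). K z * f (x - z))"
proof (rule integrable_lborel_pairI)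
  have [measurable]: "K \<in> borel_measurable borel" "f \<in> borel_measurable borel" using K f by auto
  show "(\<lambda>(x, z). K z * f (x - z)) \<in> borel_measurable (lborel \<Otimes>\<^sub>M lborel)" by measurable
  have "(\<integral>\<^sup>+x. \<integral>\<^sup>+z. ennreal (norm (K z * f (x - z))) \<partial>lborel \<partial>lborel) = (\<integral>\<^sup>+z. \<integral>\<^sup>+x. ennreal \<bar>K z\<bar> * ennreal \<bar>f (x - z)\<bar> \<partial>lborel \<partial>lborel)"
    by (subst lborel_pair.Fubini'[symmetric]) (auto simp: abs_mult ennreal_mult)
  also have "\<dots> = (\<integral>\<^sup>+z. ennreal \<bar>K z\<bar> * (\<integral>\<^sup>+x. ennreal \<bar>f x\<bar> \<partial>lborel) \<partial>lborel)"
  proof (intro nn_integral_cong)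
    fix z
    have "(\<integral>\<^sup>+x. ennreal \<bar>K z\<bar> * ennreal \<bar>f (x - z)\<bar> \<partial>lborel) = ennreal \<bar>K z\<bar> * (\<integral>\<^sup>+x. ennreal \<bar>f (x - z)\<bar> \<partial>lborel)"
      by (rule nn_integral_cmult) measurable
    then show "(\<integral>\<^sup>+x. ennreal \<bar>K z\<bar> * ennreal \<bar>f (x - z)\<bar> \<partial>lborel) = ennreal \<bar>K z\<bar> * (\<integral>\<^sup>+x. ennreal \<bar>f x\<bar> \<partial>lborel)"
      using nn_integral_lborel_shift[of "\<lambda>x. ennreal \<bar>f x\<bar>" "- z"] by simp
  qed
  also have "\<dots> = (\<integral>\<^sup>+z. ennreal \<bar>K z\<bar> \<partial>lborel) * (\<integral>\<^sup>+x. ennreal \<bar>f x\<bar> \<partial>lborel)"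
    by (rule nn_integral_multc) measurable
  also have "\<dots> < \<infinity>" using K f by (auto simp: integrable_iff_bounded ennreal_mult_less_top)
  finally show "(\<integral>\<^sup>+x. \<integral>\<^sup>+z. ennreal (norm (K z * f (x - z))) \<partial>lborel \<partial>lborel) < \<infinity>" .
qed

lemma integrable_conv:
  fixes K f :: "'a::euclidean_space \<Rightarrow> real"
  assumes K: "integrable lborel K" and f: "integrable lborel f"
  shows "integrable lborel (conv K f)"
  unfolding conv_def[abs_def] using lborel_pair.integrable_fst[OF conv_integrable_pair[OF K f]] .

lemma fourier_conv:
  fixes K f :: "'a::euclidean_space \<Rightarrow> real"
  assumes K: "integrable lborel K" and f: "integrable lborel f"
  shows "fourier (\<lambda>x. of_real (conv K f x)) \<xi> = fourier (\<lambda>x. of_real (K x)) \<xi> * fourier (\<lambda>x. of_real (f x)) \<xi>"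
proof -
  have [measurable]: "K \<in> borel_measurable borel" "f \<in> borel_measurable borel" using K f by auto
  have int: "integrable (lborel \<Otimes>\<^sub>M lborel) (\<lambda>(x, z). cis (- (x \<bullet> \<xi>)) * complex_of_real (K z * f (x - z)))"
    by (rule Bochner_Integration.integrable_bound[OF conv_integrable_pair[OF K f]]) (measurable, auto simp: norm_mult)
  have "fourier (\<lambda>x. of_real (conv K f x)) \<xi> = (LINT x|lborel. cis (- (x \<bullet> \<xi>)) * of_real (conv K f x))"
    by (rule fourier_lborel) measurable
  also have "\<dots> = (LINT x|lborel. LINT z|lborel. cis (- (x \<bullet> \<xi>)) * complex_of_real (K z * f (x - z)))"
    unfolding conv_def integral_complex_of_real[symmetric] by (simp only: integral_mult_right_zero)
  also have "\<dots> = (LINT z|lborel. LINT x|lborel. cis (- (x \<bullet> \<xi>)) * complex_of_real (K z * f (x - z)))"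
    by (rule lborel_pair.Fubini_integral[symmetric, OF int])
  also have "\<dots> = (LINT z|lborel. cis (- (z \<bullet> \<xi>)) * of_real (K z) * fourier (\<lambda>x. of_real (f x)) \<xi>)"
  proof (intro Bochner_Integration.integral_cong refl)
    fix z
    have "(LINT x|lborel. cis (- (x \<bullet> \<xi>)) * complex_of_real (K z * f (x - z))) = (LINT x|lborel. cis (- ((z + x) \<bullet> \<xi>)) * complex_of_real (K z * f ((z + x) - z)))"
      by (rule lborel_integral_shift[symmetric]) measurable
    also have "\<dots> = (LINT x|lborel. cis (- (z \<bullet> \<xi>)) * of_real (K z) * (cis (- (x \<bullet> \<xi>)) * of_real (f x)))"
    proof (intro Bochner_Integration.integral_cong refl)
      fix x
      have "cis (- ((z + x) \<bullet> \<xi>)) = cis (- (z \<bullet> \<xi>)) * cis (- (x \<bullet> \<xi>))" by (simp add: inner_add_left cis_mult)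
      then show "cis (- ((z + x) \<bullet> \<xi>)) * complex_of_real (K z * f ((z + x) - z)) = cis (- (z \<bullet> \<xi>)) * of_real (K z) * (cis (- (x \<bullet> \<xi>)) * of_real (f x))"
        by simp
    qed
    also have "\<dots> = cis (- (z \<bullet> \<xi>)) * of_real (K z) * fourier (\<lambda>x. of_real (f x)) \<xi>"
      by (simp add: fourier_lborel)
    finally show "(LINT x|lborel. cis (- (x \<bullet> \<xi>)) * complex_of_real (K z * f (x - z))) = cis (- (z \<bullet> \<xi>)) * of_real (K z) * fourier (\<lambda>x. of_real (f x)) \<xi>" .
  qed
  also have "\<dots> = fourier (\<lambda>x. of_real (K x)) \<xi> * fourier (\<lambda>x. of_real (f x)) \<xi>"
    by (simp add: fourier_lborel)
  finally show ?thesis .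
qed

lemma AE_lborel_reflect:
  fixes x :: "'a::euclidean_space"
  assumes "AE z in lborel. P z"
  shows "AE z in lborel. P (x - z)"
proof -
  obtain N where N: "N \<in> null_sets lborel" "\<And>z. z \<in> space lborel - N \<Longrightarrow> P z" using AE_E3[OF assms] by blast
  then have [measurable]: "N \<in> sets borel" by auto
  have "emeasure lborel {z. x - z \<in> N} = (\<integral>\<^sup>+z. indicator N (x - z) \<partial>lborel)"
  proof -
    have "emeasure lborel {z. x - z \<in> N} = (\<integral>\<^sup>+z. indicator {z. x - z \<in> N} z \<partial>lborel)"
      by (rule nn_integral_indicator[symmetric]) measurable
    also have "\<dots> = (\<integral>\<^sup>+z. indicator N (x - z) \<partial>lborel)" by (simp add: indicator_def)
    finally show ?thesis .
  qed
  also have "\<dots> = (\<integral>\<^sup>+z. indicator N z \<partial>lborel)" by (rule nn_integral_lborel_reflect) measurable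
  also have "\<dots> = 0" using N by auto
  finally have "{z. x - z \<in> N} \<in> null_sets lborel" by (auto simp: null_sets_def)
  then show ?thesis by (rule AE_I') (use N in auto)
qed

text \<open>For fixed \<open>x\<close>, the \<open>z\<close> for which \<open>f\<close> is
  discontinuous at \<open>x - z\<close> form a null set, so dominated convergence applies with the
  bound \<open>M * \<bar>K z\<bar>\<close>. A function with jumps on a null set becomes one to which
  inversion applies.\<close>

lemma continuous_conv:
  fixes K f :: "'a::euclidean_space \<Rightarrow> real"
  assumes K: "integrable lborel K" and fm [measurable]: "f \<in> borel_measurable borel" and M: "\<And>x. \<bar>f x\<bar> \<le> M"
    and c: "AE x in lborel. isCont f x"
  shows "continuous_on UNIV (conv K f)"
proof (intro continuous_at_imp_continuous_on ballI)
  have [measurable]: "K \<in> borel_measurable borel" using K by auto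
  fix x :: 'a
  have "(\<lambda>n. conv K f (X n)) \<longlonglongrightarrow> conv K f x" if X: "X \<longlonglongrightarrow> x" for X
    unfolding conv_def
  proof (rule integral_dominated_convergence[where w="\<lambda>z. M * \<bar>K z\<bar>"])
    show "AE z in lborel. (\<lambda>n. K z * f (X n - z)) \<longlonglongrightarrow> K z * f (x - z)"
      using AE_lborel_reflect[OF c, of x]
    proof eventually_elim
      case (elim z)
      have "(\<lambda>n. X n - z) \<longlonglongrightarrow> x - z" by (intro tendsto_intros X)
      from isCont_tendsto_compose[OF elim this] show ?case by (intro tendsto_mult tendsto_const)
    qed
    show "AE z in lborel. norm (K z * f (X n - z)) \<le> M * \<bar>K z\<bar>" for n
      using M by (intro AE_I2) (simp add: abs_mult mult.commute[of M] mult_left_mono)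
    show "integrable lborel (\<lambda>z. M * \<bar>K z\<bar>)" using K by auto
  qed measurable
  then show "isCont (conv K f) x" by (auto simp: continuous_at_sequentially comp_def)
qed

text \<open>One branch of the V. The indicator keeps the integral over the whole line, as Fubini and
  the measurability rules expect.\<close>

definition seg :: "real \<Rightarrow> 'a::euclidean_space \<Rightarrow> ('a \<Rightarrow> real) \<Rightarrow> 'a \<Rightarrow> real" where
  "seg \<nu> d P x = (LINT t|lborel. indicator {0..\<nu>} t * P (x + t *\<^sub>R d))"

lemma borel_measurable_seg [measurable]:
  assumes [measurable]: "P \<in> borel_measurable borel"
  shows "seg \<nu> d P \<in> borel_measurable borel"
  unfolding seg_def[abs_def] by measurable

lemma integrable_indicator_segment: "integrable lborel (indicator {0..\<nu>::real} :: real \<Rightarrow> real)"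
  by (rule integrable_real_indicator) (auto simp: emeasure_lborel_Icc_eq)

lemma integrable_seg:
  fixes P :: "'a::euclidean_space \<Rightarrow> real"
  assumes [measurable]: "P \<in> borel_measurable borel" and M: "\<And>x. \<bar>P x\<bar> \<le> M"
  shows "integrable lborel (\<lambda>t. indicator {0..\<nu>} t * P (x + t *\<^sub>R d))"
  by (rule Bochner_Integration.integrable_bound[OF integrable_mult_right[OF integrable_indicator_segment, of M]])
     (use order_trans[OF M abs_ge_self] in \<open>auto simp: abs_mult indicator_def\<close>)

lemma seg_nonneg: "(\<And>x. 0 \<le> P x) \<Longrightarrow> 0 \<le> seg \<nu> d P x"
  unfolding seg_def by (intro Bochner_Integration.integral_nonneg) auto

lemma seg_le:
  fixes P :: "'a::euclidean_space \<Rightarrow> real"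
  assumes "P \<in> borel_measurable borel" and M: "\<And>x. 0 \<le> P x" "\<And>x. P x \<le> M" and "0 \<le> \<nu>"
  shows "seg \<nu> d P x \<le> M * \<nu>"
proof -
  have "seg \<nu> d P x \<le> (LINT t|lborel. M * indicator {0..\<nu>} t)"
    unfolding seg_def
    by (intro integral_mono integrable_seg[OF assms(1), of M] integrable_mult_right integrable_indicator_segment)
       (use M in \<open>auto simp: indicator_def abs_of_nonneg\<close>)
  then show ?thesis using \<open>0 \<le> \<nu>\<close> by simp
qed

lemma seg_difference:
  fixes P :: "'a::euclidean_space \<Rightarrow> real"
  assumes "P \<in> borel_measurable borel" and M: "\<And>x. \<bar>P x\<bar> \<le> M"
  shows "seg \<nu> d (\<lambda>x. P (x + h) - P x) x = seg \<nu> d P (x + h) - seg \<nu> d P x"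
  using integrable_seg[OF assms, of \<nu> "x + h" d] integrable_seg[OF assms, of \<nu> x d]
  unfolding seg_def by (simp add: right_diff_distrib algebra_simps)

text \<open>Cauchy-Schwarz along the segment gives one factor \<open>\<nu>\<close>; integrating the
  translates over \<open>x\<close> gives the other.\<close>

lemma seg_L2:
  fixes D :: "'a::euclidean_space \<Rightarrow> real"
  assumes [measurable]: "D \<in> borel_measurable borel" and \<nu>: "0 \<le> \<nu>"
  shows "(\<integral>\<^sup>+x. ennreal ((seg \<nu> d D x)\<^sup>2) \<partial>lborel) \<le> ennreal (\<nu>\<^sup>2) * (\<integral>\<^sup>+x. ennreal ((D x)\<^sup>2) \<partial>lborel)"
proof -
  let ?i = "\<lambda>t. indicator {0..\<nu>} t :: ennreal"
  have i: "(\<integral>\<^sup>+t. ?i t \<partial>lborel) = ennreal \<nu>" using \<nu> by simp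
  have pt: "ennreal ((seg \<nu> d D x)\<^sup>2) \<le> ennreal \<nu> * (\<integral>\<^sup>+t. ?i t * ennreal ((D (x + t *\<^sub>R d))\<^sup>2) \<partial>lborel)" for x
  proof -
    have "ennreal \<bar>seg \<nu> d D x\<bar> \<le> (\<integral>\<^sup>+t. ennreal (norm (indicator {0..\<nu>} t * D (x + t *\<^sub>R d))) \<partial>lborel)"
      unfolding seg_def real_norm_def[symmetric] by (rule norm_integral_le_nn_integral)
    \<comment> \<open>The indicator is its own square: one copy supplies the length, the other
      restricts the integrand.\<close>
    also have "\<dots> = (\<integral>\<^sup>+t. ?i t * (?i t * ennreal \<bar>D (x + t *\<^sub>R d)\<bar>) \<partial>lborel)"
      by (intro nn_integral_cong) (auto simp: indicator_def)
    finally have "(ennreal \<bar>seg \<nu> d D x\<bar>)\<^sup>2 \<le> (\<integral>\<^sup>+t. ?i t * (?i t * ennreal \<bar>D (x + t *\<^sub>R d)\<bar>) \<partial>lborel)\<^sup>2"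
      by (rule power_mono) simp
    also have "\<dots> \<le> (\<integral>\<^sup>+t. (?i t)\<^sup>2 \<partial>lborel) * (\<integral>\<^sup>+t. (?i t * ennreal \<bar>D (x + t *\<^sub>R d)\<bar>)\<^sup>2 \<partial>lborel)"
      by (rule Cauchy_Schwarz_nn_integral) measurable
    also have "(\<integral>\<^sup>+t. (?i t)\<^sup>2 \<partial>lborel) = (\<integral>\<^sup>+t. ?i t \<partial>lborel)"
      by (intro nn_integral_cong) (auto simp: indicator_def)
    also have "(\<integral>\<^sup>+t. (?i t * ennreal \<bar>D (x + t *\<^sub>R d)\<bar>)\<^sup>2 \<partial>lborel) = (\<integral>\<^sup>+t. ?i t * ennreal ((D (x + t *\<^sub>R d))\<^sup>2) \<partial>lborel)"
      by (intro nn_integral_cong) (auto simp: indicator_def ennreal_power)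
    finally show ?thesis unfolding i by (simp add: ennreal_power)
  qed
  have "(\<integral>\<^sup>+x. ennreal ((seg \<nu> d D x)\<^sup>2) \<partial>lborel) \<le> (\<integral>\<^sup>+x. ennreal \<nu> * (\<integral>\<^sup>+t. ?i t * ennreal ((D (x + t *\<^sub>R d))\<^sup>2) \<partial>lborel) \<partial>lborel)"
    by (intro nn_integral_mono pt)
  also have "\<dots> = ennreal \<nu> * (\<integral>\<^sup>+x. \<integral>\<^sup>+t. ?i t * ennreal ((D (x + t *\<^sub>R d))\<^sup>2) \<partial>lborel \<partial>lborel)"
    by (rule nn_integral_cmult) measurable
  also have "\<dots> = ennreal \<nu> * (\<integral>\<^sup>+t. \<integral>\<^sup>+x. ?i t * ennreal ((D (x + t *\<^sub>R d))\<^sup>2) \<partial>lborel \<partial>lborel)"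
    by (intro arg_cong2[of _ _ _ _ "(*)"] refl lborel_pair.Fubini'[symmetric]) measurable
  also have "\<dots> = ennreal \<nu> * (\<integral>\<^sup>+t. ?i t * (\<integral>\<^sup>+x. ennreal ((D x)\<^sup>2) \<partial>lborel) \<partial>lborel)"
  proof (intro arg_cong2[of _ _ _ _ "(*)"] refl nn_integral_cong)
    fix t
    have "(\<integral>\<^sup>+x. ?i t * ennreal ((D (x + t *\<^sub>R d))\<^sup>2) \<partial>lborel) = ?i t * (\<integral>\<^sup>+x. ennreal ((D (x + t *\<^sub>R d))\<^sup>2) \<partial>lborel)"
      by (rule nn_integral_cmult) measurable
    then show "(\<integral>\<^sup>+x. ?i t * ennreal ((D (x + t *\<^sub>R d))\<^sup>2) \<partial>lborel) = ?i t * (\<integral>\<^sup>+x. ennreal ((D x)\<^sup>2) \<partial>lborel)"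
      using nn_integral_lborel_shift[of "\<lambda>x. ennreal ((D x)\<^sup>2)" "t *\<^sub>R d"] by (simp add: add.commute)
  qed
  also have "\<dots> = ennreal \<nu> * (ennreal \<nu> * (\<integral>\<^sup>+x. ennreal ((D x)\<^sup>2) \<partial>lborel))"
    by (subst nn_integral_multc) (measurable, simp only: i)
  also have "\<dots> = ennreal (\<nu>\<^sup>2) * (\<integral>\<^sup>+x. ennreal ((D x)\<^sup>2) \<partial>lborel)"
    using \<nu> by (simp add: power2_eq_square ennreal_mult mult.assoc)
  finally show ?thesis .
qed

text \<open>Both operations are convolutions, one of them with a measure on a segment, and commute
  by Fubini. So the smoothing may be applied to \<open>f\<close> first.\<close>

lemma seg_conv:
  fixes K f :: "'a::euclidean_space \<Rightarrow> real"
  assumes K: "integrable lborel K" and [measurable]: "f \<in> borel_measurable borel" and M: "\<And>x. \<bar>f x\<bar> \<le> M"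
  shows "conv K (seg \<nu> d f) x = seg \<nu> d (conv K f) x"
proof -
  have [measurable]: "K \<in> borel_measurable borel" using K by auto
  have "conv K (seg \<nu> d f) x = (LINT z|lborel. LINT t|lborel. K z * (indicator {0..\<nu>} t * f (x - z + t *\<^sub>R d)))"
    unfolding conv_def seg_def by simp
  also have "\<dots> = (LINT t|lborel. LINT z|lborel. K z * (indicator {0..\<nu>} t * f (x - z + t *\<^sub>R d)))"
  proof (rule lborel_pair.Fubini_integral, rule integrable_lborel_pair_bound[OF _ integrable_indicator_segment integrable_mult_right[OF K, of M]])
    show "norm (K z * (indicator {0..\<nu>} t * f (x - z + t *\<^sub>R d))) \<le> norm (indicator {0..\<nu>} t :: real) * norm (M * K z)" for t z
    proof -
      have "\<bar>f (x - z + t *\<^sub>R d)\<bar> \<le> \<bar>M\<bar>" using M order_trans abs_ge_self by blast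
      then show ?thesis by (auto simp: indicator_def abs_mult mult.commute[of "\<bar>M\<bar>"] mult_left_mono)
    qed
  qed measurable
  also have "\<dots> = seg \<nu> d (conv K f) x"
    unfolding conv_def seg_def
  proof (intro Bochner_Integration.integral_cong refl)
    fix t
    have "K z * (indicator {0..\<nu>} t * f (x - z + t *\<^sub>R d)) = indicator {0..\<nu>} t * (K z * f (x + t *\<^sub>R d - z))" for z
      by (simp add: algebra_simps)
    then show "(LINT z|lborel. K z * (indicator {0..\<nu>} t * f (x - z + t *\<^sub>R d))) = indicator {0..\<nu>} t * (LINT z|lborel. K z * f (x + t *\<^sub>R d - z))"
      by (simp only: integral_mult_right_zero)
  qed
  finally show ?thesis .
qed

text \<open>The multiplier is the transform, at \<open>- \<xi>\<close>, of the measure on the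
  segment; \<open>norm_segment_multiplier_le\<close> bounds it by \<open>\<nu>\<close>.\<close>

lemma seg_fourier:
  fixes P :: "'a::euclidean_space \<Rightarrow> real" and p :: "'a \<Rightarrow> complex"
  assumes p: "integrable lborel p" and P: "\<And>x. of_real (P x) = (LINT \<xi>|lborel. cis (x \<bullet> \<xi>) * p \<xi>)"
    and [measurable]: "P \<in> borel_measurable borel"
  shows "of_real (seg \<nu> d P x) = (LINT \<xi>|lborel. cis (x \<bullet> \<xi>) * ((LINT t|lborel. of_real (indicator {0..\<nu>} t) * cis (t * (d \<bullet> \<xi>))) * p \<xi>))"
proof -
  have [measurable]: "p \<in> borel_measurable borel" using p by auto
  let ?i = "\<lambda>t. complex_of_real (indicator {0..\<nu>} t)"
  have "of_real (seg \<nu> d P x) = (LINT t|lborel. ?i t * of_real (P (x + t *\<^sub>R d)))"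
    unfolding seg_def integral_complex_of_real[symmetric] by simp
  also have "\<dots> = (LINT t|lborel. LINT \<xi>|lborel. ?i t * (cis ((x + t *\<^sub>R d) \<bullet> \<xi>) * p \<xi>))"
    unfolding P by simp
  also have "\<dots> = (LINT \<xi>|lborel. LINT t|lborel. ?i t * (cis ((x + t *\<^sub>R d) \<bullet> \<xi>) * p \<xi>))"
    by (rule lborel_pair.Fubini_integral[symmetric], rule integrable_lborel_pair_bound[OF _ integrable_indicator_segment p]) (auto simp: norm_mult)
  also have "\<dots> = (LINT \<xi>|lborel. LINT t|lborel. cis (x \<bullet> \<xi>) * ((?i t * cis (t * (d \<bullet> \<xi>))) * p \<xi>))"
    by (simp add: inner_add_left cis_mult[symmetric] ac_simps)
  also have "\<dots> = (LINT \<xi>|lborel. cis (x \<bullet> \<xi>) * ((LINT t|lborel. ?i t * cis (t * (d \<bullet> \<xi>))) * p \<xi>))"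
    by (simp only: integral_mult_right_zero integral_mult_left_zero)
  finally show ?thesis .
qed

lemma norm_segment_multiplier_le:
  assumes "0 \<le> \<nu>"
  shows "norm (LINT t|lborel. complex_of_real (indicator {0..\<nu>} t) * cis (t * u)) \<le> \<nu>"
proof -
  have "norm (LINT t|lborel. complex_of_real (indicator {0..\<nu>} t) * cis (t * u)) \<le> (LINT t|lborel. norm (complex_of_real (indicator {0..\<nu>} t) * cis (t * u)))"
    by (rule integral_norm_bound)
  also have "\<dots> = (LINT t|lborel. indicator {0..\<nu>} t)" by (simp add: norm_mult)
  finally show ?thesis using assms by simp
qed

section \<open>Sobolev regularity\<close>

lemma wnorm2_mono:
  assumes "\<And>\<xi>. bracket \<xi> powr s * (norm (p \<xi>))\<^sup>2 \<le> C * (bracket \<xi> powr r * (norm (q \<xi>))\<^sup>2)"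
    and "0 \<le> C" and [measurable]: "q \<in> borel_measurable borel" and "wnorm2 r q < \<infinity>"
  shows "wnorm2 s p < \<infinity>"
proof -
  have "wnorm2 s p \<le> (\<integral>\<^sup>+\<xi>. ennreal C * ennreal (bracket \<xi> powr r * (norm (q \<xi>))\<^sup>2) \<partial>lborel)"
    unfolding wnorm2_def using assms(1,2) by (intro nn_integral_mono) (simp add: ennreal_leI flip: ennreal_mult)
  also have "\<dots> = ennreal C * wnorm2 r q" unfolding wnorm2_def by (rule nn_integral_cmult) measurable
  also have "\<dots> < \<infinity>" using assms(4) by (simp add: ennreal_mult_less_top)
  finally show ?thesis .
qed

lemma integrable_wnorm2:
  fixes p :: "'a::euclidean_space \<Rightarrow> complex"
  assumes s: "real DIM('a) < 2 * s" and p [measurable]: "p \<in> borel_measurable borel" and fin: "wnorm2 s p < \<infinity>"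
  shows "integrable lborel p"
proof -
  have "bracket \<xi> powr (0 / 2) * norm (p \<xi>) = norm (p \<xi>)" for \<xi>
    using bracket_pos[of \<xi>] by simp
  then show ?thesis
    using nn_integral_bracket_norm_less_top[OF _ p fin, of 0] s by (simp only: integrable_iff_bounded) auto
qed

text \<open>A converse of \<open>weighted_fourier_less_top_of_differences\<close>, without loss: the
  squared multiplier is at most \<open>4 * norm h powr (2 * s) * bracket \<xi> powr s\<close>, and
  the reverse Bessel inequality, applied to the difference, returns to
  \<open>x\<close>-space.\<close>

lemma difference_L2_le_wnorm2:
  fixes H :: "'a::euclidean_space \<Rightarrow> complex"
  assumes H: "integrable lborel H" and c: "continuous_on UNIV H" and B: "\<And>x. norm (H x) \<le> B"
    and s: "0 \<le> s" "s \<le> 1" and fin: "wnorm2 s (fourier H) < \<infinity>"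
  obtains C where "0 \<le> C" "\<And>h. (\<integral>\<^sup>+x. ennreal ((norm (H (x + h) - H x))\<^sup>2) \<partial>lborel) \<le> ennreal (C * norm h powr (2 * s))"
proof -
  have [measurable]: "H \<in> borel_measurable borel" using H by auto
  let ?P = "(2 * pi) ^ DIM('a)"
  have P: "1 \<le> ?P" using pi_gt3 by (intro one_le_power) linarith
  define N where "N = enn2real (wnorm2 s (fourier H))"
  have N: "ennreal N = wnorm2 s (fourier H)" "0 \<le> N" unfolding N_def using fin by (auto simp: less_top)
  have "(\<integral>\<^sup>+x. ennreal ((norm (H (x + h) - H x))\<^sup>2) \<partial>lborel) \<le> ennreal ((4 * N) * norm h powr (2 * s))" for h
  proof -
    let ?D = "\<lambda>x. H (x + h) - H x"
    let ?I = "\<integral>\<^sup>+x. ennreal ((norm (?D x))\<^sup>2) \<partial>lborel"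
    have "?I = ennreal 1 * ?I" by simp
    \<comment> \<open>The constant is at least 1, so it is absorbed at no cost.\<close>
    also have "\<dots> \<le> ennreal ?P * ?I" using P by (intro mult_right_mono ennreal_leI) auto
    also have "\<dots> \<le> (\<integral>\<^sup>+\<xi>. ennreal ((norm (fourier ?D \<xi>))\<^sup>2) \<partial>lborel)"
    proof (rule bessel_inequality_reverse)
      show "integrable lborel ?D" by (intro Bochner_Integration.integrable_diff integrable_lborel_shift H)
      show "continuous_on UNIV ?D"
        by (intro continuous_intros c continuous_on_compose2[OF c]) auto
      show "norm (?D x) \<le> B + B" for x by (intro order_trans[OF norm_triangle_ineq4] add_mono B)
    qed
    also have "\<dots> \<le> (\<integral>\<^sup>+\<xi>. ennreal (4 * norm h powr (2 * s)) * ennreal (bracket \<xi> powr s * (norm (fourier H \<xi>))\<^sup>2) \<partial>lborel)"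
    proof (intro nn_integral_mono)
      fix \<xi> :: 'a
      have "(norm (cis (h \<bullet> \<xi>) - 1))\<^sup>2 \<le> 4 * \<bar>h \<bullet> \<xi>\<bar> powr (2 * s)" by (rule norm_cis_minus_1_upper[OF s])
      also have "\<dots> \<le> 4 * (norm h * norm \<xi>) powr (2 * s)"
        using s by (intro mult_left_mono powr_mono2 Cauchy_Schwarz_ineq2) auto
      also have "\<dots> = 4 * norm h powr (2 * s) * norm \<xi> powr (2 * s)" by (simp add: powr_mult)
      also have "\<dots> \<le> 4 * norm h powr (2 * s) * bracket \<xi> powr s"
      proof (intro mult_left_mono)
        have "norm \<xi> powr (2 * s) = ((norm \<xi>)\<^sup>2) powr s"
          by (cases "\<xi> = 0") (auto simp: powr_powr powr_numeral[symmetric] simp del: powr_numeral)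
        also have "\<dots> \<le> bracket \<xi> powr s" using s by (intro powr_mono2) auto
        finally show "norm \<xi> powr (2 * s) \<le> bracket \<xi> powr s" .
      qed simp
      finally have "(norm (cis (h \<bullet> \<xi>) - 1))\<^sup>2 * (norm (fourier H \<xi>))\<^sup>2 \<le> 4 * norm h powr (2 * s) * bracket \<xi> powr s * (norm (fourier H \<xi>))\<^sup>2"
        by (rule mult_right_mono) simp
      then show "ennreal ((norm (fourier ?D \<xi>))\<^sup>2) \<le> ennreal (4 * norm h powr (2 * s)) * ennreal (bracket \<xi> powr s * (norm (fourier H \<xi>))\<^sup>2)"
        unfolding fourier_difference[OF H] by (simp add: norm_mult power_mult_distrib ennreal_leI mult.assoc flip: ennreal_mult)
    qed
    also have "\<dots> = ennreal (4 * norm h powr (2 * s)) * wnorm2 s (fourier H)"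
      unfolding wnorm2_def by (rule nn_integral_cmult) measurable
    also have "\<dots> = ennreal ((4 * N) * norm h powr (2 * s))"
      unfolding N(1)[symmetric] using N(2) by (simp add: mult.commute mult.left_commute flip: ennreal_mult)
    finally show ?thesis .
  qed
  then show thesis using N(2) by (intro that[of "4 * N"]) auto
qed

text \<open>At scale \<open>\<delta>\<close> there are at most \<open>C / \<delta>\<close> discs of
  area O(\<open>\<delta>\<close>^2), so the total area is O(\<open>\<delta>\<close>).\<close>

lemma linearly_covered_null:
  fixes S :: "(real^2) set"
  assumes S: "linearly_covered S" "S \<in> sets borel"
  shows "S \<in> null_sets lborel"
proof -
  obtain C where C: "\<And>\<delta>. 0 < \<delta> \<Longrightarrow> \<delta> \<le> 1 \<Longrightarrow> \<exists>F. finite F \<and> real (card F) * \<delta> \<le> C \<and> S \<subseteq> (\<Union>z\<in>F. cball z \<delta>)"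
    using S(1) unfolding linearly_covered_def by blast
  let ?V = "unit_ball_vol 2"
  have "emeasure lborel S \<le> ennreal (?V * C * (1 / real (Suc n)))" for n
  proof -
    let ?d = "1 / real (Suc n)"
    have d: "0 < ?d" "?d \<le> 1" by auto
    obtain F where F: "finite F" "real (card F) * ?d \<le> C" "S \<subseteq> (\<Union>z\<in>F. cball z ?d)" using C[OF d] by blast
    have "emeasure lborel S \<le> emeasure lborel (\<Union>z\<in>F. cball z ?d)" using F by (intro emeasure_mono) auto
    also have "\<dots> \<le> (\<Sum>z\<in>F. emeasure lborel (cball z ?d))" using F by (intro emeasure_subadditive_finite) auto
    also have "\<dots> = (\<Sum>z\<in>F. ennreal (?V * ?d\<^sup>2))"
      using emeasure_cball[of ?d, where 'a="real^2"] d by (intro sum.cong refl) (simp del: of_nat_Suc)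
    also have "\<dots> = ennreal (\<Sum>z\<in>F. ?V * ?d\<^sup>2)" by (intro sum_ennreal) simp
    also have "\<dots> = ennreal (?V * (real (card F) * ?d) * ?d)"
      by (simp add: power2_eq_square ac_simps del: of_nat_Suc)
    also have "\<dots> \<le> ennreal (?V * C * ?d)"
      using F d by (intro ennreal_leI mult_right_mono mult_left_mono) auto
    finally show ?thesis .
  qed
  moreover have "(\<lambda>n. ennreal (?V * C * (1 / real (Suc n)))) \<longlonglongrightarrow> ennreal (?V * C * 0)"
    by (intro tendsto_ennrealI tendsto_mult tendsto_const LIMSEQ_inverse_Suc)
  ultimately have "emeasure lborel S \<le> ennreal (?V * C * 0)"
    by (intro LIMSEQ_le_const) auto
  then show ?thesis using S(2) by (simp add: null_sets_def)
qed

text \<open>From \<open>1 - exp (- d) \<le> d\<close>. The restriction to nonnegative arguments is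
  where the sign of \<open>F\<close> enters.\<close>

lemma abs_exp_minus_diff_le:
  fixes p q :: real
  assumes "0 \<le> p" "0 \<le> q"
  shows "\<bar>exp (- p) - exp (- q)\<bar> \<le> \<bar>p - q\<bar>"
proof -
  have *: "\<bar>exp (- p) - exp (- q)\<bar> \<le> q - p" if "0 \<le> p" "p \<le> q" for p q :: real
  proof -
    have "exp (- p) - exp (- q) = exp (- p) * (1 - exp (- (q - p)))"
      by (simp add: right_diff_distrib exp_add[symmetric])
    also have "\<dots> \<le> 1 * (q - p)"
    proof (rule mult_mono)
      show "1 - exp (- (q - p)) \<le> q - p" using exp_ge_add_one_self[of "- (q - p)"] by linarith
    qed (use that in auto)
    finally show ?thesis using that by simp
  qed
  show ?thesis using *[of p q] *[of q p] assms by (cases "p \<le> q") (auto simp: abs_minus_commute)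
qed

lemma nn_integral_linear_combination:
  assumes "f \<in> borel_measurable M" "g \<in> borel_measurable M"
  shows "(\<integral>\<^sup>+x. c * f x + d * g x \<partial>M) = c * integral\<^sup>N M f + d * integral\<^sup>N M g"
  using assms by (subst nn_integral_add) (auto simp: nn_integral_cmult)

text \<open>Difference bounds of order \<open>s\<close> pass from \<open>P\<close> to
  \<open>F\<close> by \<open>seg_L2\<close>, and from \<open>F\<close> to the product by the
  Lipschitz bound for the exponential. The return to the Fourier side costs the gap
  \<open>t < s\<close>.\<close>

lemma weighted_fourier_less_top_of_exp:
  fixes \<eta> :: "'a::euclidean_space \<Rightarrow> complex" and P :: "'a \<Rightarrow> real"
  assumes \<eta>: "test_function \<eta>"
    and P: "integrable lborel P" "continuous_on UNIV P" "\<And>x. 0 \<le> P x" "\<And>x. P x \<le> M"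
    and s: "0 \<le> s" "s \<le> 1" and fin: "wnorm2 s (fourier (\<lambda>x. of_real (P x))) < \<infinity>"
    and F: "\<And>x. F x = a * seg \<nu> d\<^sub>1 P x + b * seg \<nu> d\<^sub>2 P x" and ab: "0 \<le> a" "0 \<le> b" and \<nu>: "0 \<le> \<nu>"
    and t: "0 \<le> t" "t < s"
  shows "wnorm2 t (fourier (\<lambda>x. \<eta> x * of_real (exp (- F x)))) < \<infinity>"
proof -
  have \<eta>m [measurable]: "\<eta> \<in> borel_measurable borel" by (rule test_function_borel_measurable[OF \<eta>])
  have \<eta>i: "integrable lborel \<eta>" by (rule test_function_integrable[OF \<eta>])
  have \<eta>c: "continuous_on UNIV \<eta>" using \<eta> by (auto simp: test_function_def intro: smooth_on_continuous)
  have Pm [measurable]: "P \<in> borel_measurable borel" using P(1) by auto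
  have F': "F = (\<lambda>x. a * seg \<nu> d\<^sub>1 P x + b * seg \<nu> d\<^sub>2 P x)" using F by auto
  have Fm [measurable]: "F \<in> borel_measurable borel" unfolding F' by measurable
  have F0: "0 \<le> F x" for x unfolding F using ab by (intro add_nonneg_nonneg mult_nonneg_nonneg seg_nonneg P)
  have Pb: "\<bar>P x\<bar> \<le> M" for x using P by simp
  obtain B where B: "0 < B" "\<And>x. norm (\<eta> x) \<le> B" using test_function_bounded[OF \<eta>] by blast
  obtain C\<^sub>1 where C1: "0 \<le> C\<^sub>1" "\<And>h. (\<integral>\<^sup>+x. ennreal ((norm (\<eta> (x + h) - \<eta> x))\<^sup>2) \<partial>lborel) \<le> ennreal (C\<^sub>1 * norm h powr (2 * s))"
    using difference_L2_le_wnorm2[OF \<eta>i \<eta>c B(2) s] test_function_weighted_fourier_less_top[OF \<eta>, of s] by blast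
  obtain C\<^sub>2 where C2: "0 \<le> C\<^sub>2" "\<And>h. (\<integral>\<^sup>+x. ennreal ((norm (complex_of_real (P (x + h)) - of_real (P x)))\<^sup>2) \<partial>lborel) \<le> ennreal (C\<^sub>2 * norm h powr (2 * s))"
  proof (rule difference_L2_le_wnorm2[OF _ _ _ s fin])
    show "integrable lborel (\<lambda>x. complex_of_real (P x))" using P(1) by (rule integrable_of_real)
    show "continuous_on UNIV (\<lambda>x. complex_of_real (P x))" using P(2) by (intro continuous_intros)
    show "norm (complex_of_real (P x)) \<le> M" for x using Pb by simp
  qed blast
  let ?D = "\<lambda>h x. P (x + h) - P x"
  have D2: "(\<integral>\<^sup>+x. ennreal ((?D h x)\<^sup>2) \<partial>lborel) \<le> ennreal (C\<^sub>2 * norm h powr (2 * s))" for h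
    using C2(2)[of h] unfolding of_real_diff[symmetric] norm_of_real power2_abs .
  have FD: "(\<integral>\<^sup>+x. ennreal ((F (x + h) - F x)\<^sup>2) \<partial>lborel) \<le> ennreal ((2 * a\<^sup>2 + 2 * b\<^sup>2) * \<nu>\<^sup>2 * C\<^sub>2 * norm h powr (2 * s))" for h
  proof -
    let ?X = "seg \<nu> d\<^sub>1 (?D h)" and ?Y = "seg \<nu> d\<^sub>2 (?D h)"
    have Dm: "?D h \<in> borel_measurable borel" by measurable
    have [measurable]: "?X \<in> borel_measurable borel" "?Y \<in> borel_measurable borel" by measurable
    have "(F (x + h) - F x)\<^sup>2 \<le> 2 * a\<^sup>2 * (?X x)\<^sup>2 + 2 * b\<^sup>2 * (?Y x)\<^sup>2" for x
    proof -
      have "F (x + h) - F x = a * ?X x + b * ?Y x"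
        unfolding F seg_difference[OF Pm Pb] by (simp add: algebra_simps)
      moreover have "(a * ?X x + b * ?Y x)\<^sup>2 \<le> 2 * (a * ?X x)\<^sup>2 + 2 * (b * ?Y x)\<^sup>2"
        using sum_squares_bound[of "a * ?X x" "b * ?Y x"] by (simp add: power2_sum)
      ultimately show ?thesis by (simp add: power_mult_distrib)
    qed
    then have "(\<integral>\<^sup>+x. ennreal ((F (x + h) - F x)\<^sup>2) \<partial>lborel) \<le>
        (\<integral>\<^sup>+x. ennreal (2 * a\<^sup>2) * ennreal ((?X x)\<^sup>2) + ennreal (2 * b\<^sup>2) * ennreal ((?Y x)\<^sup>2) \<partial>lborel)"
      by (intro nn_integral_mono) (simp add: ennreal_leI flip: ennreal_mult ennreal_plus)
    also have "\<dots> = ennreal (2 * a\<^sup>2) * (\<integral>\<^sup>+x. ennreal ((?X x)\<^sup>2) \<partial>lborel) + ennreal (2 * b\<^sup>2) * (\<integral>\<^sup>+x. ennreal ((?Y x)\<^sup>2) \<partial>lborel)"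
      by (rule nn_integral_linear_combination) measurable
    also have "\<dots> \<le> ennreal (2 * a\<^sup>2) * (ennreal (\<nu>\<^sup>2) * ennreal (C\<^sub>2 * norm h powr (2 * s))) + ennreal (2 * b\<^sup>2) * (ennreal (\<nu>\<^sup>2) * ennreal (C\<^sub>2 * norm h powr (2 * s)))"
      by (intro add_mono mult_left_mono order_trans[OF seg_L2[OF Dm \<nu>]] D2) simp_all
    also have "\<dots> = ennreal ((2 * a\<^sup>2 + 2 * b\<^sup>2) * \<nu>\<^sup>2 * C\<^sub>2 * norm h powr (2 * s))"
      using C2(1) by (simp add: algebra_simps flip: ennreal_mult ennreal_plus)
    finally show ?thesis .
  qed
  let ?G = "\<lambda>x. \<eta> x * of_real (exp (- F x))"
  have Gle: "norm (?G x) \<le> norm (\<eta> x)" for x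
    unfolding norm_mult norm_of_real using F0[of x] by (intro mult_left_le) auto
  have Gi: "integrable lborel ?G"
    by (rule Bochner_Integration.integrable_bound[OF \<eta>i]) (measurable, use Gle in auto)
  \<comment> \<open>The factors 2 come from \<open>(p + q)^2 \<le> 2 p^2 + 2 q^2\<close>, used for
    the product rule below and, inside, for the two segments of \<open>F\<close>.\<close>
  define C where "C = 2 * C\<^sub>1 + 2 * B\<^sup>2 * ((2 * a\<^sup>2 + 2 * b\<^sup>2) * \<nu>\<^sup>2 * C\<^sub>2)"
  have C: "0 \<le> C" using C1(1) C2(1) by (simp add: C_def)
  have GD: "(\<integral>\<^sup>+x. ennreal ((norm (?G (x + h) - ?G x))\<^sup>2) \<partial>lborel) \<le> ennreal (C * norm h powr (2 * s))" for h
  proof -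
    have "(norm (?G (x + h) - ?G x))\<^sup>2 \<le> 2 * (norm (\<eta> (x + h) - \<eta> x))\<^sup>2 + 2 * B\<^sup>2 * (F (x + h) - F x)\<^sup>2" for x
    proof -
      \<comment> \<open>Discrete product rule: the exponential at the shifted point is at most 1,
        the cutoff at \<open>x\<close> at most \<open>B\<close>.\<close>
      have "?G (x + h) - ?G x = (\<eta> (x + h) - \<eta> x) * of_real (exp (- F (x + h))) + \<eta> x * of_real (exp (- F (x + h)) - exp (- F x))"
        by (simp add: algebra_simps)
      then have "norm (?G (x + h) - ?G x) \<le> norm (\<eta> (x + h) - \<eta> x) * exp (- F (x + h)) + norm (\<eta> x) * \<bar>exp (- F (x + h)) - exp (- F x)\<bar>"
        using norm_triangle_ineq[of "(\<eta> (x + h) - \<eta> x) * of_real (exp (- F (x + h)))" "\<eta> x * of_real (exp (- F (x + h)) - exp (- F x))"]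
        by (simp only: norm_mult norm_of_real abs_exp_cancel)
      also have "\<dots> \<le> norm (\<eta> (x + h) - \<eta> x) + B * \<bar>F (x + h) - F x\<bar>"
        using F0 B by (intro add_mono mult_mono mult_left_le abs_exp_minus_diff_le) (auto simp: less_imp_le)
      finally have "(norm (?G (x + h) - ?G x))\<^sup>2 \<le> (norm (\<eta> (x + h) - \<eta> x) + B * \<bar>F (x + h) - F x\<bar>)\<^sup>2"
        by (rule power_mono) simp
      also have "\<dots> \<le> 2 * (norm (\<eta> (x + h) - \<eta> x))\<^sup>2 + 2 * (B * \<bar>F (x + h) - F x\<bar>)\<^sup>2"
        using sum_squares_bound[of "norm (\<eta> (x + h) - \<eta> x)" "B * \<bar>F (x + h) - F x\<bar>"] by (simp add: power2_sum)
      finally show ?thesis by (simp add: power_mult_distrib)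
    qed
    then have "(\<integral>\<^sup>+x. ennreal ((norm (?G (x + h) - ?G x))\<^sup>2) \<partial>lborel) \<le>
        (\<integral>\<^sup>+x. ennreal 2 * ennreal ((norm (\<eta> (x + h) - \<eta> x))\<^sup>2) + ennreal (2 * B\<^sup>2) * ennreal ((F (x + h) - F x)\<^sup>2) \<partial>lborel)"
      by (intro nn_integral_mono) (simp only: ennreal_leI zero_le_power2 mult_nonneg_nonneg zero_le_numeral flip: ennreal_mult ennreal_plus)
    also have "\<dots> = ennreal 2 * (\<integral>\<^sup>+x. ennreal ((norm (\<eta> (x + h) - \<eta> x))\<^sup>2) \<partial>lborel) + ennreal (2 * B\<^sup>2) * (\<integral>\<^sup>+x. ennreal ((F (x + h) - F x)\<^sup>2) \<partial>lborel)"
      by (rule nn_integral_linear_combination) measurable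
    also have "\<dots> \<le> ennreal 2 * ennreal (C\<^sub>1 * norm h powr (2 * s)) + ennreal (2 * B\<^sup>2) * ennreal ((2 * a\<^sup>2 + 2 * b\<^sup>2) * \<nu>\<^sup>2 * C\<^sub>2 * norm h powr (2 * s))"
      by (intro add_mono mult_left_mono C1 FD) auto
    also have "\<dots> = ennreal (2 * (C\<^sub>1 * norm h powr (2 * s)) + 2 * B\<^sup>2 * ((2 * a\<^sup>2 + 2 * b\<^sup>2) * \<nu>\<^sup>2 * C\<^sub>2 * norm h powr (2 * s)))"
      using C1(1) C2(1) by (subst ennreal_plus) (simp_all add: ennreal_mult)
    also have "2 * (C\<^sub>1 * norm h powr (2 * s)) + 2 * B\<^sup>2 * ((2 * a\<^sup>2 + 2 * b\<^sup>2) * \<nu>\<^sup>2 * C\<^sub>2 * norm h powr (2 * s)) = C * norm h powr (2 * s)"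
      by (simp add: C_def algebra_simps)
    finally show ?thesis .
  qed
  show ?thesis
  proof (rule weighted_fourier_less_top_of_differences[OF Gi _ _ t C])
    show "(\<integral>\<^sup>+x. ennreal ((norm (?G (x + \<tau> *\<^sub>R e) - ?G x))\<^sup>2) \<partial>lborel) \<le> ennreal (C * \<tau> powr (2 * s))"
      if "e \<in> Basis" "0 < \<tau>" for e \<tau>
      using GD[of "\<tau> *\<^sub>R e"] that by simp
    have "(norm (?G x))\<^sup>2 \<le> B * norm (\<eta> x)" for x
      unfolding power2_eq_square using Gle[of x] B(2)[of x] B(1) by (intro mult_mono) (auto intro: order_trans)
    then have "(\<integral>\<^sup>+x. ennreal ((norm (?G x))\<^sup>2) \<partial>lborel) \<le> (\<integral>\<^sup>+x. ennreal (norm (B *\<^sub>R \<eta> x)) \<partial>lborel)"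
      using B(1) by (intro nn_integral_mono) (simp add: ennreal_leI)
    also have "\<dots> < \<infinity>" using integrable_scaleR_right[OF \<eta>i, of B] unfolding integrable_iff_bounded by blast
    finally show "(\<integral>\<^sup>+x. ennreal ((norm (?G x))\<^sup>2) \<partial>lborel) < \<infinity>" .
  qed
qed

text \<open>Above half the dimension the transform of \<open>P\<close> is integrable, so inversion
  represents \<open>P\<close>, and then \<open>F\<close>, as inverse transforms; the segments
  multiply the density by a function bounded by \<open>(a + b) * \<nu>\<close>. The exponential
  series then keeps the order \<open>s\<close>.\<close>

lemma wnorm2_exp_of_large_order:
  fixes \<eta> :: "'a::euclidean_space \<Rightarrow> complex" and P :: "'a \<Rightarrow> real"
  assumes \<eta>: "test_function \<eta>"
    and P: "integrable lborel P" "continuous_on UNIV P" "\<And>x. 0 \<le> P x" "\<And>x. P x \<le> M"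
    and s: "real DIM('a) < 2 * s" and fin: "wnorm2 s (fourier (\<lambda>x. of_real (P x))) < \<infinity>"
    and F: "\<And>x. F x = a * seg \<nu> d\<^sub>1 P x + b * seg \<nu> d\<^sub>2 P x" and ab: "0 \<le> a" "0 \<le> b" and \<nu>: "0 \<le> \<nu>"
  shows "wnorm2 s (fourier (\<lambda>x. \<eta> x * of_real (exp (- F x)))) < \<infinity>"
proof -
  have Pm [measurable]: "P \<in> borel_measurable borel" using P(1) by auto
  have F': "F = (\<lambda>x. a * seg \<nu> d\<^sub>1 P x + b * seg \<nu> d\<^sub>2 P x)" using F by auto
  have Fm [measurable]: "F \<in> borel_measurable borel" unfolding F' by measurable
  have Pc: "integrable lborel (\<lambda>x. complex_of_real (P x))" using P(1) by (rule integrable_of_real)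
  let ?c = "(2 * pi) ^ DIM('a)"
  \<comment> \<open>Normalised so that inversion reads without a constant.\<close>
  define p where "p \<xi> = fourier (\<lambda>x. of_real (P x)) \<xi> / of_real ?c" for \<xi>
  have Fourm: "fourier (\<lambda>x. complex_of_real (P x)) \<in> borel_measurable borel"
    using fourier_measurable[of "\<lambda>x. complex_of_real (P x)" "\<lambda>x. x" borel] by simp
  have fi: "integrable lborel (fourier (\<lambda>x. complex_of_real (P x)))"
    by (rule integrable_wnorm2[OF s Fourm fin])
  then have pi: "integrable lborel p" unfolding p_def by simp
  then have [measurable]: "p \<in> borel_measurable borel" by auto
  have P_eq: "of_real (P x) = (LINT \<xi>|lborel. cis (x \<bullet> \<xi>) * p \<xi>)" for x
  proof -
    have "(LINT \<xi>|lborel. cis (x \<bullet> \<xi>) * fourier (\<lambda>x. complex_of_real (P x)) \<xi>) = of_real ?c * of_real (P x)"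
      by (rule fourier_inversion[OF Pc _ _ fi, of M]) (use P in \<open>auto intro: continuous_intros\<close>)
    then show ?thesis unfolding p_def by (simp only: times_divide_eq_right integral_divide_zero) simp
  qed
  let ?m = "\<lambda>d \<xi>. LINT \<tau>|lborel. complex_of_real (indicator {0..\<nu>} \<tau>) * cis (\<tau> * (d \<bullet> \<xi>))"
  let ?q = "\<lambda>\<xi>. (of_real a * ?m d\<^sub>1 \<xi> + of_real b * ?m d\<^sub>2 \<xi>) * p \<xi>"
  have mm [measurable]: "?m d \<in> borel_measurable borel" for d :: 'a by measurable
  have m: "norm (?m d \<xi>) \<le> \<nu>" for d \<xi> :: 'a by (rule norm_segment_multiplier_le[OF \<nu>])
  have qp: "norm (?q \<xi>) \<le> ((a + b) * \<nu>) * norm (p \<xi>)" for \<xi>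
  proof -
    have "norm (of_real a * ?m d\<^sub>1 \<xi> + of_real b * ?m d\<^sub>2 \<xi>) \<le> norm (of_real a * ?m d\<^sub>1 \<xi>) + norm (of_real b * ?m d\<^sub>2 \<xi>)" by (rule norm_triangle_ineq)
    also have "\<dots> \<le> a * \<nu> + b * \<nu>" unfolding norm_mult norm_of_real using ab m by (intro add_mono mult_mono) auto
    finally show ?thesis unfolding norm_mult[of _ "p \<xi>"] by (intro mult_right_mono) (simp_all add: distrib_right)
  qed
  have mpi: "integrable lborel (\<lambda>\<xi>. ?m d \<xi> * p \<xi>)" for d
    by (rule Bochner_Integration.integrable_bound[OF integrable_scaleR_right[OF pi, of \<nu>]])
       (measurable, use m \<nu> in \<open>auto simp: norm_mult intro!: AE_I2 mult_right_mono\<close>)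
  have qi: "integrable lborel ?q"
    using Bochner_Integration.integrable_add[OF integrable_mult_right[OF mpi, of "of_real a" d\<^sub>1] integrable_mult_right[OF mpi, of "of_real b" d\<^sub>2]]
    by (simp add: distrib_right mult.assoc)
  have F_eq: "of_real (F x) = (LINT \<xi>|lborel. cis (x \<bullet> \<xi>) * ?q \<xi>)" for x
  proof -
    have "of_real (F x) = of_real a * (LINT \<xi>|lborel. cis (x \<bullet> \<xi>) * (?m d\<^sub>1 \<xi> * p \<xi>)) + of_real b * (LINT \<xi>|lborel. cis (x \<bullet> \<xi>) * (?m d\<^sub>2 \<xi> * p \<xi>))"
      unfolding F of_real_add of_real_mult seg_fourier[OF pi P_eq Pm] ..
    also have "\<dots> = (LINT \<xi>|lborel. of_real a * (cis (x \<bullet> \<xi>) * (?m d\<^sub>1 \<xi> * p \<xi>)) + of_real b * (cis (x \<bullet> \<xi>) * (?m d\<^sub>2 \<xi> * p \<xi>)))"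
      by (subst Bochner_Integration.integral_add) (auto intro!: integrable_mult_right integrable_cis_mult mpi)
    also have "\<dots> = (LINT \<xi>|lborel. cis (x \<bullet> \<xi>) * ?q \<xi>)"
      by (intro Bochner_Integration.integral_cong refl) (simp add: algebra_simps)
    finally show ?thesis .
  qed
  have q2: "wnorm2 s ?q < \<infinity>"
  proof (rule wnorm2_mono[OF _ _ Fourm fin, where C="((a + b) * \<nu> / ?c)\<^sup>2"])
    fix \<xi> :: 'a
    have c0: "0 < ?c" by simp
    have "norm (p \<xi>) = norm (fourier (\<lambda>x. complex_of_real (P x)) \<xi>) / ?c"
      unfolding p_def norm_divide norm_of_real using c0 by (simp only: abs_of_pos)
    then have "norm (?q \<xi>) \<le> ((a + b) * \<nu> / ?c) * norm (fourier (\<lambda>x. complex_of_real (P x)) \<xi>)"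
      using qp[of \<xi>] by (simp only: times_divide_eq_left times_divide_eq_right)
    then have "(norm (?q \<xi>))\<^sup>2 \<le> (((a + b) * \<nu> / ?c) * norm (fourier (\<lambda>x. complex_of_real (P x)) \<xi>))\<^sup>2" by (rule power_mono) simp
    then have "(norm (?q \<xi>))\<^sup>2 \<le> ((a + b) * \<nu> / ?c)\<^sup>2 * (norm (fourier (\<lambda>x. complex_of_real (P x)) \<xi>))\<^sup>2" by (simp only: power_mult_distrib)
    then have "bracket \<xi> powr s * (norm (?q \<xi>))\<^sup>2 \<le> bracket \<xi> powr s * (((a + b) * \<nu> / ?c)\<^sup>2 * (norm (fourier (\<lambda>x. complex_of_real (P x)) \<xi>))\<^sup>2)"
      by (rule mult_left_mono) simp
    then show "bracket \<xi> powr s * (norm (?q \<xi>))\<^sup>2 \<le> ((a + b) * \<nu> / ?c)\<^sup>2 * (bracket \<xi> powr s * (norm (fourier (\<lambda>x. complex_of_real (P x)) \<xi>))\<^sup>2)"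
      by (simp only: mult.left_commute)
  qed simp
  have Fb: "\<bar>F x\<bar> \<le> a * (M * \<nu>) + b * (M * \<nu>)" for x
  proof -
    have "0 \<le> F x" unfolding F using ab by (intro add_nonneg_nonneg mult_nonneg_nonneg seg_nonneg P)
    moreover have "F x \<le> a * (M * \<nu>) + b * (M * \<nu>)"
      unfolding F using ab by (intro add_mono mult_left_mono seg_le[OF Pm P(3,4) \<nu>])
    ultimately show ?thesis by simp
  qed
  have \<eta>2: "wnorm2 s (fourier \<eta>) < \<infinity>" by (rule test_function_weighted_fourier_less_top[OF \<eta>])
  show ?thesis by (rule fourier_exp_wnorm2[OF s test_function_integrable[OF \<eta>] \<eta>2 qi q2 F_eq Fm Fb])
qed

lemma smoothed_exp_regularity:
  fixes \<eta> :: "'a::euclidean_space \<Rightarrow> complex" and K f :: "'a \<Rightarrow> real"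
  assumes dim: "DIM('a) \<le> 2" and \<eta>: "test_function \<eta>"
    and K: "integrable lborel K" "\<And>x. 0 \<le> K x"
    and KC: "\<And>\<xi>. norm (fourier (\<lambda>x. of_real (K x)) \<xi>) \<le> C * bracket \<xi> powr (- l / 2)" and l: "0 \<le> l"
    and f: "integrable lborel f" "\<And>x. 0 \<le> f x" "\<And>x. f x \<le> M" "AE x in lborel. isCont f x"
    and fw: "\<And>r. 0 \<le> r \<Longrightarrow> r < 1 / 2 \<Longrightarrow> wnorm2 r (fourier (\<lambda>x. of_real (f x))) < \<infinity>"
    and F: "\<And>x. F x = a * seg \<nu> d\<^sub>1 (conv K f) x + b * seg \<nu> d\<^sub>2 (conv K f) x" and ab: "0 \<le> a" "0 \<le> b" and \<nu>: "0 \<le> \<nu>"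
    and \<alpha>: "\<alpha> < 1 / 2"
  shows "\<exists>t>\<alpha> + l. wnorm2 t (fourier (\<lambda>x. \<eta> x * of_real (exp (- F x)))) < \<infinity>"
proof -
  have Km: "K \<in> borel_measurable borel" and fm: "f \<in> borel_measurable borel" using K f by auto
  have fb: "\<bar>f x\<bar> \<le> M" for x using f(2,3) by simp
  note P = integrable_conv[OF K(1) f(1)] continuous_conv[OF K(1) fm fb f(4)] conv_bounds[OF K fm f(2,3)]
  have Ff: "fourier (\<lambda>x. complex_of_real (f x)) \<in> borel_measurable borel"
    using fourier_measurable[of "\<lambda>x. complex_of_real (f x)" "\<lambda>x. x" borel] fm by simp
  \<comment> \<open>The squared kernel bound \<open>C^2 * bracket powr (- l)\<close> is compensated
    exactly by raising the order by \<open>l\<close>.\<close>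
  have Pw: "wnorm2 (r + l) (fourier (\<lambda>x. of_real (conv K f x))) < \<infinity>" if r: "0 \<le> r" "r < 1 / 2" for r
  proof (rule wnorm2_mono[OF _ _ Ff fw[OF r], where C="C\<^sup>2"])
    fix \<xi> :: 'a
    let ?w = "bracket \<xi>"
    have "(norm (fourier (\<lambda>x. of_real (K x)) \<xi>))\<^sup>2 \<le> (C * ?w powr (- l / 2))\<^sup>2" by (intro power_mono KC) simp
    also have "\<dots> = C\<^sup>2 * ?w powr (- l)"
      unfolding power_mult_distrib power2_eq_square[of "?w powr _"] powr_add[symmetric] by simp
    finally have le: "(norm (fourier (\<lambda>x. of_real (K x)) \<xi>))\<^sup>2 \<le> C\<^sup>2 * ?w powr (- l)" .
    have "?w powr (r + l) * (norm (fourier (\<lambda>x. of_real (conv K f x)) \<xi>))\<^sup>2 =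
        ?w powr (r + l) * ((norm (fourier (\<lambda>x. of_real (K x)) \<xi>))\<^sup>2 * (norm (fourier (\<lambda>x. of_real (f x)) \<xi>))\<^sup>2)"
      by (simp only: fourier_conv[OF K(1) f(1)] norm_mult power_mult_distrib)
    also have "\<dots> \<le> ?w powr (r + l) * ((C\<^sup>2 * ?w powr (- l)) * (norm (fourier (\<lambda>x. of_real (f x)) \<xi>))\<^sup>2)"
      using le by (intro mult_left_mono mult_right_mono) auto
    also have "\<dots> = C\<^sup>2 * ((?w powr (r + l) * ?w powr (- l)) * (norm (fourier (\<lambda>x. of_real (f x)) \<xi>))\<^sup>2)"
      by (simp only: ac_simps)
    also have "?w powr (r + l) * ?w powr (- l) = ?w powr r" by (simp add: powr_add[symmetric])
    finally show "?w powr (r + l) * (norm (fourier (\<lambda>x. of_real (conv K f x)) \<xi>))\<^sup>2 \<le>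
        C\<^sup>2 * (?w powr r * (norm (fourier (\<lambda>x. of_real (f x)) \<xi>))\<^sup>2)" .
  qed simp
  \<comment> \<open>\<open>\<alpha>\<close> may be negative, hence \<open>m\<close>;
    \<open>c\<close> lies strictly between \<open>m\<close> and 1/2. If \<open>c + l < 1\<close>,
    the interval from \<open>m + l\<close> to \<open>c + l\<close> has room for the loss; otherwise
    an order slightly above \<open>c + l\<close> lies beyond 1 and is kept in full.\<close>
  define m where "m = max \<alpha> 0"
  define c where "c = (m + 1 / 2) / 2"
  have m: "\<alpha> \<le> m" "0 \<le> m" "m < 1 / 2" using \<alpha> by (auto simp: m_def)
  then have c: "m < c" "c < 1 / 2" by (auto simp: c_def)
  show ?thesis
  proof (cases "c + l < 1")
    case True
    define t where "t = (m + c) / 2 + l"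
    have t: "\<alpha> + l < t" "0 \<le> t" "t < c + l" using m c l by (auto simp: t_def)
    have "wnorm2 t (fourier (\<lambda>x. \<eta> x * of_real (exp (- F x)))) < \<infinity>"
      by (rule weighted_fourier_less_top_of_exp[OF \<eta> P _ _ Pw F ab \<nu> t(2,3)]) (use m c l True in auto)
    with t(1) show ?thesis by blast
  next
    case False
    define r where "r = (c + 1 / 2) / 2" \<comment> \<open>larger than \<open>c\<close>, so that the order \<open>r + l\<close> exceeds 1\<close>
    have r: "c < r" "r < 1 / 2" "0 \<le> r" using m c by (auto simp: r_def)
    have "wnorm2 (r + l) (fourier (\<lambda>x. \<eta> x * of_real (exp (- F x)))) < \<infinity>"
      by (rule wnorm2_exp_of_large_order[OF \<eta> P _ Pw F ab \<nu>]) (use r False dim in auto)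
    moreover have "\<alpha> + l < r + l" using m c r by linarith
    ultimately show ?thesis by blast
  qed
qed

lemma cutoff_function_properties:
  fixes u :: "real^2 \<Rightarrow> real" and \<Omega> :: "(real^2) set"
  assumes u: "test_function u" and \<Omega>: "compact_smooth_domain \<Omega>" "\<Omega> \<subseteq> ball 0 1"
    and pos: "\<forall>x\<in>\<Omega>. u x > 0" and f: "f = (\<lambda>x. u x * indicator \<Omega> x)"
  shows "integrable lborel f" "\<exists>M. \<forall>x. 0 \<le> f x \<and> f x \<le> M" "AE x in lborel. isCont f x"
    and "\<And>r. 0 \<le> r \<Longrightarrow> r < 1 / 2 \<Longrightarrow> wnorm2 r (fourier (\<lambda>x. complex_of_real (f x))) < \<infinity>"
proof -
  have \<Omega>': "compact \<Omega>" "smooth_boundary \<Omega>" using \<Omega>(1) by (auto simp: compact_smooth_domain_def)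
  then have clo: "closed \<Omega>" by (simp add: compact_imp_closed)
  have sm: "smooth_on UNIV u" using u by (simp add: test_function_def)
  have [measurable]: "u \<in> borel_measurable borel" "\<Omega> \<in> sets borel"
    using test_function_borel_measurable[OF u] clo by auto
  have fm [measurable]: "f \<in> borel_measurable borel" unfolding f by measurable
  obtain M where M: "0 < M" "\<And>x. norm (u x) \<le> M" using test_function_bounded[OF u] by blast
  have f0: "0 \<le> f x" for x using pos by (auto simp: f indicator_def less_imp_le)
  have fM: "f x \<le> M" for x using M(2)[of x] M(1) by (auto simp: f indicator_def)
  show "\<exists>M. \<forall>x. 0 \<le> f x \<and> f x \<le> M" using f0 fM by blast
  have fs: "f x = 0" if "1 < norm x" for x using that \<Omega>(2) by (force simp: f indicator_def)
  show fi: "integrable lborel f"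
    by (rule integrable_bounded_support[OF fm _ fs, of M]) (use f0 fM in \<open>auto simp: abs_of_nonneg\<close>)
  \<comment> \<open>Off the frontier \<open>f\<close> agrees locally with \<open>u\<close> or with
    0, so its discontinuities lie in this null set.\<close>
  have "frontier \<Omega> \<in> null_sets lborel"
    by (intro linearly_covered_null frontier_linearly_covered \<Omega>') auto
  moreover have "isCont f x" if x: "x \<notin> frontier \<Omega>" for x
  proof (cases "x \<in> \<Omega>")
    case True
    then have "x \<in> interior \<Omega>" using x clo by (auto simp: frontier_def)
    then have "\<forall>\<^sub>F y in nhds x. f y = u y"
      unfolding eventually_nhds f using interior_subset[of \<Omega>] by (intro exI[of _ "interior \<Omega>"]) auto
    moreover have "isCont u x" using smooth_on_continuous[OF sm] by (simp add: continuous_on_eq_continuous_at)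
    ultimately show ?thesis using isCont_cong by blast
  next
    case False
    then have "\<forall>\<^sub>F y in nhds x. f y = 0"
      unfolding eventually_nhds f using clo by (intro exI[of _ "- \<Omega>"]) auto
    then show ?thesis using isCont_cong[of f "\<lambda>_. 0" x] by simp
  qed
  ultimately show "AE x in lborel. isCont f x"
    by (intro AE_I'[of "frontier \<Omega>"]) auto
  obtain C where C: "0 \<le> C" "\<And>h. norm h \<le> 1 \<Longrightarrow> (\<integral>\<^sup>+x. ennreal ((f (x + h) - f x)\<^sup>2) \<partial>lborel) \<le> ennreal (C * norm h)"
    using cutoff_difference_L2[OF sm \<Omega>' \<Omega>(2)] unfolding f by blast
  fix r :: real assume r: "0 \<le> r" "r < 1 / 2"
  show "wnorm2 r (fourier (\<lambda>x. complex_of_real (f x))) < \<infinity>"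
  proof (rule weighted_fourier_less_top_of_differences[OF _ _ _ r C(1)])
    show "integrable lborel (\<lambda>x. complex_of_real (f x))" using fi by (rule integrable_of_real)
    \<comment> \<open>The bound linear in the step is the difference hypothesis for order 1/2,
      whence every \<open>r < 1/2\<close>.\<close>
    show "(\<integral>\<^sup>+x. ennreal ((norm (complex_of_real (f (x + t *\<^sub>R b)) - of_real (f x)))\<^sup>2) \<partial>lborel) \<le> ennreal (C * t powr (2 * (1 / 2)))"
      if "b \<in> Basis" "0 < t" "t \<le> 1" for b t
      unfolding of_real_diff[symmetric] norm_of_real power2_abs using C(2)[of "t *\<^sub>R b"] that by simp
    have "(\<integral>\<^sup>+x. ennreal ((norm (complex_of_real (f x)))\<^sup>2) \<partial>lborel) \<le> (\<integral>\<^sup>+x. ennreal (norm (M * f x)) \<partial>lborel)"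
      using f0 fM M(1) by (intro nn_integral_mono ennreal_leI) (simp add: power2_eq_square abs_mult mult_right_mono)
    also have "\<dots> < \<infinity>" using integrable_mult_right[OF fi, of M] unfolding integrable_iff_bounded by blast
    finally show "(\<integral>\<^sup>+x. ennreal ((norm (complex_of_real (f x)))\<^sup>2) \<partial>lborel) < \<infinity>" .
  qed
qed

section \<open>From the transform as stated to \<open>conv\<close> and \<open>seg\<close>\<close>

lemma vline_eq_seg:
  assumes [measurable]: "f \<in> borel_measurable borel"
  shows "vline a b \<psi> \<nu> f x \<phi> = a * seg \<nu> (direction (\<phi> + 2 * \<psi> - pi / 2)) f x + b * seg \<nu> (direction (\<phi> - pi / 2)) f x"
proof -
  have "(LINT t:{0..\<nu>}|lebesgue. f (x + t *\<^sub>R d)) = seg \<nu> d f x" for d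
    unfolding set_lebesgue_integral_def seg_def real_scaleR_def by (rule integral_completion) measurable
  then show ?thesis by (simp add: vline_def)
qed

text \<open>The kernel \<open>k\<close> agrees with a Borel function only almost everywhere;
  reflection preserves null sets, so the representative may replace it at every \<open>x\<close>.
  The substitution \<open>z = x - y\<close> then exchanges the arguments.\<close>

lemma convol_eq_conv:
  fixes k K w :: "'a::euclidean_space \<Rightarrow> real"
  assumes [measurable]: "K \<in> borel_measurable borel" "w \<in> borel_measurable borel" and eq: "AE x in lborel. k x = K x"
  shows "convol k w x = conv K w x"
proof -
  have ae: "AE y in lebesgue. K (x - y) * w y = k (x - y) * w y"
    by (rule AE_completion) (use AE_lborel_reflect[OF eq, of x] in \<open>eventually_elim, simp\<close>)
  have m: "(\<lambda>y. K (x - y) * w y) \<in> borel_measurable lebesgue" by (rule measurable_completion) measurable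
  have "convol k w x = (LINT y|lebesgue. K (x - y) * w y)"
    unfolding convol_def using ae by (intro integral_cong_AE borel_measurable_AE[OF m ae] m) auto
  also have "\<dots> = (LINT y|lborel. K (x - y) * w y)" by (rule integral_completion) measurable
  also have "\<dots> = (LINT z|lborel. K z * w (x - z))"
    using lborel_integral_reflect[of "\<lambda>z. K z * w (x - z)" x] by simp
  finally show ?thesis by (simp add: conv_def)
qed

theorem theorem4p7:
  fixes a b \<psi> \<nu> \<phi> l \<alpha> :: real
    and \<Omega> :: "(real^2) set"
    and u f g k :: "real^2 \<Rightarrow> real"
    and \<eta> :: "real^2 \<Rightarrow> complex"
  assumes "a > 0" and "b > 0" and "0 < 2 * \<psi>" and "2 * \<psi> < pi" and "\<nu> > 0"
    and "compact_smooth_domain \<Omega>" and "\<Omega> \<subseteq> ball 0 1"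
    and "test_function u" and "\<forall>x\<in>\<Omega>. u x > 0"
    and "f = (\<lambda>x. u x * indicator \<Omega> x)"
    and "smoothing_kernel k" and "dist_of (\<lambda>x. of_real (k x)) \<in> H_space l \<infinity>"
    and "\<phi> \<in> {-pi..pi}"
    and "g = (\<lambda>x. exp (- smoothed_vline k a b \<psi> \<nu> f x \<phi>))"
    and "test_function \<eta>" and "\<alpha> < 1 / 2"
  shows "dist_of (\<lambda>x. \<eta> x * of_real (g x)) \<in> H_space (\<alpha> + l) 2 \<and>
         dist_of (\<lambda>x. \<eta> x * of_real (g x)) \<in> H_space (\<alpha> + l - 1) 1"
proof -
  note fp = cutoff_function_properties[OF assms(8,6,7,9,10)]
  obtain M where M: "\<And>x. 0 \<le> f x" "\<And>x. f x \<le> M" using fp(2) by blast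
  have fm [measurable]: "f \<in> borel_measurable borel" using fp(1) by auto
  have fb: "\<bar>f x\<bar> \<le> M" for x using M by simp
  have k: "\<And>x. 0 \<le> k x" "integrable lebesgue k" using assms(11) by (auto simp: smoothing_kernel_def)
  then have km: "k \<in> borel_measurable lebesgue" by auto
  then obtain K' where K': "K' \<in> borel_measurable lborel" "AE x in lborel. k x = K' x"
    using completion_ex_borel_measurable_real by blast
  \<comment> \<open>The absolute value makes the Borel representative nonnegative everywhere; it
    still equals \<open>k\<close> almost everywhere because \<open>k\<close> is nonnegative.\<close>
  define K where "K x = \<bar>K' x\<bar>" for x
  have Km [measurable]: "K \<in> borel_measurable borel" unfolding K_def using K'(1) by measurable
  have kK: "AE x in lborel. k x = K x" using K'(2) by eventually_elim (metis K_def abs_of_nonneg k(1))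
  then have kK': "AE x in lebesgue. k x = K x" by (rule AE_completion)
  have "K \<in> borel_measurable lebesgue" by (rule measurable_completion) simp
  then have "integrable lebesgue K" using k(2) kK' km by (subst integrable_cong_AE[of _ _ k]) auto
  then have Ki: "integrable lborel K" by (subst (asm) integrable_completion) auto
  have K0: "0 \<le> K x" for x by (simp add: K_def)
  have Kc: "integrable lborel (\<lambda>x. complex_of_real (K x))" using Ki by (rule integrable_of_real)
  \<comment> \<open>For negative \<open>l\<close> the exponent is 0 and the constant below is the
    L^1 norm of \<open>K\<close>; regularity obtained for \<open>l'\<close> implies that for
    \<open>l\<close>.\<close>
  define l' where "l' = max l 0"
  obtain C where C: "\<And>\<xi>. norm (fourier (\<lambda>x. complex_of_real (K x)) \<xi>) \<le> C * bracket \<xi> powr (- l' / 2)"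
  proof (cases "0 \<le> l")
    case True
    have "(\<lambda>x. complex_of_real (k x)) \<in> borel_measurable lebesgue" using km by measurable
    moreover have "AE x in lebesgue. complex_of_real (k x) = of_real (K x)" using kK' by eventually_elim simp
    ultimately show thesis
      using H_space_infinity_fourier_bound[OF Kc _ _ assms(12) True] that True by (metis l'_def max.absorb1)
  next
    case False
    show thesis
    proof (rule that)
      show "norm (fourier (\<lambda>x. complex_of_real (K x)) \<xi>) \<le> (LINT x|lborel. norm (complex_of_real (K x))) * bracket \<xi> powr (- l' / 2)" for \<xi>
        using norm_fourier_le[OF Kc, of \<xi>] False bracket_pos[of \<xi>] by (simp add: l'_def)
    qed
  qed
  let ?d1 = "direction (\<phi> + 2 * \<psi> - pi / 2)" and ?d2 = "direction (\<phi> - pi / 2)"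
  let ?F = "\<lambda>x. a * seg \<nu> ?d1 (conv K f) x + b * seg \<nu> ?d2 (conv K f) x"
  have "smoothed_vline k a b \<psi> \<nu> f x \<phi> = ?F x" for x
  proof -
    let ?w = "\<lambda>y. a * seg \<nu> ?d1 f y + b * seg \<nu> ?d2 f y"
    have s: "\<bar>seg \<nu> d f y\<bar> \<le> M * \<nu>" for d y
      using seg_le[OF fm M, of \<nu> d y] seg_nonneg[of f \<nu> d y] M assms(5) by simp
    have sm: "seg \<nu> d f \<in> borel_measurable borel" for d by measurable
    have "smoothed_vline k a b \<psi> \<nu> f x \<phi> = conv K ?w x"
      unfolding smoothed_vline_def vline_eq_seg[OF fm] by (rule convol_eq_conv[OF Km _ kK]) measurable
    also have "\<dots> = a * conv K (seg \<nu> ?d1 f) x + b * conv K (seg \<nu> ?d2 f) x"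
    proof -
      note i = integrable_conv_kernel[OF Ki sm s]
      have "conv K ?w x = (LINT z|lborel. a * (K z * seg \<nu> ?d1 f (x - z)) + b * (K z * seg \<nu> ?d2 f (x - z)))"
        unfolding conv_def by (intro Bochner_Integration.integral_cong refl) (simp add: algebra_simps)
      also have "\<dots> = a * conv K (seg \<nu> ?d1 f) x + b * conv K (seg \<nu> ?d2 f) x"
        unfolding conv_def by (subst Bochner_Integration.integral_add) (auto intro!: integrable_mult_right i)
      finally show ?thesis .
    qed
    also have "\<dots> = ?F x" by (simp only: seg_conv[OF Ki fm fb])
    finally show ?thesis .
  qed
  then have g: "(\<lambda>x. \<eta> x * of_real (g x)) = (\<lambda>x. \<eta> x * of_real (exp (- ?F x)))" using assms(14) by simp
  let ?G = "\<lambda>x. \<eta> x * complex_of_real (exp (- ?F x))"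
  obtain t where t: "\<alpha> + l' < t" "wnorm2 t (fourier ?G) < \<infinity>"
    using smoothed_exp_regularity[OF _ assms(15) Ki K0 C _ fp(1) M fp(3,4), of ?F a \<nu> ?d1 b ?d2 \<alpha>] assms(1,2,5,16)
    by (auto simp: l'_def)
  have [measurable]: "\<eta> \<in> borel_measurable borel" by (rule test_function_borel_measurable[OF assms(15)])
  have "0 \<le> ?F x" for x
    using assms(1,2) by (intro add_nonneg_nonneg mult_nonneg_nonneg seg_nonneg conv_bounds(1)[OF Ki K0 fm M]) auto
  then have "exp (- ?F x) \<le> 1" for x by (simp only: exp_le_one_iff neg_le_0_iff_le)
  then have Gle: "norm (?G x) \<le> norm (\<eta> x)" for x
    unfolding norm_mult norm_of_real abs_exp_cancel by (intro mult_left_le) simp_all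
  have Gi: "integrable lborel ?G"
    by (rule Bochner_Integration.integrable_bound[OF test_function_integrable[OF assms(15)] _ AE_I2[OF Gle]]) measurable
  have l: "l \<le> l'" by (simp add: l'_def)
  \<comment> \<open>Half the dimension is 1, so \<open>t > \<alpha> + l' \<ge> \<alpha> + l\<close>
    yields both conditions, \<open>\<alpha> + l \<le> t\<close> for L^2 and
    \<open>\<alpha> + l - 1 < t - 1\<close> for L^1.\<close>
  show ?thesis
    unfolding g
    using dist_of_in_H_space_2[OF Gi t(2), of "\<alpha> + l"]
      dist_of_in_H_space_1[OF Gi t(2), of "\<alpha> + l - 1"] t(1) l by auto
qed

end
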